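(* Let $V$ be a vertex algebra and $g$ an automorphism of $V$ with $g^T=1$ for some integer $T\ge 1$. The functor from the category of $\frac1T\mathbb N$-graded $g$-twisted $\phi$-coordinated $V$-modules to the category of graded $\tilde{\mathbf A}^{g,\infty}(V)$-modules, which sends $W=\bigoplus_{n}W(n)$ to the same graded space with $\tilde{\mathbf A}^{g,\infty}(V)$ acting through $\tilde\vartheta_W$ (and is the identity on underlying linear maps), is an isomorphism of categories.
   Context: All vector spaces are over $\mathbb C$; $\mathbb N=\{0,1,2,\dots\}$. For a vertex algebra $(V,Y,\mathbf 1)$ write $Y(v,x)=\sum_{n\in\mathbb Z}v_nx^{-n-1}$. For $r\in\{0,\dots,T-1\}$ put $V^r=\{v\in V: gv=e^{2\pi\sqrt{-1}r/T}v\}$, so $V=\bigoplus_r V^r$. A $g$-twisted $\phi$-coordinated $V$-module is a vector space $W$ with a linear map $Y_W(\cdot,x):V\to \mathrm{Hom}(W,W((x^{1/T})))$, $Y_W(v,x)=\sum_{n\in\frac1T\mathbb Z}v_nx^{-n-1}$, such that: (1) $Y_W(\mathbf 1,x)=\mathrm{id}_W$; (2) $Y_W(gv,x)$ is obtained from $Y_W(v,x)$ by substituting $x^{1/T}\mapsto e^{-2\pi\sqrt{-1}/T}x^{1/T}$, for all $v\in V$ (equivalently, $Y_W(u,x)w\in x^{-r/T}W((x))$ for $u\in V^r$, $w\in W$); (3) for all $u,v\in V$ there is $k\in\mathbb N$ with $(x_1-x_2)^kY_W(u,x_1)Y_W(v,x_2)\in \mathrm{Hom}(W,W((x_1^{1/T},x_2^{1/T})))$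 and $x_2^k(e^{x_0}-1)^kY_W(Y(u,x_0)v,x_2)=\big((x_1-x_2)^kY_W(u,x_1)Y_W(v,x_2)\big)|_{x_1^{1/T}=(x_2e^{x_0})^{1/T}}$. It is $\frac1T\mathbb N$-graded if equipped with a grading $W=\bigoplus_{n\in\frac1T\mathbb N}W(n)$ with $v_mW(n)\subseteq W(n-m-1)$ for all $v\in V$, $m\in\frac1T\mathbb Z$, $n\in\frac1T\mathbb N$ (where $W(i)=0$ for $i<0$). Morphisms are grading-preserving linear maps commuting with all $v_m$. For $k,l\in\{0,\dots,T-1\}$ let $\delta_k(l)=1$ if $k\ge l$, $0$ if $k<l$, and $\delta_k(T)=0$. Write $n\in\frac1T\mathbb Z$ as $n=\lfloor n\rfloor+\bar n/T$ with $\bar n\in\{0,\dots,T-1\}$. For $u\in V^r$, $v\in V$, $m,n,p\in\frac1T\mathbb N$ with $\bar p-\bar n\equiv r \pmod T$ set $$u\bullet_{g,m,p}^{n}v=\sum_{i=0}^{\lfloor p\rfloor}(-1)^i\binom{\lfloor m\rfloor+\lfloor n\rfloor-\lfloor p\rfloor-1+\delta_{\bar m}(r)+\delta_{\bar n}(T-r)+i}{i}\mathrm{Res}_y\frac{(1+y)^{-1+\lfloor m\rfloor+\delta_{\bar m}(r)+r/T}}{y^{\lfloor m\rfloor+\lfloor n\rfloor-\lfloor p\rfloor+\delta_{\bar m}(r)+\delta_{\bar n}(T-r)+i}}Y(u,\log(1+y))v,$$ and $u\bullet_{g,m,p}^nv=0$ if $\bar p-\bar n\not\equiv r \pmod T$;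 extend bilinearly. $U^{g,\infty}(V)$ is the space of matrices $[v_{kl}]_{k,l\in\frac1T\mathbb N}$ with entries in $V$ such that for each $l$ only finitely many $v_{kl}$ are nonzero; $[v]_{kl}$ is the matrix with $(k,l)$ entry $v$ and other entries $0$; $\mathbf 1^\infty$ is the diagonal matrix with diagonal entries $\mathbf 1$. The product is $(\mathfrak u\circledast_g\mathfrak v)_{kl}=\sum_{n\in\frac1T\mathbb N}u_{kn}\bullet_{g,l,n}^kv_{nl}$. For a $\frac1T\mathbb N$-graded $g$-twisted $\phi$-coordinated $V$-module $W$, the linear map $\tilde\vartheta_W:U^{g,\infty}(V)\to\mathrm{End}\,W$ is given by $\tilde\vartheta_W([v_{kl}])w=\sum_{k}\mathrm{Res}_x x^{n-k-1}Y_W(v_{kn},x)w$ for $w\in W(n)$; in particular $\tilde\vartheta_W([v]_{kl})w=\delta_{ln}\mathrm{Res}_xx^{l-k-1}Y_W(v,x)w$. Let $\tilde{\mathbf Q}^{g,\infty}(V)=\bigcap_W\ker\tilde\vartheta_W$ over all such $W$, and $\tilde{\mathbf A}^{g,\infty}(V)=U^{g,\infty}(V)/\tilde{\mathbf Q}^{g,\infty}(V)$, an associative algebra under $\circledast_g$ with identity $\mathbf 1^\infty+\tilde{\mathbf Q}^{g,\infty}(V)$, which acts on each such $W$ through $\tilde\vartheta_W$. A graded $\tilde{\mathbf A}^{g,\infty}(V)$-module is a (unital) $\tilde{\mathbf A}^{g,\infty}(V)$-module $G$ with a grading $G=\bigoplus_{n\in\frac1T\mathbb N}G(n)$ such that for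 all $v\in V$, $k,l\in\frac1T\mathbb N$ the class of $[v]_{kl}$ maps $G(l)$ into $G(k)$ and annihilates $G(n)$ for $n\ne l$. Morphisms are grading-preserving module homomorphisms.
   Formalization: A graded module is also required to have the class of [1]_{ll} act as the identity on G(l); without this the claim fails, e.g. for V=C, T=1, with G=G(0) the quotient of the product of copies of C by finite sequences. *)

theory Defs
  imports
    Complex_Main
    "HOL-Library.FuncSet"
    "HOL-Library.Groups_Big_Fun"
    "HOL-Library.Poly_Mapping"
    "HOL-Computational_Algebra.Formal_Laurent_Series"
    "HOL-Algebra.QuotRing"
begin

section \<open>Categories\<close>

text \<open>Hom-sets need not be disjoint, so identities, composition and the action of a functor on
  morphisms carry the objects involved as arguments.\<close>

record ('o, 'm) category =
  Obj :: "'o set"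
  Hom :: "'o \<Rightarrow> 'o \<Rightarrow> 'm set"
  Idn :: "'o \<Rightarrow> 'm"
  Comp :: "'o \<Rightarrow> 'o \<Rightarrow> 'o \<Rightarrow> 'm \<Rightarrow> 'm \<Rightarrow> 'm"  \<comment> \<open>\<open>Comp C X Y Z h f\<close> is \<open>h \<circ> f\<close> for \<open>f : X \<rightarrow> Y\<close>, \<open>h : Y \<rightarrow> Z\<close>\<close>

definition is_category :: "('o, 'm) category \<Rightarrow> bool" where
  "is_category C \<longleftrightarrow>
     (\<forall>X\<in>Obj C. Idn C X \<in> Hom C X X) \<and>
     (\<forall>X\<in>Obj C. \<forall>Y\<in>Obj C. \<forall>Z\<in>Obj C. \<forall>f\<in>Hom C X Y. \<forall>h\<in>Hom C Y Z. Comp C X Y Z h f \<in> Hom C X Z) \<and>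
     (\<forall>X\<in>Obj C. \<forall>Y\<in>Obj C. \<forall>f\<in>Hom C X Y. Comp C X X Y f (Idn C X) = f \<and> Comp C X Y Y (Idn C Y) f = f) \<and>
     (\<forall>X\<in>Obj C. \<forall>Y\<in>Obj C. \<forall>Z\<in>Obj C. \<forall>W\<in>Obj C. \<forall>f\<in>Hom C X Y. \<forall>h\<in>Hom C Y Z. \<forall>k\<in>Hom C Z W.
        Comp C X Y W (Comp C Y Z W k h) f = Comp C X Z W k (Comp C X Y Z h f))"

definition is_functor ::
    "('o, 'm) category \<Rightarrow> ('p, 'n) category \<Rightarrow> ('o \<Rightarrow> 'p) \<Rightarrow> ('o \<Rightarrow> 'o \<Rightarrow> 'm \<Rightarrow> 'n) \<Rightarrow> bool" where
  "is_functor C D Fo Fm \<longleftrightarrow>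
     is_category C \<and> is_category D \<and>
     (\<forall>X\<in>Obj C. Fo X \<in> Obj D) \<and>
     (\<forall>X\<in>Obj C. \<forall>Y\<in>Obj C. \<forall>f\<in>Hom C X Y. Fm X Y f \<in> Hom D (Fo X) (Fo Y)) \<and>
     (\<forall>X\<in>Obj C. Fm X X (Idn C X) = Idn D (Fo X)) \<and>
     (\<forall>X\<in>Obj C. \<forall>Y\<in>Obj C. \<forall>Z\<in>Obj C. \<forall>f\<in>Hom C X Y. \<forall>h\<in>Hom C Y Z.
        Fm X Z (Comp C X Y Z h f) = Comp D (Fo X) (Fo Y) (Fo Z) (Fm Y Z h) (Fm X Y f))"

definition is_category_isomorphism ::
    "('o, 'm) category \<Rightarrow> ('p, 'n) category \<Rightarrow> ('o \<Rightarrow> 'p) \<Rightarrow> ('o \<Rightarrow> 'o \<Rightarrow> 'm \<Rightarrow> 'n) \<Rightarrow> bool" where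
  "is_category_isomorphism C D Fo Fm \<longleftrightarrow>
     is_functor C D Fo Fm \<and>
     (\<exists>Go Gm. is_functor D C Go Gm \<and>
        (\<forall>X\<in>Obj C. Go (Fo X) = X) \<and>
        (\<forall>X\<in>Obj C. \<forall>Y\<in>Obj C. \<forall>f\<in>Hom C X Y. Gm (Fo X) (Fo Y) (Fm X Y f) = f) \<and>
        (\<forall>X\<in>Obj D. Fo (Go X) = X) \<and>
        (\<forall>X\<in>Obj D. \<forall>Y\<in>Obj D. \<forall>f\<in>Hom D X Y. Fm (Go X) (Go Y) (Gm X Y f) = f))"


section \<open>Graded vector spaces\<close>

text \<open>Modules live on subspaces of an ambient complex vector space given by a type of class
  \<^class>\<open>ab_group_add\<close> with a scalar multiplication \<open>s\<close>. A grading is a family \<open>G\<close> of subspaces whose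
  sum, the underlying space \<open>total_space G\<close>, is direct. Throughout, the index \<open>j\<close> (in \<^typ>\<open>nat\<close> or
  \<^typ>\<open>int\<close>) stands for the rational number \<open>j/T\<close>; thus \<open>G n\<close> is the space of degree \<open>n/T\<close>, and
  \<open>n div T\<close>, \<open>n mod T\<close> are the integer part and the numerator of the fractional part of \<open>n/T\<close>.\<close>

definition finite_family :: "(nat \<Rightarrow> 'w::ab_group_add set) \<Rightarrow> (nat \<Rightarrow> 'w) \<Rightarrow> bool" where
  "finite_family G f \<longleftrightarrow> (\<forall>n. f n \<in> G n) \<and> finite {n. f n \<noteq> 0}"

definition graded_space :: "(complex \<Rightarrow> 'w \<Rightarrow> 'w) \<Rightarrow> (nat \<Rightarrow> 'w::ab_group_add set) \<Rightarrow> bool" where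
  "graded_space s G \<longleftrightarrow>
     (\<forall>n. module.subspace s (G n)) \<and>
     (\<forall>f. finite_family G f \<and> Sum_any f = 0 \<longrightarrow> (\<forall>n. f n = 0))"

definition total_space :: "(nat \<Rightarrow> 'w::ab_group_add set) \<Rightarrow> 'w set" where
  "total_space G = {Sum_any f | f. finite_family G f}"

definition component :: "(nat \<Rightarrow> 'w::ab_group_add set) \<Rightarrow> 'w \<Rightarrow> nat \<Rightarrow> 'w" where
  "component G w = (THE f. finite_family G f \<and> Sum_any f = w)"

text \<open>Linear maps between subspaces are \<^const>\<open>undefined\<close> outside their domain, so that equality of
  maps is equality on the domain.\<close>

definition linear_maps :: "(complex \<Rightarrow> 'w \<Rightarrow> 'w) \<Rightarrow> 'w::ab_group_add set \<Rightarrow> 'w set \<Rightarrow> ('w \<Rightarrow> 'w) set" where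
  "linear_maps s A B = {f \<in> A \<rightarrow>\<^sub>E B.
     (\<forall>x\<in>A. \<forall>y\<in>A. f (x + y) = f x + f y) \<and> (\<forall>c. \<forall>x\<in>A. f (s c x) = s c (f x))}"

definition graded_linear_maps ::
    "(complex \<Rightarrow> 'w \<Rightarrow> 'w) \<Rightarrow> (nat \<Rightarrow> 'w::ab_group_add set) \<Rightarrow> (nat \<Rightarrow> 'w set) \<Rightarrow> ('w \<Rightarrow> 'w) set" where
  "graded_linear_maps s G H = {f \<in> linear_maps s (total_space G) (total_space H). \<forall>n. f ` G n \<subseteq> H n}"


section \<open>Algebras over the complex numbers and their modules\<close>

record 'a complex_algebra = "'a ring" +
  csmult :: "complex \<Rightarrow> 'a \<Rightarrow> 'a"

definition quotient_algebra :: "'a complex_algebra \<Rightarrow> 'a set \<Rightarrow> 'a set complex_algebra" where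
  "quotient_algebra U I =
     ring.extend (U Quot I) (complex_algebra.fields (\<lambda>c X. \<Union>a\<in>X. I +>\<^bsub>U\<^esub> csmult U c a))"

definition unital_module ::
    "'a complex_algebra \<Rightarrow> (complex \<Rightarrow> 'w \<Rightarrow> 'w) \<Rightarrow> 'w::ab_group_add set \<Rightarrow> ('a \<Rightarrow> 'w \<Rightarrow> 'w) \<Rightarrow> bool" where
  "unital_module A s M \<rho> \<longleftrightarrow>
     module.subspace s M \<and>
     \<rho> \<in> carrier A \<rightarrow>\<^sub>E linear_maps s M M \<and>
     (\<forall>a\<in>carrier A. \<forall>b\<in>carrier A. \<forall>w\<in>M. \<rho> (a \<oplus>\<^bsub>A\<^esub> b) w = \<rho> a w + \<rho> b w) \<and>
     (\<forall>c. \<forall>a\<in>carrier A. \<forall>w\<in>M. \<rho> (csmult A c a) w = s c (\<rho> a w)) \<and>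
     (\<forall>a\<in>carrier A. \<forall>b\<in>carrier A. \<forall>w\<in>M. \<rho> (a \<otimes>\<^bsub>A\<^esub> b) w = \<rho> a (\<rho> b w)) \<and>
     (\<forall>w\<in>M. \<rho> \<one>\<^bsub>A\<^esub> w = w)"


section \<open>Vertex algebras\<close>

text \<open>\<open>mode u n v\<close> is the coefficient \<open>u\<^sub>n v\<close> of \<open>x^(-n-1)\<close> in \<open>Y(u,x)v\<close>. The last axiom is the
  Jacobi identity in components (Borcherds identity); its sums are finite by truncation.\<close>

locale vertex_algebra = vector_space scale
  for scale :: "complex \<Rightarrow> 'v::ab_group_add \<Rightarrow> 'v" (infixr \<open>*v\<close> 75) +
  fixes mode :: "'v \<Rightarrow> int \<Rightarrow> 'v \<Rightarrow> 'v"
    and vac :: 'v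
  assumes mode_add_left: "mode (u + u') n v = mode u n v + mode u' n v"
    and mode_scale_left: "mode (c *v u) n v = c *v mode u n v"
    and mode_add_right: "mode u n (v + v') = mode u n v + mode u n v'"
    and mode_scale_right: "mode u n (c *v v) = c *v mode u n v"
    and truncation: "\<exists>N. \<forall>n\<ge>N. mode u n v = 0"
    and vacuum: "mode vac n v = (if n = - 1 then v else 0)"
    and creation: "mode v (- 1) vac = v" "n \<ge> 0 \<Longrightarrow> mode v n vac = 0"
    and jacobi:
      "Sum_any (\<lambda>i::nat. ((of_int p :: complex) gchoose i) *v mode (mode u (q + int i) v) (p + r - int i) w) =
       Sum_any (\<lambda>i::nat. ((- 1) ^ i * ((of_int q :: complex) gchoose i)) *v
         (mode u (p + q - int i) (mode v (r + int i) w)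
          - ((- 1) powi q) *v mode v (q + r - int i) (mode u (p + int i) w)))"

definition (in vertex_algebra) automorphism :: "('v \<Rightarrow> 'v) \<Rightarrow> bool" where
  "automorphism g \<longleftrightarrow>
     bij g \<and> (\<forall>u v. g (u + v) = g u + g v) \<and> (\<forall>c v. g (c *v v) = c *v g v) \<and>
     g vac = vac \<and> (\<forall>u n v. g (mode u n v) = mode (g u) n (g v))"

locale vertex_algebra_with_automorphism = vertex_algebra scale mode vac
  for scale :: "complex \<Rightarrow> 'v::ab_group_add \<Rightarrow> 'v" (infixr \<open>*v\<close> 75)
    and mode :: "'v \<Rightarrow> int \<Rightarrow> 'v \<Rightarrow> 'v"
    and vac :: 'v +
  fixes g :: "'v \<Rightarrow> 'v"
    and T :: nat
  assumes g_automorphism: "automorphism g"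
    and T_pos: "T \<ge> 1"
    and g_power: "g ^^ T = id"
begin

definition eigenspace :: "nat \<Rightarrow> 'v set" where
  "eigenspace r =
     (if r < T then {v. g v = exp (2 * of_real pi * \<i> * of_nat r / of_nat T) *v v} else {0})"


section \<open>Twisted phi-coordinated modules\<close>

text \<open>A family of operators \<open>Y v j\<close> encodes \<open>Y\<^sub>W(v,x) = \<Sum>\<^sub>j (Y v j) x^(-j/T-1)\<close>. Accordingly
  \<open>coeff Y v a\<close> is the coefficient of \<open>x^(a/T)\<close> in \<open>Y\<^sub>W(v,x)\<close>, and \<open>product_coeff s Y k u v a b\<close> is
  the coefficient of \<open>x\<^sub>1^(a/T) x\<^sub>2^(b/T)\<close> in \<open>(x\<^sub>1-x\<^sub>2)^k Y\<^sub>W(u,x\<^sub>1) Y\<^sub>W(v,x\<^sub>2)\<close>.\<close>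

definition coeff :: "('v \<Rightarrow> int \<Rightarrow> 'w \<Rightarrow> 'w) \<Rightarrow> 'v \<Rightarrow> int \<Rightarrow> 'w \<Rightarrow> 'w" where
  "coeff Y v a = Y v (- a - int T)"

definition product_coeff ::
    "(complex \<Rightarrow> 'w \<Rightarrow> 'w) \<Rightarrow> ('v \<Rightarrow> int \<Rightarrow> 'w \<Rightarrow> 'w::ab_group_add) \<Rightarrow> nat \<Rightarrow> 'v \<Rightarrow> 'v \<Rightarrow> int \<Rightarrow> int \<Rightarrow> 'w \<Rightarrow> 'w" where
  "product_coeff s Y k u v a b w =
     (\<Sum>i\<le>k. s ((- 1) ^ i * of_nat (k choose i))
        (coeff Y u (a - int T * int (k - i)) (coeff Y v (b - int T * int i) w)))"

text \<open>The last clause compares, for all \<open>c\<close> and \<open>d\<close>, the coefficients of \<open>x\<^sub>2^(c/T) x\<^sub>0^d\<close> in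
  \<open>x\<^sub>2^k (e^(x\<^sub>0) - 1)^k Y\<^sub>W(Y(u,x\<^sub>0)v,x\<^sub>2)w\<close>, where \<open>x\<^sub>0^d = x\<^sub>0^i x\<^sub>0^(-n-1)\<close> for \<open>n = i - d - 1\<close>, and
  in the image of \<open>(x\<^sub>1-x\<^sub>2)^k Y\<^sub>W(u,x\<^sub>1) Y\<^sub>W(v,x\<^sub>2)w\<close> under
  \<open>x\<^sub>1^(a/T) \<mapsto> x\<^sub>2^(a/T) e^(a x\<^sub>0/T)\<close>. All sums have only finitely many nonzero terms.\<close>

definition graded_phi_module ::
    "(complex \<Rightarrow> 'w \<Rightarrow> 'w) \<Rightarrow> (nat \<Rightarrow> 'w::ab_group_add set) \<Rightarrow> ('v \<Rightarrow> int \<Rightarrow> 'w \<Rightarrow> 'w) \<Rightarrow> bool" where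
  "graded_phi_module s G Y \<longleftrightarrow>
     graded_space s G \<and>
     (\<forall>v j. Y v j \<in> linear_maps s (total_space G) (total_space G)) \<and>
     (\<forall>u v j. \<forall>w\<in>total_space G. Y (u + v) j w = Y u j w + Y v j w) \<and>
     (\<forall>c v j. \<forall>w\<in>total_space G. Y (c *v v) j w = s c (Y v j w)) \<and>
     (\<forall>v. \<forall>w\<in>total_space G. \<exists>N. \<forall>j\<ge>N. Y v j w = 0) \<and>
     (\<forall>v j n. \<forall>w\<in>G n.
        if int n - j - int T \<ge> 0 then Y v j w \<in> G (nat (int n - j - int T)) else Y v j w = 0) \<and>
     (\<forall>a. \<forall>w\<in>total_space G. coeff Y vac a w = (if a = 0 then w else 0)) \<and>
     (\<forall>v a. \<forall>w\<in>total_space G. coeff Y (g v) a w = s (exp (- 2 * of_real pi * \<i> / of_nat T) powi a) (coeff Y v a w)) \<and>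
     (\<forall>u v. \<exists>k.
        (\<forall>w\<in>total_space G. \<exists>N. \<forall>a b. a < N \<or> b < N \<longrightarrow> product_coeff s Y k u v a b w = 0) \<and>
        (\<forall>w\<in>total_space G. \<forall>c d::int.
           Sum_any (\<lambda>i::nat. s (fps_nth ((fps_exp 1 - 1) ^ k) i)
             (coeff Y (mode u (int i - d - 1) v) (c - int T * int k) w)) =
           Sum_any (\<lambda>a::int. s (if d < 0 then 0 else (of_int a / of_nat T) ^ nat d / fact (nat d))
             (product_coeff s Y k u v a (c - a) w))))"

definition phi_module_category ::
    "(complex \<Rightarrow> 'w \<Rightarrow> 'w) \<Rightarrow> ((nat \<Rightarrow> 'w::ab_group_add set) \<times> ('v \<Rightarrow> int \<Rightarrow> 'w \<Rightarrow> 'w), 'w \<Rightarrow> 'w) category" where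
  "phi_module_category s =
     \<lparr>Obj = {(G, Y). graded_phi_module s G Y},
      Hom = \<lambda>(G, Y) (G', Y'). {f \<in> graded_linear_maps s G G'. \<forall>v j. \<forall>w\<in>total_space G. f (Y v j w) = Y' v j (f w)},
      Idn = \<lambda>(G, _). \<lambda>w\<in>total_space G. w,
      Comp = \<lambda>(G, _) _ _ h f. compose (total_space G) h f\<rparr>"


section \<open>The algebra of column-finite matrices and its quotient\<close>

definition delta :: "nat \<Rightarrow> nat \<Rightarrow> int" where
  "delta k l = (if k \<ge> l then 1 else 0)"

text \<open>\<open>residue_product a e u v\<close> is \<open>Res\<^sub>y (1+y)^a y^(-e) Y(u,log(1+y))v\<close>, with
  \<open>Y(u,log(1+y))v = \<Sum>\<^sub>n u\<^sub>n v (log(1+y))^(-n-1)\<close> expanded in \<open>y\<close>.\<close>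

definition residue_product :: "complex \<Rightarrow> int \<Rightarrow> 'v \<Rightarrow> 'v \<Rightarrow> 'v" where
  "residue_product a e u v =
     Sum_any (\<lambda>n::int.
       fls_residue (fps_to_fls (fps_binomial a) * fls_X_intpow (- e) * fps_to_fls (fps_ln 1) powi (- n - 1))
         *v mode u n v)"

text \<open>The product for \<open>u\<close> in \<open>eigenspace r\<close> with \<open>p - n\<close> congruent to \<open>r\<close> modulo \<open>T\<close>.\<close>

definition bullet_homogeneous :: "nat \<Rightarrow> nat \<Rightarrow> nat \<Rightarrow> nat \<Rightarrow> 'v \<Rightarrow> 'v \<Rightarrow> 'v" where
  "bullet_homogeneous r m p n u v =
     (let d = delta (m mod T) r;
          e = int (m div T) + int (n div T) - int (p div T) + d + delta (n mod T) (T - r);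
          a = - 1 + of_nat (m div T) + of_int d + of_nat r / of_nat T
      in \<Sum>i\<le>p div T. ((- 1) ^ i * ((of_int (e - 1 + int i) :: complex) gchoose i))
           *v residue_product a (e + int i) u v)"

text \<open>Only the component of \<open>u\<close> in \<open>eigenspace r\<close> with \<open>r\<close> congruent to \<open>p - n\<close> contributes to the
  bilinear extension.\<close>

definition bullet :: "nat \<Rightarrow> nat \<Rightarrow> nat \<Rightarrow> 'v \<Rightarrow> 'v \<Rightarrow> 'v" where
  "bullet m p n u v =
     (\<Sum>r<T. if (int p - int n) mod int T = int r
             then bullet_homogeneous r m p n (component eigenspace u r) v else 0)"

definition elementary :: "nat \<Rightarrow> nat \<Rightarrow> 'v \<Rightarrow> nat \<Rightarrow> nat \<Rightarrow> 'v" where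
  "elementary k l v = (\<lambda>i j. if i = k \<and> j = l then v else 0)"

definition matrix_algebra :: "(nat \<Rightarrow> nat \<Rightarrow> 'v) complex_algebra" where
  "matrix_algebra =
     \<lparr>carrier = {a. \<forall>l. finite {k. a k l \<noteq> 0}},
      mult = \<lambda>a b k l. Sum_any (\<lambda>n. bullet l n k (a k n) (b n l)),
      one = \<lambda>k l. if k = l then vac else 0,
      zero = \<lambda>k l. 0,
      add = \<lambda>a b k l. a k l + b k l,
      csmult = \<lambda>c a k l. c *v a k l\<rparr>"

text \<open>On \<open>G n\<close>, \<open>Res\<^sub>x x^((n-k)/T-1) Y\<^sub>W(v,x)\<close> is the operator \<open>Y v (n - k - T)\<close>.\<close>

definition theta ::
    "(nat \<Rightarrow> 'w::ab_group_add set) \<Rightarrow> ('v \<Rightarrow> int \<Rightarrow> 'w \<Rightarrow> 'w) \<Rightarrow> (nat \<Rightarrow> nat \<Rightarrow> 'v) \<Rightarrow> 'w \<Rightarrow> 'w" where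
  "theta G Y a = (\<lambda>w\<in>total_space G.
     Sum_any (\<lambda>n. Sum_any (\<lambda>k. Y (a k n) (int n - int k - int T) (component G w n))))"

text \<open>The intersection of the kernels over all modules. A matrix acts by zero on a module if and only
  if it does so on all graded submodules generated by one homogeneous element \<open>w\<close>. Such a submodule is
  spanned by the images of \<open>w\<close> under products of operators \<open>Y v j\<close>, which are indexed by words in
  pairs \<open>(v, j)\<close>; hence it is isomorphic to a module on a subspace of the free vector space on these
  words, and it suffices to let the modules range over those.\<close>

definition kernel_ideal :: "(nat \<Rightarrow> nat \<Rightarrow> 'v) set" where
  "kernel_ideal = {a \<in> carrier matrix_algebra.
     \<forall>(G :: nat \<Rightarrow> (('v \<times> int) list \<Rightarrow>\<^sub>0 complex) set) Y.
       graded_phi_module (\<lambda>c. Poly_Mapping.map ((*) c)) G Y \<longrightarrow> (\<forall>w\<in>total_space G. theta G Y a w = 0)}"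

definition A_algebra :: "(nat \<Rightarrow> nat \<Rightarrow> 'v) set complex_algebra" where
  "A_algebra = quotient_algebra matrix_algebra kernel_ideal"

definition quotient_class :: "(nat \<Rightarrow> nat \<Rightarrow> 'v) \<Rightarrow> (nat \<Rightarrow> nat \<Rightarrow> 'v) set" where
  "quotient_class a = kernel_ideal +>\<^bsub>matrix_algebra\<^esub> a"


section \<open>Graded modules for the quotient algebra\<close>

text \<open>Unitality is understood degree by degree, i.e. through the decomposition of the identity matrix
  as the infinite sum of the matrices \<open>elementary l l vac\<close>: the last clause says that the \<open>l\<close>-th summand
  acts as the identity on \<open>G l\<close>. This is not implied by the other clauses, since linearity does not
  reach infinite sums: without it there are modules, such as (for the one-dimensional vertex algebra,
  where the algebra is the product of countably many copies of the complex numbers) the quotient of the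
  algebra by the ideal of finite sequences, placed in degree 0, on which every elementary matrix acts
  as zero.\<close>

definition graded_A_module ::
    "(complex \<Rightarrow> 'w \<Rightarrow> 'w) \<Rightarrow> (nat \<Rightarrow> 'w::ab_group_add set) \<Rightarrow> ((nat \<Rightarrow> nat \<Rightarrow> 'v) set \<Rightarrow> 'w \<Rightarrow> 'w) \<Rightarrow> bool" where
  "graded_A_module s G \<rho> \<longleftrightarrow>
     graded_space s G \<and>
     unital_module A_algebra s (total_space G) \<rho> \<and>
     (\<forall>v k l. \<forall>w\<in>G l. \<rho> (quotient_class (elementary k l v)) w \<in> G k) \<and>
     (\<forall>v k l n. n \<noteq> l \<longrightarrow> (\<forall>w\<in>G n. \<rho> (quotient_class (elementary k l v)) w = 0)) \<and>
     (\<forall>l. \<forall>w\<in>G l. \<rho> (quotient_class (elementary l l vac)) w = w)"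

definition A_module_category ::
    "(complex \<Rightarrow> 'w \<Rightarrow> 'w) \<Rightarrow>
     ((nat \<Rightarrow> 'w::ab_group_add set) \<times> ((nat \<Rightarrow> nat \<Rightarrow> 'v) set \<Rightarrow> 'w \<Rightarrow> 'w), 'w \<Rightarrow> 'w) category" where
  "A_module_category s =
     \<lparr>Obj = {(G, \<rho>). graded_A_module s G \<rho>},
      Hom = \<lambda>(G, \<rho>) (G', \<rho>'). {f \<in> graded_linear_maps s G G'.
              \<forall>X\<in>carrier A_algebra. \<forall>w\<in>total_space G. f (\<rho> X w) = \<rho>' X (f w)},
      Idn = \<lambda>(G, _). \<lambda>w\<in>total_space G. w,
      Comp = \<lambda>(G, _) _ _ h f. compose (total_space G) h f\<rparr>"

text \<open>The action of a class is the common value of \<^term>\<open>theta G Y\<close> on its representatives.\<close>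

definition A_module_of ::
    "(nat \<Rightarrow> 'w::ab_group_add set) \<times> ('v \<Rightarrow> int \<Rightarrow> 'w \<Rightarrow> 'w) \<Rightarrow>
     (nat \<Rightarrow> 'w set) \<times> ((nat \<Rightarrow> nat \<Rightarrow> 'v) set \<Rightarrow> 'w \<Rightarrow> 'w)" where
  "A_module_of = (\<lambda>(G, Y). (G, \<lambda>X\<in>carrier A_algebra. the_elem (theta G Y ` X)))"

end

end

theory Submission
  imports Defs
begin

unbundle fps_syntax

text \<open>The coefficients of \<open>Y\<^sub>W(u,x\<^sub>1)Y\<^sub>W(v,x\<^sub>2)w\<close> of a fixed total degree form a series \<open>H(z)\<close>, \<open>z = x\<^sub>1/x\<^sub>2\<close>,
  bounded above in \<open>z\<close> because \<open>W\<close> is graded. Multiplied by a power of \<open>z\<close> and by \<open>(z - 1)\<^sup>k\<close>, it becomes a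
  polynomial whose expansion at \<open>z = 1 + y\<close> is \<open>y\<^sup>k (1 + y)\<^sup>M Y\<^sub>W(Y(u,log(1 + y))v,x\<^sub>2)w\<close>; weak
  commutativity, which follows from skew symmetry, bounds its powers of \<open>z\<close> from below. Expanding
  the resulting Laurent polynomial in \<open>z - 1\<close> at \<open>z = \<infinity>\<close> gives the product formula defining
  \<open>bullet\<close>, together with the vanishing of the coefficients of high powers of \<open>z - 1\<close>. Conversely
  these two families of relations imply the axiom of twisted modules, with an exponent \<open>k\<close> that depends
  only on \<open>u\<close> and \<open>v\<close>. Both are relations between elementary matrices modulo the kernel ideal, so
  they hold in every graded module of the quotient algebra. Identities between vectors are checked by
  applying linear functionals, which reduces them to complex Laurent series.\<close>

section \<open>Exponential sums and iterated differences\<close>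

text \<open>The module axiom asks for some \<open>k\<close>, so it is not a relation in an algebra;
  the obstacle is to trade it for relations without \<open>k\<close>. Let \<open>u\<close> lie in
  \<open>eigenspace r\<close> and let a vector of degree m/T be mapped to degree n/T. In units of
  1/T the exponents of z in H are congruent to - r modulo \<open>T\<close>. With
  \<open>least_power r m\<close> the largest integer that is congruent to \<open>r\<close> and at
  most \<open>m\<close>, the factor z^M for M = \<open>twist_power r m\<close> makes them integral,
  and nonnegative once (z - 1)^k is applied. The intermediate degree cannot be negative, which stops
  them at the integer part of (n + \<open>least_power r m\<close>)/T, that is at
  \<open>degree_bound r m n - 1\<close>. So z^M H is a Laurent polynomial in z - 1 with exponents
  below \<open>degree_bound\<close>, a statement free of \<open>k\<close>. On the way back
  \<open>k\<close> is read off from the pole of Y(u,x)v and so is the same for all vectors. A second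
  obstacle: linearity does not reduce the action of an infinite matrix to that of its entries.
  Multiplying by \<open>elementary m m vac\<close> cuts out one finite column, and this determines
  the action on degree m/T.\<close>

text \<open>The coefficient of z^(a/h) in (z - 1)^k F, where F is the formal series with coefficient
  \<open>F a\<close> at z^(a/h); two-sided infinite series are allowed. It is used with
  \<open>h = T\<close> for fractional powers and with \<open>h = 1\<close> once these have been
  removed.\<close>

definition sdiff :: "nat \<Rightarrow> nat \<Rightarrow> (int \<Rightarrow> complex) \<Rightarrow> int \<Rightarrow> complex" where
  "sdiff h k F a = (\<Sum>i\<le>k. (- 1) ^ i * of_nat (k choose i) * F (a - int h * int (k - i)))"

lemma sdiff_0 [simp]: "sdiff h 0 F = F"
  by (simp add: sdiff_def fun_eq_iff)

lemma sdiff_Suc: "sdiff h (Suc k) F a = sdiff h k F (a - int h) - sdiff h k F a"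
proof -
  define G where "G = (\<lambda>i. F (a - int h * int (Suc k - i)))"
  have "sdiff h (Suc k) F a = (\<Sum>i\<le>Suc k. (- 1) ^ i * of_nat (Suc k choose i) * G i)"
    by (simp add: sdiff_def G_def)
  also have "\<dots> = G 0 + (\<Sum>i\<le>k. (- 1) ^ Suc i * of_nat (Suc k choose Suc i) * G (Suc i))"
    by (subst sum.atMost_Suc_shift) simp
  also have "(\<Sum>i\<le>k. (- 1) ^ Suc i * of_nat (Suc k choose Suc i) * G (Suc i)) =
     (\<Sum>i\<le>k. (- 1) ^ Suc i * of_nat (k choose Suc i) * G (Suc i)) -
     (\<Sum>i\<le>k. (- 1) ^ i * of_nat (k choose i) * G (Suc i))"
    unfolding sum_subtractf [symmetric] binomial_Suc_Suc of_nat_add power_Suc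
    by (intro sum.cong refl, simp only: distrib_left distrib_right mult_minus_left mult_1_left) simp
  also have "G 0 + ((\<Sum>i\<le>k. (- 1) ^ Suc i * of_nat (k choose Suc i) * G (Suc i)) -
     (\<Sum>i\<le>k. (- 1) ^ i * of_nat (k choose i) * G (Suc i))) =
     (\<Sum>i\<le>Suc k. (- 1) ^ i * of_nat (k choose i) * G i) -
     (\<Sum>i\<le>k. (- 1) ^ i * of_nat (k choose i) * G (Suc i))"
    by (subst sum.atMost_Suc_shift) simp
  also have "(\<Sum>i\<le>Suc k. (- 1) ^ i * of_nat (k choose i) * G i) = sdiff h k F (a - int h)"
    by (auto simp: sdiff_def G_def of_nat_diff Suc_diff_le algebra_simps intro!: sum.cong)
  also have "(\<Sum>i\<le>k. (- 1) ^ i * of_nat (k choose i) * G (Suc i)) = sdiff h k F a"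
    by (simp add: sdiff_def G_def)
  finally show ?thesis .
qed

lemma sdiff_add: "sdiff h k (\<lambda>a. F a + G a) a = sdiff h k F a + sdiff h k G a"
  by (simp add: sdiff_def sum.distrib algebra_simps)

lemma sdiff_diff: "sdiff h k (\<lambda>a. F a - G a) a = sdiff h k F a - sdiff h k G a"
  by (simp add: sdiff_def sum_subtractf algebra_simps)

lemma sdiff_sum: "finite S \<Longrightarrow> sdiff h k (\<lambda>a. \<Sum>x\<in>S. F x a) a = (\<Sum>x\<in>S. sdiff h k (F x) a)"
  by (induction S rule: finite_induct) (simp_all add: sdiff_add, simp add: sdiff_def)

lemma sdiff_cmult: "sdiff h k (\<lambda>a. c * F a) a = c * sdiff h k F a"
  by (simp add: sdiff_def sum_distrib_left algebra_simps)

text \<open>Since (z - 1)^k = (- 1)^k z^k (1/z - 1)^k; the factor z^k is the shift by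
  \<open>int h * int k\<close>.\<close>

lemma sdiff_reflect:
  "sdiff h k (\<lambda>a. F (c - a)) a = (- 1) ^ k * sdiff h k F (c + int h * int k - a)"
proof -
  have "sdiff h k (\<lambda>a. F (c - a)) a = (\<Sum>i\<le>k. (- 1) ^ i * of_nat (k choose i) * F (c - (a - int h * int (k - i))))"
    by (simp add: sdiff_def)
  also have "\<dots> = (\<Sum>i\<le>k. (- 1) ^ (k - i) * of_nat (k choose (k - i)) * F (c - (a - int h * int (k - (k - i)))))"
    by (rule sum.reindex_bij_witness[of _ "\<lambda>i. k - i" "\<lambda>i. k - i"]) auto
  also have "\<dots> = (\<Sum>i\<le>k. (- 1) ^ k * ((- 1) ^ i * of_nat (k choose i) * F (c + int h * int k - a - int h * int (k - i))))"
  proof (intro sum.cong refl)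
    fix i assume "i \<in> {..k}"
    then have i: "i \<le> k" by simp
    have "c - (a - int h * int (k - (k - i))) = c + int h * int k - a - int h * int (k - i)"
      using i by (simp add: of_nat_diff algebra_simps)
    moreover have "(- 1) ^ (k - i) = (- 1) ^ k * (- 1 :: complex) ^ i"
      using i by (metis (no_types, lifting) add_diff_cancel_right' le_add_diff_inverse2 left_minus_one_mult_self mult.commute power_add)
    ultimately show "(- 1) ^ (k - i) * of_nat (k choose (k - i)) * F (c - (a - int h * int (k - (k - i)))) =
       (- 1) ^ k * ((- 1) ^ i * of_nat (k choose i) * F (c + int h * int k - a - int h * int (k - i)))"
      using i by (simp only: binomial_symmetric[symmetric] mult.assoc)
  qed
  finally show ?thesis by (simp add: sdiff_def sum_distrib_left)
qed

lemma sdiff_eq_0_above: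
  assumes "\<And>t. t \<ge> e \<Longrightarrow> f t = 0" and "t \<ge> e + int h * int k"
  shows "sdiff h k f t = 0"
  unfolding sdiff_def
proof (intro sum.neutral ballI)
  fix i
  have "int h * int (k - i) \<le> int h * int k"
    by (intro mult_left_mono) auto
  then show "(- 1) ^ i * of_nat (k choose i) * f (t - int h * int (k - i)) = 0"
    using assms by simp
qed

lemma sdiff_eq_0_below:
  assumes "\<And>t. t < e \<Longrightarrow> f t = 0" and "t < e"
  shows "sdiff h k f t = 0"
  unfolding sdiff_def
proof (intro sum.neutral ballI)
  fix i
  have "int h * int (k - i) \<ge> 0"
    by (intro mult_nonneg_nonneg) auto
  then have "t - int h * int (k - i) < e" using assms(2) by linarith
  then show "(- 1) ^ i * of_nat (k choose i) * f (t - int h * int (k - i)) = 0"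
    using assms by simp
qed

text \<open>Multiplication by (z - 1)^k is injective on series that are bounded above. Two-sided
  series can be killed by z - 1, for instance the constant sequence. In the induction
  \<open>sdiff 1 k d\<close> is constant and vanishes far up, hence everywhere.\<close>

lemma sdiff_inj:
  fixes d :: "int \<Rightarrow> complex" and e t :: int
  assumes "\<And>t. sdiff 1 k d t = 0" and d: "\<And>t. t \<ge> e \<Longrightarrow> d t = 0"
  shows "d t = 0"
  using assms(1)
proof (induction k arbitrary: t)
  case (Suc k)
  have step: "sdiff 1 k d (t - 1) = sdiff 1 k d t" for t
    using Suc.prems[of t] by (simp add: sdiff_Suc)
  have "sdiff 1 k d t = 0" for t
  proof (cases "t \<ge> e + int k")
    case True
    then show ?thesis using sdiff_eq_0_above[where e = e and f = d and t = t and h = 1 and k = k] d by simp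
  next
    case False
    then have "t \<le> e + int k" by simp
    then show ?thesis
    proof (induction t rule: int_le_induct)
      case base
      then show ?case using sdiff_eq_0_above[where e = e and f = d and t = "e + int k" and h = 1 and k = k] d by simp
    next
      case (step i)
      then show ?case using \<open>\<And>t. sdiff 1 k d (t - 1) = sdiff 1 k d t\<close> by simp
    qed
  qed
  then show ?case by (rule Suc.IH)
qed simp

section \<open>Substituting an exponential into a Laurent polynomial\<close>

text \<open>The value of the Laurent polynomial with coefficients \<open>P a\<close> at z^(1/h) =
  e^(x/h). \<open>Sum_any\<close> is the intended sum only for finitely many nonzero
  \<open>P a\<close>, so finiteness is carried along in the lemmas.\<close>

definition expsum :: "nat \<Rightarrow> (int \<Rightarrow> complex) \<Rightarrow> complex fps" where
  "expsum h P = Sum_any (\<lambda>a. fps_const (P a) * fps_exp (of_int a / of_nat h))"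

lemma expsum_superset:
  assumes "finite S" "{a. P a \<noteq> 0} \<subseteq> S"
  shows "expsum h P = (\<Sum>a\<in>S. fps_const (P a) * fps_exp (of_int a / of_nat h))"
  unfolding expsum_def using assms by (intro Sum_any.expand_superset) auto

lemma expsum_add:
  assumes "finite {a. P a \<noteq> 0}" "finite {a. Q a \<noteq> 0}"
  shows "expsum h (\<lambda>a. P a + Q a) = expsum h P + expsum h Q"
proof -
  define S where "S = {a. P a \<noteq> 0} \<union> {a. Q a \<noteq> 0}"
  have S: "finite S" using assms by (simp add: S_def)
  then show ?thesis
    by (subst (1 2 3) expsum_superset[OF S])
       (auto simp: S_def sum.distrib algebra_simps simp flip: fps_const_add)
qed

lemma expsum_cmult:
  assumes "finite {a. P a \<noteq> 0}"
  shows "expsum h (\<lambda>a. c * P a) = fps_const c * expsum h P"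
  by (subst (1 2) expsum_superset[OF assms])
     (auto simp: sum_distrib_left mult.assoc simp flip: fps_const_mult)

lemma expsum_diff:
  assumes "finite {a. P a \<noteq> 0}" "finite {a. Q a \<noteq> 0}"
  shows "expsum h (\<lambda>a. P a - Q a) = expsum h P - expsum h Q"
  using expsum_add[of P "\<lambda>a. (- 1) * Q a" h] expsum_cmult[of Q h "- 1"] assms
  by (simp add: fps_const_neg[symmetric] del: fps_const_neg)

lemma expsum_sum:
  assumes "finite S" "\<And>x. x \<in> S \<Longrightarrow> finite {a. P x a \<noteq> 0}"
  shows "expsum h (\<lambda>a. \<Sum>x\<in>S. P x a) = (\<Sum>x\<in>S. expsum h (P x)) \<and> finite {a. (\<Sum>x\<in>S. P x a) \<noteq> 0}"
  using assms
proof (induction S rule: finite_induct)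
  case empty
  then show ?case by (simp add: expsum_def)
next
  case (insert x S)
  then have fin: "finite ({a. P x a \<noteq> 0} \<union> {a. (\<Sum>x\<in>S. P x a) \<noteq> 0})" by simp
  have "finite {a. P x a + (\<Sum>x\<in>S. P x a) \<noteq> 0}"
    by (rule finite_subset[OF _ fin]) auto
  with insert show ?case by (simp add: expsum_add)
qed

lemma expsum_shift:
  assumes fin: "finite {a. P a \<noteq> 0}"
  shows "expsum h (\<lambda>a. P (a - c)) = fps_exp (of_int c / of_nat h) * expsum h P"
proof -
  let ?S = "{a. P a \<noteq> 0}"
  have "expsum h (\<lambda>a. P (a - c)) = (\<Sum>a\<in>(\<lambda>a. a + c) ` ?S. fps_const (P (a - c)) * fps_exp (of_int a / of_nat h))"
    using fin by (intro expsum_superset) (auto simp: image_iff intro!: exI[of _ "_ - c"])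
  also have "\<dots> = (\<Sum>a\<in>?S. fps_const (P a) * fps_exp (of_int (a + c) / of_nat h))"
    by (subst sum.reindex) (auto simp: inj_on_def)
  also have "\<dots> = fps_exp (of_int c / of_nat h) * expsum h P"
    by (subst expsum_superset[OF fin]) (auto simp: sum_distrib_left add_divide_distrib fps_exp_add_mult mult_ac)
  finally show ?thesis .
qed

text \<open>At z = e^x the factor z - 1 becomes e^x - 1.\<close>

lemma expsum_difference:
  assumes "finite {a. P a \<noteq> 0}" "h > 0"
  shows "expsum h (\<lambda>a. P (a - int h) - P a) = (fps_exp 1 - 1) * expsum h P"
    and "finite {a. P (a - int h) - P a \<noteq> 0}"
proof -
  have fin: "finite {a. P (a - int h) \<noteq> 0}"
    by (rule finite_subset[OF _ finite_imageI[OF assms(1), of "\<lambda>a. a + int h"]])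
       (auto simp: image_iff intro!: exI[of _ "_ - int h"])
  show "expsum h (\<lambda>a. P (a - int h) - P a) = (fps_exp 1 - 1) * expsum h P"
    using expsum_diff[OF fin assms(1)] expsum_shift[OF assms(1), of h "int h"] assms(2)
    by (simp add: algebra_simps)
  show "finite {a. P (a - int h) - P a \<noteq> 0}"
    by (rule finite_subset[of _ "{a. P (a - int h) \<noteq> 0} \<union> {a. P a \<noteq> 0}"]) (use fin assms in auto)
qed

lemma expsum_sdiff:
  assumes "finite {a. F a \<noteq> 0}" "h > 0"
  shows "finite {a. sdiff h k F a \<noteq> 0} \<and> expsum h (sdiff h k F) = (fps_exp 1 - 1) ^ k * expsum h F"
proof (induction k)
  case (Suc k)
  have eq: "sdiff h (Suc k) F = (\<lambda>a. sdiff h k F (a - int h) - sdiff h k F a)"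
    by (simp add: fun_eq_iff sdiff_Suc)
  show ?case
    using Suc expsum_difference[OF conjunct1[OF Suc] assms(2)] unfolding eq by (simp add: mult.assoc)
qed (use assms in simp)

lemma expsum_nth:
  assumes "finite {a. P a \<noteq> 0}"
  shows "expsum h P $ d = Sum_any (\<lambda>a. (of_int a / of_nat h) ^ d / fact d * P a)"
proof -
  have "Sum_any (\<lambda>a. (of_int a / of_nat h) ^ d / fact d * P a) =
    (\<Sum>a\<in>{a. P a \<noteq> 0}. (of_int a / of_nat h) ^ d / fact d * P a)"
    using assms by (intro Sum_any.expand_superset) auto
  then show ?thesis
    by (subst expsum_superset[OF assms]) (auto simp: fps_sum_nth mult.commute)
qed

text \<open>Exponentials with distinct exponents are linearly independent: the coefficients of the
  power series are the moments of \<open>P\<close>, so \<open>P\<close> annihilates every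
  polynomial, in particular one that vanishes at all exponents of the support but one.\<close>

lemma expsum_eq_0D:
  assumes fin: "finite {a. P a \<noteq> 0}" and h: "h > 0" and 0: "expsum h P = 0"
  shows "P a = 0"
proof (rule ccontr)
  assume a: "P a \<noteq> 0"
  let ?S = "{a. P a \<noteq> 0}"
  let ?x = "\<lambda>a. of_int a / of_nat h :: complex"
  have pow: "(\<Sum>a\<in>?S. P a * ?x a ^ d) = 0" for d
  proof -
    have "0 = expsum h P $ d" using 0 by simp
    also have "\<dots> = (\<Sum>a\<in>?S. P a * ?x a ^ d) / fact d"
      by (subst expsum_superset[OF fin]) (auto simp: fps_sum_nth sum_divide_distrib)
    finally show ?thesis by simp
  qed
  have poly: "(\<Sum>a\<in>?S. P a * poly q (?x a)) = 0" for q
  proof -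
    have "(\<Sum>a\<in>?S. P a * poly q (?x a)) = (\<Sum>a\<in>?S. \<Sum>i\<le>degree q. coeff q i * (P a * ?x a ^ i))"
      by (simp add: poly_altdef sum_distrib_left mult_ac)
    also have "\<dots> = (\<Sum>i\<le>degree q. coeff q i * (\<Sum>a\<in>?S. P a * ?x a ^ i))"
      by (subst sum.swap) (simp add: sum_distrib_left)
    finally show ?thesis using pow by simp
  qed
  define q where "q = (\<Prod>b\<in>?S - {a}. [:- ?x b, 1:])"
  have "poly q (?x b) = 0" if "b \<in> ?S - {a}" for b
    using fin that by (auto simp: q_def poly_prod)
  then have "(\<Sum>b\<in>?S - {a}. P b * poly q (?x b)) = 0" by simp
  then have "P a * poly q (?x a) = 0"
    using poly[of q] sum.remove[OF fin, of a "\<lambda>b. P b * poly q (?x b)"] a by simp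
  moreover have "poly q (?x a) \<noteq> 0"
    using fin h by (auto simp: q_def poly_prod)
  ultimately show False using a by simp
qed

lemma expsum_inj:
  assumes "finite {a. P a \<noteq> 0}" "finite {a. Q a \<noteq> 0}" "h > 0" "expsum h P = expsum h Q"
  shows "P = Q"
proof -
  have "finite {a. P a - Q a \<noteq> 0}"
    by (rule finite_subset[of _ "{a. P a \<noteq> 0} \<union> {a. Q a \<noteq> 0}"]) (use assms in auto)
  then have "P a - Q a = 0" for a
    using assms expsum_diff[OF assms(1,2), of h] by (intro expsum_eq_0D[of "\<lambda>a. P a - Q a" h]) auto
  then show ?thesis by (simp add: fun_eq_iff)
qed

section \<open>The scalar form of the module axiom\<close>

text \<open>The module axiom as seen by one functional at one total degree: \<open>F\<close> will
  hold the coefficients of Y_W(u,x1)Y_W(v,x2)w, and \<open>A\<close>, a series in x0, those of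
  Y_W(Y(u,x0)v,x2)w. The factor (z - 1)^k makes the former a Laurent polynomial, so that z = e^x0
  may be substituted.\<close>

definition phi_pair :: "nat \<Rightarrow> nat \<Rightarrow> (int \<Rightarrow> complex) \<Rightarrow> complex fls \<Rightarrow> bool" where
  "phi_pair h k F A \<longleftrightarrow> finite {a. sdiff h k F a \<noteq> 0} \<and>
     fps_to_fls (expsum h (sdiff h k F)) = fps_to_fls ((fps_exp 1 - 1) ^ k) * A"

text \<open>One more factor z - 1 in the series is one more factor e^x - 1 after substitution. This
  provides a common exponent for several pairs.\<close>

lemma phi_pair_mono:
  assumes "phi_pair h k F A" "h > 0" "k \<le> k'"
  shows "phi_pair h k' F A"
  using assms(3)
proof (induction k' rule: dec_induct)
  case base
  then show ?case by (rule assms)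
next
  case (step k)
  have eq: "sdiff h (Suc k) F = (\<lambda>a. sdiff h k F (a - int h) - sdiff h k F a)"
    by (simp add: fun_eq_iff sdiff_Suc)
  have fin: "finite {a. sdiff h k F a \<noteq> 0}" using step.IH by (simp add: phi_pair_def)
  show ?case
    using step.IH expsum_difference[OF fin assms(2)] unfolding eq phi_pair_def
    by (simp add: fls_times_fps_to_fls mult.assoc)
qed

lemma phi_pair_sum:
  assumes "finite S" "\<And>x. x \<in> S \<Longrightarrow> phi_pair h k (F x) (A x)"
  shows "phi_pair h k (\<lambda>a. \<Sum>x\<in>S. F x a) (\<Sum>x\<in>S. A x)"
proof -
  have eq: "sdiff h k (\<lambda>a. \<Sum>x\<in>S. F x a) = (\<lambda>a. \<Sum>x\<in>S. sdiff h k (F x) a)"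
    using assms(1) by (simp add: sdiff_sum fun_eq_iff)
  have fin: "finite {a. sdiff h k (F x) a \<noteq> 0}" if "x \<in> S" for x
    using assms(2)[OF that] by (simp add: phi_pair_def)
  have "fps_to_fls (\<Sum>x\<in>S. G x) = (\<Sum>x\<in>S. fps_to_fls (G x))" for G :: "_ \<Rightarrow> complex fps"
    by (induction S rule: infinite_finite_induct) auto
  then show ?thesis
    using assms(2) expsum_sum[where h = h and P = "\<lambda>x. sdiff h k (F x)", OF assms(1) fin]
    unfolding phi_pair_def eq by (simp add: sum_distrib_left)
qed

lemma fps_exp_1_neq_1: "fps_exp 1 - 1 \<noteq> (0 :: complex fps)"
  using fps_exp_eq_iff[of "1::complex" 0] by simp

text \<open>If \<open>F\<close> is itself a Laurent polynomial, z = e^x can be substituted in it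
  directly, and the nonzero factor (e^x - 1)^k cancels.\<close>

lemma phi_pair_finite:
  assumes "phi_pair h k F A" "h > 0" "finite {a. F a \<noteq> 0}"
  shows "A = fps_to_fls (expsum h F)"
proof -
  have "fps_to_fls ((fps_exp 1 - 1) ^ k) * A = fps_to_fls ((fps_exp 1 - 1) ^ k) * fps_to_fls (expsum h F)"
    using assms(1) expsum_sdiff[OF assms(3,2), of k] by (simp add: phi_pair_def fls_times_fps_to_fls)
  moreover have "fps_to_fls ((fps_exp 1 - 1 :: complex fps) ^ k) \<noteq> 0"
    using fps_exp_1_neq_1 by simp
  ultimately show ?thesis by simp
qed

lemma fps_compose_sum: "(\<Sum>x\<in>S. f x) oo (g :: complex fps) = (\<Sum>x\<in>S. f x oo g)"
  by (induction S rule: infinite_finite_induct) (simp_all add: fps_compose_add_distrib)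

lemma expsum_uminus:
  assumes "finite {a. P a \<noteq> 0}"
  shows "expsum h P oo (- fps_X) = expsum h (\<lambda>a. P (- a))"
proof -
  have "expsum h (\<lambda>a. P (- a)) = (\<Sum>a\<in>uminus ` {a. P a \<noteq> 0}. fps_const (P (- a)) * fps_exp (of_int a / of_nat h))"
    using assms by (intro expsum_superset) (auto simp: image_iff intro!: exI[of _ "- _"])
  also have "\<dots> = (\<Sum>a\<in>{a. P a \<noteq> 0}. fps_const (P a) * fps_exp (- (of_int a / of_nat h)))"
    by (subst sum.reindex) auto
  also have "\<dots> = expsum h P oo (- fps_X)"
    by (subst expsum_superset[OF assms])
       (auto simp: fps_compose_sum fps_const_mult_apply_left fps_compose_mult_distrib)
  finally show ?thesis ..
qed

text \<open>\<open>c\<close> is the total degree of \<open>F\<close> and \<open>F'\<close>, which hold the coefficients of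
  \<open>Y(u,x\<^sub>1)Y(v,x\<^sub>2)\<close> and \<open>Y(v,x\<^sub>1)Y(u,x\<^sub>2)\<close>.\<close>

lemma phi_pair_commute:
  assumes F: "phi_pair h k F A" and F': "phi_pair h k F' A'" and h: "h > 0"
    and skew: "A = fps_to_fls (fps_exp (of_int c / of_nat h)) * fls_compose_fps A' (- fps_X)"
  shows "sdiff h k F a = sdiff h k (\<lambda>a. F' (c - a)) a"
proof -
  let ?E = "fps_exp 1 - 1 :: complex fps"
  let ?P = "sdiff h k F'" and ?c = "c + int h * int k"
  have finF: "finite {a. sdiff h k F a \<noteq> 0}" and finP: "finite {a. ?P a \<noteq> 0}"
    using F F' by (auto simp: phi_pair_def)
  \<comment> \<open>\<open>Q\<close> will be (z - 1)^k times the series with coefficients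
    \<open>F' (c - a)\<close>. Both sides of the claim are Laurent polynomials, so it is enough to
    compare their values at z = e^x.\<close>
  define Q where "Q = (\<lambda>a. (- 1) ^ k * ?P (?c - a))"
  have Q: "sdiff h k (\<lambda>a. F' (c - a)) = Q"
    by (simp add: fun_eq_iff Q_def sdiff_reflect)
  have finQ': "finite {a. ?P (- a) \<noteq> 0}"
    by (rule finite_subset[OF _ finite_imageI[OF finP, of uminus]]) (auto simp: image_iff intro!: exI[of _ "- _"])
  have finQ'': "finite {a. ?P (- (a - ?c)) \<noteq> 0}"
    by (rule finite_subset[OF _ finite_imageI[OF finP, of "\<lambda>a. ?c - a"]])
       (auto simp: image_iff intro!: exI[of _ "?c - _"])
  then have finQ: "finite {a. Q a \<noteq> 0}"
    by (simp add: Q_def)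
  have "expsum h Q = fps_const ((- 1) ^ k) * expsum h (\<lambda>a. ?P (- (a - ?c)))"
    unfolding Q_def using expsum_cmult[OF finQ'', of h "(-1)^k"] by simp
  also have "expsum h (\<lambda>a. ?P (- (a - ?c))) = fps_exp (of_int ?c / of_nat h) * (expsum h ?P oo (- fps_X))"
    using expsum_shift[OF finQ', of h ?c] expsum_uminus[OF finP, of h] by simp
  also have "fps_exp (of_int ?c / of_nat h :: complex) = fps_exp (of_int c / of_nat h) * fps_exp 1 ^ k"
    using h by (simp add: add_divide_distrib fps_exp_add_mult fps_exp_power_mult)
  finally have "fps_to_fls (expsum h Q) =
     fps_to_fls (fps_const ((- 1) ^ k) * (fps_exp (of_int c / of_nat h) * fps_exp 1 ^ k)) *
     fls_compose_fps (fps_to_fls (expsum h ?P)) (- fps_X)"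
    by (simp add: fls_times_fps_to_fls mult_ac)
  also have "fls_compose_fps (fps_to_fls (expsum h ?P)) (- fps_X) =
     fps_to_fls ((fps_exp (- 1) - 1) ^ k) * fls_compose_fps A' (- fps_X)"
    using F' by (simp add: phi_pair_def fls_compose_fps_mult fps_compose_power [symmetric] fps_compose_sub_distrib)
  also have "fps_to_fls (fps_const ((- 1) ^ k) * (fps_exp (of_int c / of_nat h) * fps_exp 1 ^ k)) *
     (fps_to_fls ((fps_exp (- 1) - 1) ^ k) * fls_compose_fps A' (- fps_X)) =
     fps_to_fls (fps_const ((- 1) ^ k) * fps_exp 1 ^ k * (fps_exp (- 1) - 1) ^ k) * A"
    unfolding skew by (simp add: fls_times_fps_to_fls mult_ac)
  \<comment> \<open>The k-th power of the identity - e^x (e^(-x) - 1) = e^x - 1. The factor e^(kx)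
    stems from the shift by \<open>int h * int k\<close> in \<open>sdiff_reflect\<close>.\<close>
  also have "fps_const ((- 1) ^ k) * fps_exp 1 ^ k * (fps_exp (- 1) - 1) ^ k = (?E :: complex fps) ^ k"
  proof -
    have "fps_const (- 1) * fps_exp 1 * (fps_exp (- 1) - 1) = (?E :: complex fps)"
      using fps_exp_add_mult[of 1 "- 1 :: complex"] by (simp add: algebra_simps fps_const_neg[symmetric] del: fps_const_neg)
    then show ?thesis
      by (metis (no_types, lifting) fps_const_power power_mult_distrib)
  qed
  also have "fps_to_fls (?E ^ k) * A = fps_to_fls (expsum h (sdiff h k F))"
    using F by (simp add: phi_pair_def)
  finally have "expsum h Q = expsum h (sdiff h k F)" by simp
  then have "Q = sdiff h k F"
    using finF finQ h by (intro expsum_inj) auto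
  then show ?thesis using Q by simp
qed

section \<open>The change of variable\<close>

lemma fps_ln_1_neq_0: "fps_ln 1 \<noteq> (0 :: complex fps)"
proof
  assume "fps_ln 1 = (0 :: complex fps)"
  then have "fps_ln 1 $ 1 = (0 :: complex fps) $ 1" by (rule arg_cong)
  then show False by (simp add: fps_ln_nth)
qed

lemma subdegree_fps_ln_1: "subdegree (fps_ln 1 :: complex fps) = 1"
  by (rule subdegreeI) (auto simp: fps_ln_nth)

text \<open>Both sides solve (1 + y) f' = c f with constant term 1, and the solution is
  unique.\<close>

lemma fps_exp_compose_ln: "fps_exp (c :: complex) oo fps_ln 1 = fps_binomial c"
proof (rule iffD1[OF fps_binomial_ODE_unique'], intro conjI)
  show "fps_deriv (fps_exp c oo fps_ln 1) = fps_const c * (fps_exp c oo fps_ln 1) / (1 + fps_X)"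
    by (simp add: fps_compose_deriv fps_ln_deriv fps_const_mult_apply_left fps_divide_unit)
qed simp

lemma fps_ln_compose_exp: "fps_ln 1 oo (fps_exp 1 - 1) = (fps_X :: complex fps)"
  using fps_inv[of "fps_exp 1 - 1 :: complex fps"] fps_ln_fps_exp_inv[of "1 :: complex"] by simp

lemma fps_exp_compose_ln_1: "(fps_exp 1 - 1) oo fps_ln 1 = (fps_X :: complex fps)"
  using fps_exp_compose_ln[of 1] by (simp add: fps_compose_sub_distrib fps_binomial_1)

lemma fps_binomial_compose_exp: "fps_binomial (c :: complex) oo (fps_exp 1 - 1) = fps_exp c"
proof -
  have "(fps_exp c oo fps_ln 1) oo (fps_exp 1 - 1) = fps_exp c oo (fps_ln 1 oo (fps_exp 1 - 1))"
    by (rule fps_compose_assoc[symmetric]) auto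
  then show ?thesis by (simp add: fps_exp_compose_ln fps_ln_compose_exp)
qed

text \<open>This is (1 + y)^M A(log(1 + y)), in other words z^M A(log z) in powers of y = z - 1. Its
  coefficients are what functionals see of \<open>residue_product\<close>.\<close>

definition twist :: "complex \<Rightarrow> complex fls \<Rightarrow> complex fls" where
  "twist M A = fps_to_fls (fps_binomial M) * fls_compose_fps A (fps_ln 1)"

lemma untwist:
  "fls_compose_fps (twist M A) (fps_exp 1 - 1) = fps_to_fls (fps_exp M) * A"
proof -
  have "fls_compose_fps (fls_compose_fps A (fps_ln 1)) (fps_exp 1 - 1) = fls_compose_fps A fps_X"
    using fps_ln_1_neq_0 fps_exp_1_neq_1 fps_ln_compose_exp by (subst fls_compose_fps_assoc) auto
  also have "\<dots> = A"
    using fls_nth_fls_compose_fps_linear[of 1 A] by (intro fls_eqI) auto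
  finally show ?thesis
    using fps_exp_1_neq_1
    by (simp add: twist_def fls_compose_fps_mult fps_binomial_compose_exp)
qed

text \<open>The substitution x = log(1 + y) applied to the right side of \<open>phi_pair\<close>:
  the factor e^x - 1 becomes y.\<close>

lemma twist_untwist:
  "fls_compose_fps (fps_to_fls ((fps_exp 1 - 1) ^ k) * (fps_to_fls (fps_exp M) * A)) (fps_ln 1)
     = fls_X ^ k * twist M A"
proof -
  have "fls_compose_fps (fps_to_fls ((fps_exp 1 - 1) ^ k)) (fps_ln 1) = (fls_X ^ k :: complex fls)"
    using fps_ln_1_neq_0
    by (subst fls_compose_fps_to_fls)
       (simp_all add: fps_compose_power [symmetric] fps_exp_compose_ln_1, simp add: fps_to_fls_power)
  then show ?thesis
    using fps_ln_1_neq_0 by (simp add: twist_def fls_compose_fps_mult fps_exp_compose_ln)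
qed

text \<open>Brings a composition into the form of the sum that defines
  \<open>residue_product\<close>. Only finitely many terms matter, because \<open>L\<close> has
  positive order and its high powers do not reach the coefficient \<open>N\<close>.\<close>

lemma fls_nth_fls_compose_fps:
  fixes A :: "complex fls"
  assumes L: "L \<noteq> 0" "fps_nth L 0 = 0"
  shows "(B * fls_compose_fps A L) $$ N =
    Sum_any (\<lambda>d. A $$ d * (B * fps_to_fls L powi d) $$ N) \<and>
    finite {d. A $$ d * (B * fps_to_fls L powi d) $$ N \<noteq> 0}"
proof (cases "B = 0")
  case False
  define N' where "N' = max 0 (N - fls_subdegree B)"
  define S where "S = {fls_subdegree A..N'}"
  \<comment> \<open>\<open>A1\<close> consists of the terms of \<open>A\<close> up to degree
    \<open>N'\<close>; the tail \<open>A2\<close>, composed with \<open>L\<close>, starts too high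
    to contribute.\<close>
  define A1 where "A1 = (\<Sum>d\<in>S. fls_const (A $$ d) * fls_X powi d)"
  define A2 where "A2 = A - A1"
  have A1: "A1 $$ n = (if n \<in> S then A $$ n else 0)" for n
    by (simp add: A1_def fls_nth_sum fls_X_power_int if_distrib[of "\<lambda>x. _ * x"] S_def cong: if_cong)
  have A2: "A2 $$ n = 0" if "n \<le> N'" for n
    using that by (auto simp: A2_def A1 S_def)
  have "(B * fls_compose_fps A2 L) $$ N = 0"
  proof (cases "A2 = 0")
    case nz: False
    have "fls_subdegree A2 \<ge> N' + 1"
      using nz A2 by (intro fls_subdegree_geI) auto
    moreover have "subdegree L \<ge> 1" using L by (intro subdegree_geI) auto
    ultimately have "(N' + 1) * 1 \<le> fls_subdegree A2 * int (subdegree L)"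
      by (intro mult_mono) (auto simp: N'_def)
    then show ?thesis using L nz
      by (intro fls_times_nth_eq0) (auto simp: N'_def)
  qed simp
  moreover have "A = A1 + A2" by (simp add: A2_def)
  ultimately have "(B * fls_compose_fps A L) $$ N = (B * fls_compose_fps A1 L) $$ N"
    using L by (simp add: fls_compose_fps_add distrib_left)
  also have "fls_compose_fps A1 L = (\<Sum>d\<in>S. fls_const (A $$ d) * fps_to_fls L powi d)"
  proof -
    have "fls_compose_fps (\<Sum>d\<in>S. F d) L = (\<Sum>d\<in>S. fls_compose_fps (F d) L)" for F
      using L by (induction S rule: infinite_finite_induct) (auto simp: fls_compose_fps_add)
    then show ?thesis using L
      by (simp add: A1_def fls_compose_fps_mult fls_compose_fps_powi fls_X_power_int[symmetric] del: fls_X_power_int)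
  qed
  also have "(B * \<dots>) $$ N = (\<Sum>d\<in>S. A $$ d * (B * fps_to_fls L powi d) $$ N)"
    by (simp add: sum_distrib_left fls_nth_sum mult.left_commute[of B])
  finally have 1: "(B * fls_compose_fps A L) $$ N = (\<Sum>d\<in>S. A $$ d * (B * fps_to_fls L powi d) $$ N)" .
  have "(B * fps_to_fls L powi d) $$ N = 0" if "d > N'" for d
  proof (rule fls_times_nth_eq0)
    have "subdegree L \<ge> 1" using L by (intro subdegree_geI) auto
    then have "d * 1 \<le> d * int (subdegree L)"
      using that by (intro mult_left_mono) (auto simp: N'_def)
    then have "N < fls_subdegree B + d * int (subdegree L)" using that unfolding N'_def by linarith
    then show "N < fls_subdegree B + fls_subdegree (fps_to_fls L powi d)"
      using that by (simp add: N'_def power_int_def fls_subdegree_pow fls_subdegree_fls_to_fps)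
  qed
  then have sub: "{d. A $$ d * (B * fps_to_fls L powi d) $$ N \<noteq> 0} \<subseteq> S"
    by (auto simp: S_def intro!: fls_subdegree_leI) (meson not_le)
  have "finite S" by (simp add: S_def)
  then show ?thesis using 1 sub
    by (auto simp: Sum_any.expand_superset[OF _ sub] intro: finite_subset)
qed simp

text \<open>The index \<open>n\<close> stands for the power x^(- n - 1), as in Y(u,x)v, and the
  residue against y^(- N - 1) picks out the coefficient of y^N.\<close>

lemma twist_nth:
  "twist M A $$ N = Sum_any (\<lambda>n. fls_residue (fps_to_fls (fps_binomial M) * fls_X_intpow (- (N + 1)) *
      fps_to_fls (fps_ln 1) powi (- n - 1)) * A $$ (- n - 1)) \<and>
   finite {n. fls_residue (fps_to_fls (fps_binomial M) * fls_X_intpow (- (N + 1)) *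
      fps_to_fls (fps_ln 1) powi (- n - 1)) * A $$ (- n - 1) \<noteq> 0}"
proof -
  let ?B = "fps_to_fls (fps_binomial M)" and ?L = "fps_to_fls (fps_ln 1) :: complex fls"
  let ?t = "\<lambda>d. A $$ d * (?B * ?L powi d) $$ N"
  have res: "fls_residue (?B * fls_X_intpow (- (N + 1)) * ?L powi d) = (?B * ?L powi d) $$ N" for d
  proof -
    have "fls_residue (?B * fls_X_intpow (- (N + 1)) * ?L powi d)
        = fls_residue (fls_X_intpow (- N - 1) * (?B * ?L powi d))"
      by (simp add: mult_ac)
    also have "\<dots> = (?B * ?L powi d) $$ N"
      by (rule fls_residue_shift_nth[symmetric])
    finally show ?thesis .
  qed
  note F = fls_nth_fls_compose_fps[OF fps_ln_1_neq_0 fps_ln_0, of ?B A N]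
  have bij: "bij (\<lambda>n::int. - n - 1)"
    by (rule o_bij[of "\<lambda>n. - n - 1"]) (auto simp: fun_eq_iff)
  have "Sum_any (\<lambda>n. ?t (- n - 1)) = Sum_any ?t"
    by (rule Sum_any.reindex_cong[OF bij, symmetric]) (simp add: fun_eq_iff)
  moreover have "finite {n. ?t (- n - 1) \<noteq> 0}"
    by (rule finite_subset[OF _ finite_imageI[OF conjunct2[OF F], of "\<lambda>n. - n - 1"]])
       (auto simp: image_iff intro!: exI[of _ "- _ - 1"])
  ultimately show ?thesis
    using F unfolding res by (simp add: twist_def mult.commute)
qed

section \<open>Expansion at infinity\<close>

text \<open>\<open>binf s t\<close> is the coefficient of \<open>z\<^sup>t\<close> in the expansion of \<open>(z - 1)\<^sup>s\<close> in powers of \<open>z\<^sup>-\<^sup>1\<close>.\<close>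

definition binf :: "int \<Rightarrow> int \<Rightarrow> complex" where
  "binf s t = (if t \<le> s then (- 1) ^ nat (s - t) * (of_int s gchoose nat (s - t)) else 0)"

text \<open>Pascal's rule: the expansion of (z - 1)^s is multiplied by z - 1.\<close>

lemma binf_Suc: "binf (s + 1) t = binf s (t - 1) - binf s t"
proof -
  consider "t \<le> s" | "t = s + 1" | "t > s + 1" by linarith
  then show ?thesis
  proof cases
    case 1
    then have *: "nat (s + 1 - t) = Suc (nat (s - t))" "nat (s - (t - 1)) = Suc (nat (s - t))" by simp_all
    have "binf (s + 1) t = (- 1) ^ Suc (nat (s - t)) * (of_int s + 1 gchoose Suc (nat (s - t)))"
      using 1 unfolding binf_def * by simp
    moreover have "binf s (t - 1) = (- 1) ^ Suc (nat (s - t)) * (of_int s gchoose Suc (nat (s - t)))"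
      using 1 unfolding binf_def * by simp
    moreover have "binf s t = (- 1) ^ nat (s - t) * (of_int s gchoose nat (s - t))"
      using 1 unfolding binf_def by simp
    ultimately show ?thesis unfolding gbinomial_Suc_Suc by (simp only: power_Suc) (simp add: algebra_simps)
  qed (auto simp: binf_def)
qed

lemma sdiff_binf: "sdiff 1 k (binf s) = binf (s + int k)"
proof (induction k)
  case (Suc k)
  then show ?case using binf_Suc[of "s + int k"] by (simp add: fun_eq_iff sdiff_Suc ac_simps del: One_nat_def)
qed simp

text \<open>For a nonnegative exponent the expansion at infinity is the finite binomial theorem and
  stops at z^0.\<close>

lemma binf_nonneg:
  assumes "s \<ge> 0" "binf s t \<noteq> 0"
  shows "0 \<le> t \<and> t \<le> s"
proof (rule ccontr)
  assume "\<not> ?thesis"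
  with assms have *: "t < 0" "t \<le> s" by (auto simp: binf_def split: if_splits)
  then have "(of_nat (nat s) :: complex) gchoose nat (s - t) = 0"
    by (subst binomial_gbinomial[symmetric]) (use assms in simp)
  with assms * show False by (simp add: binf_def)
qed

lemma expsum_binf: "expsum 1 (binf (int j)) = (fps_exp 1 - 1) ^ j \<and> finite {t. binf (int j) t \<noteq> 0}"
proof -
  have eq: "binf 0 = (\<lambda>t. if t = 0 then 1 else 0)"
  proof
    fix t
    show "binf 0 t = (if t = 0 then 1 else 0)"
      by (cases "nat (- t)") (auto simp: binf_def)
  qed
  have fin: "finite {t. binf 0 t \<noteq> 0}" by (simp add: eq)
  have "expsum 1 (binf 0) = (\<Sum>t\<in>{0}. fps_const (binf 0 t) * fps_exp (of_int t / of_nat 1))"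
    by (rule expsum_superset) (auto simp: eq)
  then have "expsum 1 (binf 0) = 1" by (simp add: eq)
  then show ?thesis
    using expsum_sdiff[OF fin, of 1 j] unfolding sdiff_binf by simp
qed

text \<open>The coefficient of z^t in the expansion at infinity of the sum of \<open>R s\<close> (z
  - 1)^s over s < \<open>e\<close>. The summand \<open>i\<close> belongs to s = t + i, as (z - 1)^s
  contributes to z^t only for s >= t. In this form it is the sum that defines
  \<open>bullet\<close>.\<close>

definition inf_coeff :: "(int \<Rightarrow> complex) \<Rightarrow> int \<Rightarrow> int \<Rightarrow> complex" where
  "inf_coeff R e t = (if t < e then
     \<Sum>i\<le>nat (e - 1 - t). (- 1) ^ i * (of_int (t + int i) gchoose i) * R (t + int i) else 0)"

text \<open>When \<open>R\<close> also vanishes below - k, the range of s can be made independent of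
  \<open>t\<close>; only then can one multiply by (z - 1)^k term by term.\<close>

lemma inf_coeff_eq:
  assumes R: "\<And>s. s < - int k \<Longrightarrow> R s = 0"
  shows "inf_coeff R e t = (\<Sum>j<nat (e + int k). R (int j - int k) * binf (int j - int k) t)"
proof -
  let ?h = "\<lambda>s. R s * binf s t"
  have "(\<Sum>j<nat (e + int k). ?h (int j - int k)) = sum ?h {- int k..<e}"
    by (rule sum.reindex_bij_witness[of _ "\<lambda>s. nat (s + int k)" "\<lambda>j. int j - int k"]) auto
  also have "\<dots> = sum ?h {t..<e}"
  proof -
    have 1: "sum ?h {- int k..<e} = sum ?h {min t (- int k)..<e}"
      by (rule sum.mono_neutral_left) (auto simp: R)
    have 2: "sum ?h {t..<e} = sum ?h {min t (- int k)..<e}"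
      by (rule sum.mono_neutral_left) (auto simp: binf_def)
    show ?thesis using 1 2 by simp
  qed
  also have "\<dots> = inf_coeff R e t"
  proof (cases "t < e")
    case True
    have "sum ?h {t..<e} = (\<Sum>i\<le>nat (e - 1 - t). ?h (t + int i))"
      using True
      by (intro sum.reindex_bij_witness[of _ "\<lambda>i. t + int i" "\<lambda>s. nat (s - t)"]) auto
    then show ?thesis using True by (simp add: inf_coeff_def binf_def mult_ac)
  qed (simp add: inf_coeff_def)
  finally show ?thesis ..
qed

text \<open>All exponents \<open>int j\<close> of z - 1 are now nonnegative: the factor (z - 1)^k
  has removed the pole at z = 1, and the expansion at infinity has become a polynomial in z.\<close>

lemma sdiff_inf_coeff:
  assumes "\<And>s. s < - int k \<Longrightarrow> R s = 0"
  shows "sdiff 1 k (inf_coeff R e) t = (\<Sum>j<nat (e + int k). R (int j - int k) * binf (int j) t)"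
proof -
  have eq: "inf_coeff R e = (\<lambda>t. \<Sum>j<nat (e + int k). R (int j - int k) * binf (int j - int k) t)"
    by (rule ext, rule inf_coeff_eq) (rule assms)
  have "sdiff 1 k (inf_coeff R e) t =
    (\<Sum>j<nat (e + int k). sdiff 1 k (\<lambda>t. R (int j - int k) * binf (int j - int k) t) t)"
    unfolding eq by (rule sdiff_sum) simp
  then show ?thesis unfolding sdiff_cmult sdiff_binf by simp
qed

text \<open>Once the pole is cleared by (z - 1)^k, it makes no difference whether a Laurent
  polynomial in z - 1 is expanded in powers of z and then evaluated at z = e^x, or evaluated
  directly at y = e^x - 1.\<close>

lemma expsum_sdiff_inf_coeff:
  assumes R: "\<And>s. s < - int k \<or> s \<ge> e \<Longrightarrow> twist M A $$ s = 0"
  shows "finite {t. sdiff 1 k (inf_coeff (fls_nth (twist M A)) e) t \<noteq> 0}"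
    and "fps_to_fls (expsum 1 (sdiff 1 k (inf_coeff (fls_nth (twist M A)) e))) =
      fps_to_fls ((fps_exp 1 - 1) ^ k) * (fps_to_fls (fps_exp M) * A)"
proof -
  let ?R = "fls_nth (twist M A)" and ?N = "nat (e + int k)"
  have eq: "sdiff 1 k (inf_coeff ?R e) = (\<lambda>t. \<Sum>j<?N. ?R (int j - int k) * binf (int j) t)"
    by (rule ext, rule sdiff_inf_coeff) (simp add: R)
  have fin: "finite {t. ?R (int j - int k) * binf (int j) t \<noteq> 0}" for j
    by (rule finite_subset[OF _ conjunct2[OF expsum_binf[of j]]]) auto
  note S = expsum_sum[of "{..<?N}" "\<lambda>j t. ?R (int j - int k) * binf (int j) t" 1, OF _ fin]
  show "finite {t. sdiff 1 k (inf_coeff ?R e) t \<noteq> 0}"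
    unfolding eq using S by simp
  have "expsum 1 (sdiff 1 k (inf_coeff ?R e)) = (\<Sum>j<?N. expsum 1 (\<lambda>t. ?R (int j - int k) * binf (int j) t))"
    unfolding eq using S by simp
  also have "\<dots> = (\<Sum>j<?N. fps_const (?R (int j - int k)) * (fps_exp 1 - 1) ^ j)"
    using expsum_binf by (intro sum.cong refl) (simp add: expsum_cmult)
  also have "\<dots> = (\<Sum>j<?N. fps_const (?R (int j - int k)) * fps_X ^ j) oo (fps_exp 1 - 1)"
    by (simp add: fps_compose_sum fps_compose_mult_distrib fps_compose_power [symmetric])
  finally have 1: "fps_to_fls (expsum 1 (sdiff 1 k (inf_coeff ?R e))) =
     fls_compose_fps (fps_to_fls (\<Sum>j<?N. fps_const (?R (int j - int k)) * fps_X ^ j)) (fps_exp 1 - 1)"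
    using fps_exp_1_neq_1 by simp
  \<comment> \<open>By \<open>R\<close> the finite sum exhausts the coefficients of
    \<open>twist M A\<close>, shifted by \<open>k\<close>.\<close>
  have "fps_to_fls (\<Sum>j<?N. fps_const (?R (int j - int k)) * fps_X ^ j) = fls_X ^ k * twist M A"
  proof (rule fls_eqI)
    fix n
    have "(\<Sum>j<?N. fps_const (?R (int j - int k)) * fps_X ^ j) $ i =
       (if i < ?N then ?R (int i - int k) else 0)" for i
      by (simp add: fps_sum_nth fps_X_power_nth if_distrib[of "\<lambda>x. _ * x"] cong: if_cong)
    then show "fps_to_fls (\<Sum>j<?N. fps_const (?R (int j - int k)) * fps_X ^ j) $$ n = (fls_X ^ k * twist M A) $$ n"
      using R[of "n - int k"] by (auto simp: fls_X_power_times_conv_shift)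
  qed
  then show "fps_to_fls (expsum 1 (sdiff 1 k (inf_coeff ?R e))) =
      fps_to_fls ((fps_exp 1 - 1) ^ k) * (fps_to_fls (fps_exp M) * A)"
    unfolding 1 using fps_exp_1_neq_1
    by (simp add: fls_compose_fps_mult fls_compose_fps_power untwist fps_to_fls_power)
qed

text \<open>The way from the relations back to the axiom. The exponent \<open>k\<close> has to bound
  only the pole of \<open>A\<close>, which is what makes it independent of the vector later
  on.\<close>

lemma inf_coeff_phi_pair:
  assumes R: "\<And>s. s \<ge> e \<Longrightarrow> twist M A $$ s = 0" and A: "\<And>s. s < - int k \<Longrightarrow> A $$ s = 0"
    and f: "\<And>t. f t = inf_coeff (fls_nth (twist M A)) e t"
  shows "phi_pair 1 k f (fps_to_fls (fps_exp M) * A)" and "t < 0 \<Longrightarrow> sdiff 1 k f t = 0"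
proof -
  have f: "f = inf_coeff (fls_nth (twist M A)) e" using f by auto
  \<comment> \<open>The pole order of \<open>A\<close> is kept, because log(1 + y) has order 1 and
    (1 + y)^M is a unit.\<close>
  have R': "twist M A $$ s = 0" if "s < - int k" for s
  proof (cases "A = 0")
    case False
    then have "fls_subdegree A \<ge> - int k" using A by (intro fls_subdegree_geI) auto
    then have "s < fls_subdegree (fps_to_fls (fps_binomial M)) + fls_subdegree (fls_compose_fps A (fps_ln 1))"
      using that by (simp add: subdegree_fps_ln_1 fls_subdegree_fls_to_fps)
    then show ?thesis unfolding twist_def by (rule fls_times_nth_eq0)
  qed (simp add: twist_def)
  show "phi_pair 1 k f (fps_to_fls (fps_exp M) * A)"
    unfolding phi_pair_def f using expsum_sdiff_inf_coeff[of k e M A] R R' by blast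
  show "sdiff 1 k f t = 0" if "t < 0"
  proof -
    have "binf (int j) t = 0" for j using binf_nonneg[of "int j" t] that by auto
    then show ?thesis unfolding f by (subst sdiff_inf_coeff) (simp_all add: R')
  qed
qed

text \<open>The polynomial p = (z - 1)^k f has no power of z from e + k on, and y^k
  \<open>twist M A\<close> is p written in y = z - 1. So \<open>twist M A\<close> ends below y^e.
  Then \<open>f\<close> and the expansion at infinity agree after multiplication by (z - 1)^k; both
  are bounded above, so \<open>sdiff_inj\<close> makes them equal.\<close>

lemma phi_pair_inf_coeff:
  assumes P: "phi_pair 1 k f (fps_to_fls (fps_exp M) * A)"
    and low: "\<And>t. t < 0 \<Longrightarrow> sdiff 1 k f t = 0" and high: "\<And>t. t \<ge> e \<Longrightarrow> f t = 0"
  shows "s \<ge> e \<Longrightarrow> twist M A $$ s = 0" and "f t = inf_coeff (fls_nth (twist M A)) e t"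
proof -
  let ?R = "fls_nth (twist M A)"
  define p where "p = sdiff 1 k f"
  have p0: "p t = 0" if "t < 0 \<or> t \<ge> e + int k" for t
    using that low sdiff_eq_0_above[where e = e and f = f and t = t and h = 1 and k = k] high by (auto simp: p_def)
  have fin: "finite {t. p t \<noteq> 0}" using P by (simp add: phi_pair_def p_def)
  have "fps_to_fls (expsum 1 p oo fps_ln 1) = fls_X ^ k * twist M A"
    using P twist_untwist[of k M A] fps_ln_1_neq_0 by (simp add: phi_pair_def p_def flip: fls_compose_fps_to_fls)
  moreover have "expsum 1 p oo fps_ln 1 = (\<Sum>t\<in>{t. p t \<noteq> 0}. fps_const (p t) * fps_binomial (of_int t))"
    by (subst expsum_superset[OF fin]) (auto simp: fps_compose_sum fps_compose_mult_distrib fps_exp_compose_ln)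
  ultimately have eq: "fps_to_fls (\<Sum>t\<in>{t. p t \<noteq> 0}. fps_const (p t) * fps_binomial (of_int t)) = fls_X ^ k * twist M A"
    by simp
  have Rk: "?R s = (if s < - int k then 0 else \<Sum>t\<in>{t. p t \<noteq> 0}. p t * (of_int t gchoose nat (s + int k)))" for s
  proof -
    have "?R s = (fls_X ^ k * twist M A) $$ (s + int k)"
      by (simp add: fls_X_power_times_conv_shift)
    then show ?thesis unfolding eq[symmetric] by (auto simp: fps_sum_nth)
  qed
  have R: "?R s = 0" if "s < - int k \<or> s \<ge> e" for s
  proof (cases "s < - int k")
    case False
    \<comment> \<open>The power z^t is a polynomial in y of degree t < e + k, whereas the
      coefficient asked for has index at least e + k.\<close>
    have "p t * (of_int t gchoose nat (s + int k)) = 0" if t: "p t \<noteq> 0" for t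
    proof -
      have "0 \<le> t" "t < e + int k" using p0[of t] t by (meson not_le)+
      then have "nat t < nat (s + int k)" using \<open>s < - int k \<or> s \<ge> e\<close> False by linarith
      then have "(of_nat (nat t) :: complex) gchoose nat (s + int k) = 0"
        by (simp add: binomial_gbinomial[symmetric])
      then show ?thesis using \<open>0 \<le> t\<close> by simp
    qed
    then show ?thesis unfolding Rk by (auto intro!: sum.neutral)
  qed (simp add: Rk)
  then show "s \<ge> e \<Longrightarrow> twist M A $$ s = 0" by simp
  have E: "finite {t. sdiff 1 k (inf_coeff ?R e) t \<noteq> 0}"
    "fps_to_fls (expsum 1 (sdiff 1 k (inf_coeff ?R e))) = fps_to_fls (expsum 1 p)"
    using expsum_sdiff_inf_coeff[of k e M A] R P by (auto simp: phi_pair_def p_def)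
  then have "sdiff 1 k (inf_coeff ?R e) = p"
    using fin by (intro expsum_inj) auto
  then have "sdiff 1 k (\<lambda>t. f t - inf_coeff ?R e t) t = 0" for t
    by (simp add: sdiff_diff p_def)
  then have "f t - inf_coeff ?R e t = 0"
    by (rule sdiff_inj[of k _ e]) (simp add: high inf_coeff_def)
  then show "f t = inf_coeff ?R e t" by simp
qed

section \<open>Restriction to a residue class\<close>

lemma sdiff_residue_class:
  "sdiff h k F (c + int h * t) = sdiff 1 k (\<lambda>t. F (c + int h * t)) t"
  by (simp add: sdiff_def algebra_simps)

lemma sdiff_off_residue_class:
  assumes "\<And>a. F a \<noteq> 0 \<Longrightarrow> int h dvd a - c" and "\<not> int h dvd a - c"
  shows "sdiff h k F a = 0"
  unfolding sdiff_def
proof (intro sum.neutral ballI)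
  fix i
  have "\<not> int h dvd a - int h * int (k - i) - c"
  proof
    assume "int h dvd a - int h * int (k - i) - c"
    then have "int h dvd (a - int h * int (k - i) - c) + int h * int (k - i)" by (rule dvd_add) simp
    then show False using assms(2) by simp
  qed
  then show "(- 1) ^ i * of_nat (k choose i) * F (a - int h * int (k - i)) = 0"
    using assms(1) by auto
qed

text \<open>A series with exponents congruent to \<open>c\<close> is z^(c/h) times a series in
  integral powers of z. At z = e^x the prefactor is the unit e^(cx/h), which is moved to the other
  side.\<close>

lemma phi_pair_residue_class:
  assumes h: "h > 0" and F: "\<And>a. F a \<noteq> 0 \<Longrightarrow> int h dvd a - c"
  shows "phi_pair h k F A \<longleftrightarrow>
    phi_pair 1 k (\<lambda>t. F (c + int h * t)) (fps_to_fls (fps_exp (- of_int c / of_nat h)) * A)"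
proof -
  define P where "P = sdiff h k F"
  define p where "p = sdiff 1 k (\<lambda>t. F (c + int h * t))"
  have p: "p = (\<lambda>t. P (c + int h * t))" by (simp add: p_def P_def sdiff_residue_class)
  have supp: "{a. P a \<noteq> 0} = (\<lambda>t. c + int h * t) ` {t. p t \<noteq> 0}"
  proof (intro equalityI subsetI)
    fix a assume a: "a \<in> {a. P a \<noteq> 0}"
    then have "int h dvd a - c" using sdiff_off_residue_class[of F h c a k] F by (auto simp: P_def)
    then obtain t where "a - c = int h * t" by (auto elim: dvdE)
    then have "a = c + int h * t" by simp
    then show "a \<in> (\<lambda>t. c + int h * t) ` {t. p t \<noteq> 0}" using a by (auto simp: p)
  qed (auto simp: p)
  have inj: "inj_on (\<lambda>t. c + int h * t) X" for X using h by (auto simp: inj_on_def)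
  have fin: "finite {a. P a \<noteq> 0} \<longleftrightarrow> finite {t. p t \<noteq> 0}"
    unfolding supp using inj by (simp add: finite_image_iff)
  have "expsum h P = fps_exp (of_int c / of_nat h) * expsum 1 p" if f: "finite {t. p t \<noteq> 0}"
  proof -
    have fP: "finite {a. P a \<noteq> 0}" using f fin by simp
    have "expsum h P = (\<Sum>t\<in>{t. p t \<noteq> 0}. fps_const (P (c + int h * t)) * fps_exp (of_int (c + int h * t) / of_nat h))"
      unfolding expsum_superset[OF fP subset_refl] supp by (subst sum.reindex[OF inj]) simp
    also have "\<dots> = fps_exp (of_int c / of_nat h) * expsum 1 p"
      using h unfolding expsum_superset[OF f subset_refl]
      by (simp add: sum_distrib_left p add_divide_distrib fps_exp_add_mult mult_ac)
    finally show ?thesis .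
  qed
  note E = this
  let ?e = "fps_to_fls (fps_exp (of_int c / of_nat h)) :: complex fls"
  let ?e' = "fps_to_fls (fps_exp (- of_int c / of_nat h)) :: complex fls"
  have ee: "?e * ?e' = 1"
    using fps_exp_add_mult[of "of_int c / of_nat h :: complex" "- of_int c / of_nat h"]
    by (simp add: fls_times_fps_to_fls[symmetric])
  have "?e * X = Y * A \<longleftrightarrow> X = Y * (?e' * A)" for X Y
  proof -
    have "?e * (Y * (?e' * A)) = (?e * ?e') * (Y * A)" by (simp only: mult_ac)
    then have "?e * (Y * (?e' * A)) = Y * A" unfolding ee by simp
    moreover have "?e \<noteq> 0" using ee by auto
    ultimately show ?thesis by (metis mult_left_cancel)
  qed
  then show ?thesis
    unfolding phi_pair_def P_def[symmetric] p_def[symmetric] using fin E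
    by (auto simp: fls_times_fps_to_fls)
qed

section \<open>Graded spaces\<close>

lemma Sum_any_hom:
  assumes fin: "finite {a. f a \<noteq> 0}" and f: "\<And>a. f a \<in> S"
    and S: "0 \<in> S" "\<And>x y. x \<in> S \<Longrightarrow> y \<in> S \<Longrightarrow> x + y \<in> S"
    and h: "h 0 = 0" "\<And>x y. x \<in> S \<Longrightarrow> y \<in> S \<Longrightarrow> h (x + y) = h x + h y"
  shows "h (Sum_any f) = Sum_any (\<lambda>a. h (f a))" and "Sum_any f \<in> S"
proof -
  have "h (\<Sum>a\<in>A. f a) = (\<Sum>a\<in>A. h (f a)) \<and> (\<Sum>a\<in>A. f a) \<in> S" if "finite A" for A
    using that by (induction A rule: finite_induct) (auto simp: S h f)
  from this[OF fin] show "h (Sum_any f) = Sum_any (\<lambda>a. h (f a))" "Sum_any f \<in> S"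
    using fin h(1) by (auto simp: Sum_any.expand_set[of f] intro!: Sum_any.expand_superset[symmetric])
qed

definition is_functional :: "(complex \<Rightarrow> 'w \<Rightarrow> 'w) \<Rightarrow> ('w::ab_group_add \<Rightarrow> complex) \<Rightarrow> bool" where
  "is_functional s \<phi> \<longleftrightarrow> (\<forall>x y. \<phi> (x + y) = \<phi> x + \<phi> y) \<and> (\<forall>c x. \<phi> (s c x) = c * \<phi> x)"

lemma is_functionalD:
  assumes "is_functional s \<phi>"
  shows "\<phi> (x + y) = \<phi> x + \<phi> y" "\<phi> (s c x) = c * \<phi> x" "\<phi> 0 = 0"
proof -
  show "\<phi> (x + y) = \<phi> x + \<phi> y" "\<phi> (s c x) = c * \<phi> x" using assms by (auto simp: is_functional_def)
  have "\<phi> (0 + 0) = \<phi> 0 + \<phi> 0" using assms by (simp only: is_functional_def)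
  then show "\<phi> 0 = 0" by simp
qed

lemma is_functional_Sum_any:
  assumes "is_functional s \<phi>" "finite {a. f a \<noteq> 0}"
  shows "\<phi> (Sum_any f) = Sum_any (\<lambda>a. \<phi> (f a))"
  by (rule Sum_any_hom(1)[of f UNIV]) (use assms in \<open>auto simp: is_functionalD\<close>)

lemma is_functional_sum:
  assumes "is_functional s \<phi>"
  shows "\<phi> (\<Sum>x\<in>A. f x) = (\<Sum>x\<in>A. \<phi> (f x))"
  by (induction A rule: infinite_finite_induct) (auto simp: is_functionalD[OF assms])

text \<open>A nonzero vector is linearly independent, so some linear functional takes the value 1 on
  it.\<close>

lemma functional_eqI:
  fixes s :: "complex \<Rightarrow> 'w::ab_group_add \<Rightarrow> 'w"
  assumes "vector_space s" and eq: "\<And>\<phi>. is_functional s \<phi> \<Longrightarrow> \<phi> x = \<phi> y"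
  shows "x = y"
proof (rule ccontr)
  assume "x \<noteq> y"
  interpret vector_space s by (rule assms(1))
  interpret C: vector_space "(*) :: complex \<Rightarrow> complex \<Rightarrow> complex"
    by standard (auto simp: algebra_simps)
  interpret P: vector_space_pair s "(*) :: complex \<Rightarrow> complex \<Rightarrow> complex" ..
  have "independent {x - y}" using \<open>x \<noteq> y\<close> by simp
  from P.linear_independent_extend[OF this, of "\<lambda>_. 1"]
  obtain \<phi> where lin: "Vector_Spaces.linear s (*) \<phi>" and 1: "\<phi> (x - y) = 1" by auto
  interpret \<phi>: Vector_Spaces.linear s "(*)" \<phi> by (rule lin)
  have "is_functional s \<phi>" by (simp add: is_functional_def \<phi>.add \<phi>.scale)
  from eq[OF this] show False using 1 by (simp add: \<phi>.diff)
qed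

context
  fixes s :: "complex \<Rightarrow> 'w::ab_group_add \<Rightarrow> 'w" and G :: "nat \<Rightarrow> 'w set"
  assumes s: "vector_space s" and G: "graded_space s G"
begin

interpretation vector_space s by (rule s)

lemma graded_subspace: "subspace (G n)"
  using G by (simp add: graded_space_def)

lemma finite_family_add:
  assumes "finite_family G f" "finite_family G f'"
  shows "finite_family G (\<lambda>n. f n + f' n)" "Sum_any (\<lambda>n. f n + f' n) = Sum_any f + Sum_any f'"
proof -
  have "finite {n. f n + f' n \<noteq> 0}"
    by (rule finite_subset[of _ "{n. f n \<noteq> 0} \<union> {n. f' n \<noteq> 0}"]) (use assms in \<open>auto simp: finite_family_def\<close>)
  then show "finite_family G (\<lambda>n. f n + f' n)" "Sum_any (\<lambda>n. f n + f' n) = Sum_any f + Sum_any f'"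
    using assms graded_subspace by (auto simp: finite_family_def Sum_any.distrib intro: subspace_add)
qed

lemma finite_family_scale:
  assumes "finite_family G f"
  shows "finite_family G (\<lambda>n. s c (f n))" "Sum_any (\<lambda>n. s c (f n)) = s c (Sum_any f)"
proof -
  have "finite {n. s c (f n) \<noteq> 0}"
    by (rule finite_subset[of _ "{n. f n \<noteq> 0}"]) (use assms in \<open>auto simp: finite_family_def\<close>)
  then show "finite_family G (\<lambda>n. s c (f n))"
    using assms graded_subspace by (auto simp: finite_family_def intro: subspace_scale)
  show "Sum_any (\<lambda>n. s c (f n)) = s c (Sum_any f)"
    by (rule Sum_any_hom(1)[symmetric, of f UNIV "s c"]) (use assms in \<open>auto simp: finite_family_def scale_right_distrib\<close>)
qed

lemma finite_family_single:
  assumes "w \<in> G n"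
  shows "finite_family G (\<lambda>m. if m = n then w else 0)"
  using assms graded_subspace by (auto simp: finite_family_def intro: subspace_0)

lemma total_space_mem: "w \<in> G n \<Longrightarrow> w \<in> total_space G"
  using finite_family_single[of w n] by (force simp: total_space_def)

lemma subspace_total_space: "subspace (total_space G)"
proof (rule subspaceI)
  show "0 \<in> total_space G" using total_space_mem[of 0 0] graded_subspace subspace_0 by blast
  show "x + y \<in> total_space G" if "x \<in> total_space G" "y \<in> total_space G" for x y
    using that finite_family_add unfolding total_space_def by (smt (verit, best) mem_Collect_eq)
  show "s c x \<in> total_space G" if "x \<in> total_space G" for c x
    using that finite_family_scale unfolding total_space_def by (smt (verit, best) mem_Collect_eq)
qed

lemma component_eqI:
  assumes "finite_family G f" "Sum_any f = w"
  shows "component G w = f"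
  unfolding component_def
proof (rule the_equality)
  fix f' assume f': "finite_family G f' \<and> Sum_any f' = w"
  have 1: "finite_family G (\<lambda>n. s (- 1) (f n))" "Sum_any (\<lambda>n. s (- 1) (f n)) = s (- 1) (Sum_any f)"
    using finite_family_scale[OF assms(1), of "- 1"] by simp_all
  have "finite_family G (\<lambda>n. f' n + s (- 1) (f n))" "Sum_any (\<lambda>n. f' n + s (- 1) (f n)) = 0"
    using finite_family_add[OF conjunct1[OF f'] 1(1)] f' assms 1 by auto
  then have "f' n + s (- 1) (f n) = 0" for n
    using G unfolding graded_space_def by blast
  then show "f' = f" by (simp add: fun_eq_iff)
qed (use assms in simp)

lemma component:
  assumes "w \<in> total_space G"
  shows "finite_family G (component G w)" "Sum_any (component G w) = w"
  using assms component_eqI by (auto simp: total_space_def)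

lemma component_mem: "w \<in> total_space G \<Longrightarrow> component G w n \<in> G n"
  using component(1) by (simp add: finite_family_def)

lemma finite_component: "w \<in> total_space G \<Longrightarrow> finite {n. component G w n \<noteq> 0}"
  using component(1) by (simp add: finite_family_def)

lemma component_single: "w \<in> G n \<Longrightarrow> component G w = (\<lambda>m. if m = n then w else 0)"
  by (rule component_eqI[OF finite_family_single]) auto

lemma component_add:
  assumes "x \<in> total_space G" "y \<in> total_space G"
  shows "component G (x + y) = (\<lambda>n. component G x n + component G y n)"
  using assms by (intro component_eqI) (simp_all add: finite_family_add component)

lemma component_scale:
  assumes "x \<in> total_space G"
  shows "component G (s c x) = (\<lambda>n. s c (component G x n))"
  using assms by (intro component_eqI) (simp_all add: finite_family_scale component)

lemma total_space_inductI:
  assumes w: "w \<in> total_space G"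
    and hom: "\<And>n w. w \<in> G n \<Longrightarrow> P w"
    and add: "\<And>x y. x \<in> total_space G \<Longrightarrow> y \<in> total_space G \<Longrightarrow> P x \<Longrightarrow> P y \<Longrightarrow> P (x + y)"
  shows "P w"
proof -
  have fam: "component G w n \<in> G n" for n using component_mem[OF w] .
  have "(\<Sum>n\<in>A. component G w n) \<in> total_space G \<and> P (\<Sum>n\<in>A. component G w n)" if "finite A" for A
    using that
  proof (induction A rule: finite_induct)
    case empty
    then show ?case using hom[of 0 0] graded_subspace subspace_0 subspace_total_space by auto
  next
    case (insert n A)
    have "component G w n + sum (component G w) A \<in> total_space G"
      using insert total_space_mem[OF fam] by (intro subspace_add[OF subspace_total_space]) auto
    moreover have "P (component G w n + sum (component G w) A)"
      using insert hom[OF fam] total_space_mem[OF fam] by (intro add) auto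
    ultimately show ?case using insert by simp
  qed
  from this[OF finite_component[OF w]] show ?thesis
    using component(2)[OF w] by (simp add: Sum_any.expand_set)
qed

end

lemmas total_space_induct = total_space_inductI [consumes 3, case_names hom add]

section \<open>Vertex algebras\<close>

context vertex_algebra
begin

lemma mode_0_left [simp]: "mode 0 n v = 0"
  using mode_scale_left[of 0 0 n v] by simp

lemma mode_0_right [simp]: "mode u n 0 = 0"
  using mode_scale_right[of u n 0 0] by simp

lemma truncation_nat: "\<exists>N::nat. \<forall>n\<ge>int N. mode u n v = 0"
proof -
  obtain N where N: "\<forall>n\<ge>N. mode u n v = 0" using truncation by blast
  then show ?thesis by (intro exI[of _ "nat N"]) auto
qed

text \<open>The Jacobi identity for p = - 1, r = 0 and w = \<open>vac\<close>; the creation property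
  leaves only the term i = 0 on the right. As \<open>mode x (- 1 - int i) vac\<close> is the i-th
  divided power of the translation operator D applied to x, this is Y(v,x)u = e^(xD) Y(u,-x)v in
  components.\<close>

lemma skew_symmetry:
  "Sum_any (\<lambda>i::nat. ((- 1) ^ i) *v mode (mode u (q + int i) v) (- 1 - int i) vac) =
     (- ((- 1) powi q)) *v mode v q u"
proof -
  have "Sum_any (\<lambda>i::nat. ((- 1) ^ i) *v mode (mode u (q + int i) v) (- 1 - int i) vac) =
    Sum_any (\<lambda>i::nat. ((- 1) ^ i * ((of_int q :: complex) gchoose i)) *v
         (mode u (- 1 + q - int i) (mode v (0 + int i) vac)
          - ((- 1) powi q) *v mode v (q + 0 - int i) (mode u (- 1 + int i) vac)))"
  proof -
    have "(of_int (- 1) :: complex) gchoose i = (- 1) ^ i" for i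
      using gbinomial_minus[of "1 :: complex" i] binomial_gbinomial[of i i, where ?'a = complex] by simp
    then show ?thesis
      using jacobi[of "- 1" u q v 0 vac] by (simp only: add.right_neutral)
  qed
  also have "\<dots> = Sum_any (\<lambda>i::nat. if i = 0 then (- ((- 1) powi q)) *v mode v q u else 0)"
  proof (rule Sum_any.cong)
    fix i :: nat
    show "((- 1) ^ i * ((of_int q :: complex) gchoose i)) *v
         (mode u (- 1 + q - int i) (mode v (0 + int i) vac)
          - ((- 1) powi q) *v mode v (q + 0 - int i) (mode u (- 1 + int i) vac))
       = (if i = 0 then (- ((- 1) powi q)) *v mode v q u else 0)"
      using creation(1)[of u] creation(2)[of "int i - 1" u] creation(2)[of "int i" v]
      by (cases i) auto
  qed
  finally show ?thesis by simp
qed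

end

section \<open>Eigenspaces of the automorphism\<close>

lemma sum_roots_of_unity:
  assumes "(z :: complex) ^ n = 1" "z \<noteq> 1"
  shows "(\<Sum>j<n. z ^ j) = 0"
  using geometric_sum[OF assms(2), of n] assms(1) by simp

context vertex_algebra_with_automorphism
begin

definition root_of_unity :: complex where
  "root_of_unity = exp (2 * of_real pi * \<i> / of_nat T)"

lemma exp_root_of_unity: "exp (2 * of_real pi * \<i> * of_nat r / of_nat T) = root_of_unity ^ r"
  by (simp add: root_of_unity_def exp_of_nat_mult[symmetric] mult_ac)

lemma root_of_unity_nz [simp]: "root_of_unity \<noteq> 0"
  by (simp add: root_of_unity_def)

lemma root_of_unity_power_T: "root_of_unity ^ T = 1"
  using T_pos by (simp add: root_of_unity_def exp_of_nat_mult[symmetric])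

lemma root_of_unity_powi_eq_1: "root_of_unity powi a = 1 \<longleftrightarrow> int T dvd a"
proof -
  have T: "real T \<noteq> 0" using T_pos by simp
  have "root_of_unity = cis (2 * pi / real T)"
    by (simp add: root_of_unity_def cis_conv_exp mult_ac)
  then have "root_of_unity powi a = cis (of_int a * (2 * pi / real T))"
    by (simp add: cis_power_int)
  also have "\<dots> = 1 \<longleftrightarrow> cos (of_int a * (2 * pi / real T)) = 1"
    by (auto simp: complex_eq_iff dest: cos_one_sin_zero)
  also have "\<dots> \<longleftrightarrow> (\<exists>n::int. a = int T * n)"
    unfolding cos_one_2pi_int
  proof (intro ex_cong1)
    fix n :: int
    have "real_of_int a * (2 * pi / real T) = real_of_int n * 2 * pi \<longleftrightarrow> real_of_int a = real_of_int (int T * n)"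
      using T by (simp add: field_simps)
    then show "real_of_int a * (2 * pi / real T) = real_of_int n * 2 * pi \<longleftrightarrow> a = int T * n"
      unfolding of_int_eq_iff .
  qed
  finally show ?thesis by (auto simp: dvd_def)
qed

lemma g_add: "g (u + v) = g u + g v" and g_scale: "g (c *v v) = c *v g v"
  using g_automorphism by (auto simp: automorphism_def)

lemma g_0: "g 0 = 0"
  using g_scale[of 0 0] by simp

lemma g_sum: "g (sum f A) = (\<Sum>x\<in>A. g (f x))"
  by (induction A rule: infinite_finite_induct) (auto simp: g_0 g_add)

lemma mem_eigenspace: "r < T \<Longrightarrow> v \<in> eigenspace r \<longleftrightarrow> g v = root_of_unity ^ r *v v"
  by (simp add: eigenspace_def exp_root_of_unity)

text \<open>The discrete Fourier projection for the cyclic group generated by \<open>g\<close>; it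
  makes the decomposition into eigenspaces explicit.\<close>

definition eigen_projection :: "nat \<Rightarrow> 'v \<Rightarrow> 'v" where
  "eigen_projection r v = (1 / of_nat T) *v (\<Sum>j<T. (root_of_unity powi (- int r * int j)) *v (g ^^ j) v)"

lemma g_pow_eigen: "r < T \<Longrightarrow> v \<in> eigenspace r \<Longrightarrow> (g ^^ j) v = (root_of_unity ^ (r * j)) *v v"
  by (induction j) (auto simp: g_scale mem_eigenspace power_add mult.commute)

lemma eigen_projection_add: "eigen_projection r (u + v) = eigen_projection r u + eigen_projection r v"
proof -
  have "(g ^^ j) (u + v) = (g ^^ j) u + (g ^^ j) v" for j
    by (induction j) (auto simp: g_add)
  then show ?thesis by (simp add: eigen_projection_def scale_right_distrib sum.distrib)
qed

text \<open>Orthogonality of characters: for nonzero \<open>a\<close> the sum runs over all powers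
  of a T-th root of unity other than 1.\<close>

lemma sum_powi_roots:
  fixes a :: int
  assumes "\<bar>a\<bar> < int T"
  shows "(\<Sum>j<T. root_of_unity powi (a * int j)) = (if a = 0 then of_nat T else 0)"
proof (cases "a = 0")
  case False
  have "\<not> int T dvd a" using False assms zdvd_imp_le[of "int T" "\<bar>a\<bar>"] by auto
  then have "root_of_unity powi a \<noteq> 1" by (simp add: root_of_unity_powi_eq_1)
  moreover have "(root_of_unity powi a) ^ T = 1"
    using root_of_unity_power_T
    by (metis mult.commute power_int_mult power_int_of_nat power_int_1_left)
  ultimately have "(\<Sum>j<T. (root_of_unity powi a) ^ j) = 0" by (rule sum_roots_of_unity[rotated])
  then show ?thesis using False by (simp add: power_int_mult)
qed simp

lemma eigen_projection_eigen:
  assumes "r < T" "q < T" "v \<in> eigenspace q"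
  shows "eigen_projection r v = (if q = r then v else 0)"
proof -
  have "(\<Sum>j<T. (root_of_unity powi (- int r * int j)) *v (g ^^ j) v) =
    (\<Sum>j<T. (root_of_unity powi ((int q - int r) * int j)) *v v)"
  proof (intro sum.cong refl)
    fix j
    have "root_of_unity powi (- int r * int j) * root_of_unity ^ (q * j) = root_of_unity powi ((int q - int r) * int j)"
      by (simp add: power_int_add[symmetric] algebra_simps flip: power_int_of_nat)
    then show "(root_of_unity powi (- int r * int j)) *v (g ^^ j) v = (root_of_unity powi ((int q - int r) * int j)) *v v"
      using g_pow_eigen[OF assms(2,3), of j] by simp
  qed
  also have "\<dots> = (\<Sum>j<T. root_of_unity powi ((int q - int r) * int j)) *v v"
    by (simp add: scale_sum_left)
  also have "\<dots> = (if q = r then of_nat T *v v else 0)"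
    using assms by (subst sum_powi_roots) auto
  finally show ?thesis using T_pos by (simp add: eigen_projection_def)
qed

lemma eigen_projection_mem:
  assumes "r < T"
  shows "eigen_projection r v \<in> eigenspace r"
proof -
  let ?f = "\<lambda>j. (root_of_unity powi (- int r * int j)) *v (g ^^ j) v"
  \<comment> \<open>The summands are periodic, so \<open>g\<close> permutes them cyclically up to
    the factor \<open>root_of_unity ^ r\<close>.\<close>
  have per: "?f T = ?f 0"
    using g_power root_of_unity_powi_eq_1[of "- int r * int T"] by simp
  have "g (\<Sum>j<T. ?f j) = (\<Sum>j<T. (root_of_unity ^ r) *v ?f (Suc j))"
    unfolding g_sum
  proof (intro sum.cong refl)
    fix j
    have "root_of_unity ^ r * root_of_unity powi (- int r * int (Suc j)) = root_of_unity powi (- int r * int j)"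
      by (simp add: power_int_add[symmetric] algebra_simps flip: power_int_of_nat)
    then show "g (?f j) = (root_of_unity ^ r) *v ?f (Suc j)"
      by (simp only: g_scale scale_scale funpow.simps comp_def)
  qed
  also have "\<dots> = (root_of_unity ^ r) *v (\<Sum>j<T. ?f (Suc j))"
    by (simp add: scale_sum_right)
  also have "(\<Sum>j<T. ?f (Suc j)) = (\<Sum>j<T. ?f j)"
    using sum.lessThan_Suc_shift[of ?f T] sum.lessThan_Suc[of ?f T] per by simp
  finally show ?thesis using assms
    by (simp add: mem_eigenspace eigen_projection_def g_scale scale_left_commute)
qed

lemma sum_eigen_projection: "(\<Sum>r<T. eigen_projection r v) = v"
proof -
  have "(\<Sum>r<T. \<Sum>j<T. (root_of_unity powi (- int r * int j)) *v (g ^^ j) v) =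
     (\<Sum>j<T. (\<Sum>r<T. root_of_unity powi (- int j * int r)) *v (g ^^ j) v)"
    by (subst sum.swap) (simp add: scale_sum_left mult.commute)
  also have "\<dots> = (\<Sum>j<T. if j = 0 then of_nat T *v v else 0)"
    by (intro sum.cong refl, subst sum_powi_roots) auto
  finally show ?thesis using T_pos
    by (simp add: eigen_projection_def scale_sum_right[symmetric])
qed

lemma vector_space_scale: "vector_space scale" ..

lemma subspace_eigenspace: "subspace (eigenspace r)"
  by (rule subspaceI)
     (auto simp: eigenspace_def g_0 g_add g_scale scale_right_distrib scale_left_commute split: if_splits)

lemma Sum_any_eigen:
  assumes "finite_family eigenspace f"
  shows "Sum_any f = (\<Sum>r<T. f r)"
proof (rule Sum_any.expand_superset)
  show "{a. f a \<noteq> 0} \<subseteq> {..<T}" using assms by (force simp: finite_family_def eigenspace_def split: if_splits)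
qed simp

text \<open>Makes \<open>component eigenspace\<close>, on which \<open>bullet\<close> rests, well
  determined: an eigenvector is recovered from a sum by the projections.\<close>

lemma graded_eigenspace: "graded_space scale eigenspace"
  unfolding graded_space_def
proof (intro conjI allI impI)
  show "subspace (eigenspace n)" for n by (rule subspace_eigenspace)
  fix f n
  assume f: "finite_family eigenspace f \<and> Sum_any f = 0"
  show "f n = 0"
  proof (cases "n < T")
    case True
    have mem: "f r \<in> eigenspace r" for r using f by (simp add: finite_family_def)
    have sum: "eigen_projection n (sum h A) = (\<Sum>x\<in>A. eigen_projection n (h x))" if "finite A" for h :: "nat \<Rightarrow> 'v" and A
      using that
    proof (induction A rule: finite_induct)
      case empty
      then show ?case using eigen_projection_add[of n 0 0] by simp
    qed (simp add: eigen_projection_add)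
    have "0 = (\<Sum>r<T. f r)" using f Sum_any_eigen[of f] by argo
    then have "eigen_projection n 0 = (\<Sum>r<T. eigen_projection n (f r))" using sum[of "{..<T}" f] by simp
    also have "\<dots> = (\<Sum>r<T. if r = n then f r else 0)"
      using eigen_projection_eigen[OF True] mem by (intro sum.cong refl) auto
    also have "\<dots> = f n" using True by simp
    finally show ?thesis using eigen_projection_add[of n 0 0] by simp
  next
    case False
    then show ?thesis using f by (auto simp: finite_family_def eigenspace_def split: if_splits)
  qed
qed

lemma eigen_component:
  shows "component eigenspace v r \<in> eigenspace r" and "(\<Sum>r<T. component eigenspace v r) = v"
    and "total_space eigenspace = UNIV"
proof -
  define F where "F = (\<lambda>v r. if r < T then eigen_projection r v else 0)"
  have fin: "{n. F v n \<noteq> 0} \<subseteq> {..<T}" for v by (auto simp: F_def split: if_splits)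
  have fam: "finite_family eigenspace (F v)" for v
    using finite_subset[OF fin] eigen_projection_mem by (auto simp: finite_family_def F_def eigenspace_def)
  have sum: "Sum_any (F v) = v" for v
    using Sum_any_eigen[OF fam] sum_eigen_projection by (simp add: F_def)
  show "total_space eigenspace = UNIV"
  proof -
    have "x \<in> total_space eigenspace" for x
      unfolding total_space_def by (intro CollectI exI[of _ "F x"] conjI fam sum[symmetric])
    then show ?thesis by auto
  qed
  have "component eigenspace v = F v"
    using component_eqI[OF vector_space_scale graded_eigenspace fam sum] .
  then show "component eigenspace v r \<in> eigenspace r" "(\<Sum>r<T. component eigenspace v r) = v"
    using fam[of v] sum[of v] Sum_any_eigen[OF fam, of v] by (simp_all add: finite_family_def)
qed

end

text \<open>The product is summed over the power series factor, to match the left side of the module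
  axiom.\<close>

lemma fps_to_fls_times_nth:
  fixes A :: "complex fls"
  shows "(fps_to_fls f * A) $$ d = Sum_any (\<lambda>i::nat. f $ i * A $$ (d - int i)) \<and>
    finite {i::nat. f $ i * A $$ (d - int i) \<noteq> 0}"
proof -
  define N where "N = nat (d - fls_subdegree A)"
  have sub: "{i::nat. f $ i * A $$ (d - int i) \<noteq> 0} \<subseteq> {..N}"
  proof
    fix i assume "i \<in> {i::nat. f $ i * A $$ (d - int i) \<noteq> 0}"
    then have "A $$ (d - int i) \<noteq> 0" by auto
    then have "fls_subdegree A \<le> d - int i" by (rule fls_subdegree_leI)
    then show "i \<in> {..N}" by (simp add: N_def)
  qed
  define S where "S = nat ` {fls_subdegree (fps_to_fls f)..d - fls_subdegree A}"
  have "(fps_to_fls f * A) $$ d =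
     (\<Sum>i=fls_subdegree (fps_to_fls f)..d - fls_subdegree A. fps_to_fls f $$ i * A $$ (d - i))"
    by (rule fls_times_nth)
  also have "\<dots> = (\<Sum>i\<in>S. f $ i * A $$ (d - int i))"
    unfolding S_def using fls_subdegree_fls_to_fps_gt0[of f]
    by (subst sum.reindex) (auto simp: inj_on_def intro!: sum.cong)
  also have "\<dots> = (\<Sum>i\<le>N. f $ i * A $$ (d - int i))"
  proof (rule sum.mono_neutral_left)
    show "S \<subseteq> {..N}" by (auto simp: S_def N_def)
    show "\<forall>i\<in>{..N} - S. f $ i * A $$ (d - int i) = 0"
    proof
      fix i assume i: "i \<in> {..N} - S"
      show "f $ i * A $$ (d - int i) = 0"
      proof (rule ccontr)
        assume nz: "f $ i * A $$ (d - int i) \<noteq> 0"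
        then have "fps_to_fls f $$ int i \<noteq> 0" "A $$ (d - int i) \<noteq> 0" by auto
        then have "fls_subdegree (fps_to_fls f) \<le> int i" "fls_subdegree A \<le> d - int i"
          by (auto intro!: fls_subdegree_leI)
        then have "i \<in> S" unfolding S_def by (intro image_eqI[of _ _ "int i"]) auto
        with i show False by simp
      qed
    qed
  qed simp
  also have "\<dots> = Sum_any (\<lambda>i::nat. f $ i * A $$ (d - int i))"
    by (rule Sum_any.expand_superset[symmetric, OF _ sub]) simp
  finally show ?thesis using finite_subset[OF sub] by simp
qed

section \<open>Operators on a graded space and their coefficient series\<close>

text \<open>The axioms of a twisted module except the last one; truncation follows from
  \<open>Y_degree\<close>. It serves both directions: a twisted module satisfies it, and so do the
  operators built from a module of the quotient algebra, before the last axiom is known for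
  them.\<close>

locale graded_operators =
  vertex_algebra_with_automorphism scale mode vac g T + W: vector_space s
  for scale :: "complex \<Rightarrow> 'v::ab_group_add \<Rightarrow> 'v" (infixr \<open>*v\<close> 75)
    and mode :: "'v \<Rightarrow> int \<Rightarrow> 'v \<Rightarrow> 'v"
    and vac :: 'v
    and g :: "'v \<Rightarrow> 'v"
    and T :: nat
    and s :: "complex \<Rightarrow> 'w::ab_group_add \<Rightarrow> 'w" +
  fixes G :: "nat \<Rightarrow> 'w set" and Y :: "'v \<Rightarrow> int \<Rightarrow> 'w \<Rightarrow> 'w"
  assumes graded: "graded_space s G"
    and Y_linear: "Y v j \<in> linear_maps s (total_space G) (total_space G)"
    and Y_add_left: "w \<in> total_space G \<Longrightarrow> Y (u + v) j w = Y u j w + Y v j w"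
    and Y_scale_left: "w \<in> total_space G \<Longrightarrow> Y (c *v v) j w = s c (Y v j w)"
    and Y_degree: "w \<in> G n \<Longrightarrow>
      if int n - j - int T \<ge> 0 then Y v j w \<in> G (nat (int n - j - int T)) else Y v j w = 0"
    and vac_coeff: "w \<in> total_space G \<Longrightarrow> coeff Y vac a w = (if a = 0 then w else 0)"
    and g_coeff: "w \<in> total_space G \<Longrightarrow>
      coeff Y (g v) a w = s (exp (- 2 * of_real pi * \<i> / of_nat T) powi a) (coeff Y v a w)"
begin

lemma W: "vector_space s" ..

lemmas subspace_total = subspace_total_space[OF W graded]
lemmas total_mem = total_space_mem[OF W graded]
lemmas total_0 [simp] = W.subspace_0[OF subspace_total]

lemma coeff_closed: "w \<in> total_space G \<Longrightarrow> coeff Y v a w \<in> total_space G"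
  using Y_linear by (auto simp: linear_maps_def coeff_def PiE_def Pi_def)

lemma coeff_add: "x \<in> total_space G \<Longrightarrow> y \<in> total_space G \<Longrightarrow> coeff Y v a (x + y) = coeff Y v a x + coeff Y v a y"
  using Y_linear[of v] by (auto simp: linear_maps_def coeff_def)

lemma coeff_scale: "x \<in> total_space G \<Longrightarrow> coeff Y v a (s c x) = s c (coeff Y v a x)"
  using Y_linear[of v] by (auto simp: linear_maps_def coeff_def)

lemma coeff_0 [simp]: "coeff Y v a 0 = 0"
  using coeff_scale[of 0 v a 0] by simp

lemma coeff_add_left: "w \<in> total_space G \<Longrightarrow> coeff Y (u + v) a w = coeff Y u a w + coeff Y v a w"
  by (simp add: coeff_def Y_add_left)

lemma coeff_scale_left: "w \<in> total_space G \<Longrightarrow> coeff Y (c *v v) a w = s c (coeff Y v a w)"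
  by (simp add: coeff_def Y_scale_left)

lemma coeff_0_left [simp]: "w \<in> total_space G \<Longrightarrow> coeff Y 0 a w = 0"
  using coeff_scale_left[of w 0 0 a] by simp

lemma coeff_Sum_any:
  assumes "finite {n. f n \<noteq> 0}" "w \<in> total_space G"
  shows "coeff Y (Sum_any f) a w = Sum_any (\<lambda>n. coeff Y (f n) a w)"
  by (rule Sum_any_hom(1)[of f UNIV "\<lambda>u. coeff Y u a w"]) (use assms in \<open>auto simp: coeff_add_left\<close>)

lemma coeff_sum_left:
  assumes "w \<in> total_space G"
  shows "coeff Y (\<Sum>x\<in>A. f x) a w = (\<Sum>x\<in>A. coeff Y (f x) a w)"
  by (induction A rule: infinite_finite_induct) (auto simp: coeff_add_left assms)

lemma coeff_degree: "w \<in> G m \<Longrightarrow> int m + a \<ge> 0 \<Longrightarrow> coeff Y v a w \<in> G (nat (int m + a))"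
  and coeff_degree_neg: "w \<in> G m \<Longrightarrow> int m + a < 0 \<Longrightarrow> coeff Y v a w = 0"
  using Y_degree[of w m "- a - int T" v] by (auto simp: coeff_def)

text \<open>Y_W(gv,x) is described by the eigenvalue of \<open>v\<close> and by the substitution for
  x^(1/T); the two are compatible only at powers x^(a/T) with a congruent to - r.\<close>

lemma coeff_eigen:
  assumes v: "v \<in> eigenspace r" and w: "w \<in> total_space G" and nz: "coeff Y v a w \<noteq> 0"
  shows "int T dvd a + int r"
proof (cases "r < T")
  case True
  have "exp (- 2 * of_real pi * \<i> / of_nat T) = inverse root_of_unity"
    by (simp add: root_of_unity_def exp_minus[symmetric])
  then have "s (root_of_unity ^ r) (coeff Y v a w) = s (root_of_unity powi (- a)) (coeff Y v a w)"
    using g_coeff[OF w, of v a] v True by (simp add: mem_eigenspace coeff_scale_left w power_int_minus power_int_inverse)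
  then have "root_of_unity ^ r = root_of_unity powi (- a)" using nz by simp
  then have "root_of_unity powi (a + int r) = 1"
    by (simp add: power_int_add power_int_minus)
  then show ?thesis by (simp add: root_of_unity_powi_eq_1)
next
  case False
  then show ?thesis using v nz w by (simp add: eigenspace_def)
qed

text \<open>The coefficient of x1^(a/T) x2^((c-a)/T): with the total degree \<open>c\<close> fixed,
  the product is read as a series in z = x1/x2.\<close>

definition product_series :: "('w \<Rightarrow> complex) \<Rightarrow> 'v \<Rightarrow> 'v \<Rightarrow> int \<Rightarrow> 'w \<Rightarrow> int \<Rightarrow> complex" where
  "product_series \<phi> u v c w a = \<phi> (coeff Y u a (coeff Y v (c - a) w))"

text \<open>The factor of x2^(c/T) in Y_W(Y(u,x0)v,x2)w, as a Laurent series in x0.\<close>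

definition iterate_series :: "('w \<Rightarrow> complex) \<Rightarrow> 'v \<Rightarrow> 'v \<Rightarrow> int \<Rightarrow> 'w \<Rightarrow> complex fls" where
  "iterate_series \<phi> u v c w = Abs_fls (\<lambda>d. \<phi> (coeff Y (mode u (- d - 1) v) c w))"

lemma iterate_series_nth:
  assumes "is_functional s \<phi>" "w \<in> total_space G"
  shows "iterate_series \<phi> u v c w $$ d = \<phi> (coeff Y (mode u (- d - 1) v) c w)"
proof -
  obtain N where N: "\<forall>n\<ge>N. mode u n v = 0" using truncation by blast
  have "\<phi> (coeff Y (mode u (- n - 1) v) c w) = 0" if "n < - N" for n
  proof -
    have "mode u (- n - 1) v = 0" using N that by simp
    then show ?thesis using assms by (simp add: is_functionalD)
  qed
  then show ?thesis
    unfolding iterate_series_def by (intro nth_Abs_fls_lower_bound) blast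
qed

text \<open>The factor (x1 - x2)^k raises the total degree by k, which is
  \<open>int T * int k\<close> in units of 1/T.\<close>

lemma product_coeff_sdiff:
  assumes "is_functional s \<phi>"
  shows "\<phi> (product_coeff s Y k u v a (c + int T * int k - a) w) = sdiff T k (product_series \<phi> u v c w) a"
  unfolding product_coeff_def sdiff_def is_functional_sum[OF assms]
proof (intro sum.cong refl)
  fix i assume "i \<in> {..k}"
  then have "c + int T * int k - a - int T * int i = c - (a - int T * int (k - i))"
    by (simp add: of_nat_diff algebra_simps)
  then show "\<phi> (s ((- 1) ^ i * of_nat (k choose i)) (coeff Y u (a - int T * int (k - i))
       (coeff Y v (c + int T * int k - a - int T * int i) w))) =
     (- 1) ^ i * of_nat (k choose i) * product_series \<phi> u v c w (a - int T * int (k - i))"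
    by (simp only: product_series_def is_functionalD[OF assms])
qed

definition truncated :: "nat \<Rightarrow> 'v \<Rightarrow> 'v \<Rightarrow> 'w \<Rightarrow> bool" where
  "truncated k u v w \<longleftrightarrow> (\<exists>N. \<forall>a b. a < N \<or> b < N \<longrightarrow> product_coeff s Y k u v a b w = 0)"

definition phi_identity :: "nat \<Rightarrow> 'v \<Rightarrow> 'v \<Rightarrow> 'w \<Rightarrow> bool" where
  "phi_identity k u v w \<longleftrightarrow> (\<forall>c d::int.
     Sum_any (\<lambda>i::nat. s (fps_nth ((fps_exp 1 - 1) ^ k) i)
       (coeff Y (mode u (int i - d - 1) v) (c - int T * int k) w)) =
     Sum_any (\<lambda>a::int. s (if d < 0 then 0 else (of_int a / of_nat T) ^ nat d / fact (nat d))
       (product_coeff s Y k u v a (c - a) w)))"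

lemma graded_phi_module_iff:
  "graded_phi_module s G Y \<longleftrightarrow> (\<forall>u v. \<exists>k. \<forall>w\<in>total_space G. truncated k u v w \<and> phi_identity k u v w)"
proof -
  \<comment> \<open>Truncation in x comes from the grading: on a homogeneous vector the high modes
    would lead to negative degree.\<close>
  have trunc: "\<exists>N. \<forall>j\<ge>N. Y v j w = 0" if "w \<in> total_space G" for v w
    using W graded that
  proof (induction w rule: total_space_induct)
    case (hom n w)
    then have "\<forall>j\<ge>int n + 1. Y v j w = 0"
      using Y_degree[OF hom] T_pos by (smt (verit, best) of_nat_0_le_iff)
    then show ?case by blast
  next
    case (add x y)
    then obtain M N where "\<forall>j\<ge>M. Y v j x = 0" "\<forall>j\<ge>N. Y v j y = 0" by blast
    moreover have "Y v j (x + y) = Y v j x + Y v j y" for j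
      using add Y_linear by (auto simp: linear_maps_def)
    ultimately have "\<forall>j\<ge>max M N. Y v j (x + y) = 0" by simp
    then show ?case by blast
  qed
  show ?thesis
    unfolding graded_phi_module_def truncated_def phi_identity_def
    using graded Y_linear Y_add_left Y_scale_left Y_degree vac_coeff g_coeff trunc
    by (simp add: ball_conj_distrib)
qed

lemma product_coeff_finite:
  assumes "truncated k u v w"
  shows "finite {a. product_coeff s Y k u v a (c - a) w \<noteq> 0}"
proof -
  obtain N where N: "\<forall>a b. a < N \<or> b < N \<longrightarrow> product_coeff s Y k u v a b w = 0"
    using assms by (auto simp: truncated_def)
  then have "{a. product_coeff s Y k u v a (c - a) w \<noteq> 0} \<subseteq> {N..c - N}"
    by (auto simp: not_less[symmetric]; smt (verit, best))
  then show ?thesis by (rule finite_subset) simp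
qed

lemma phi_identity_iff:
  assumes w: "w \<in> total_space G" and tr: "truncated k u v w"
  shows "phi_identity k u v w \<longleftrightarrow>
    (\<forall>\<phi> c. is_functional s \<phi> \<longrightarrow> phi_pair T k (product_series \<phi> u v c w) (iterate_series \<phi> u v c w))"
proof -
  let ?e = "(fps_exp 1 - 1 :: complex fps) ^ k"
  define L where "L = (\<lambda>c d. Sum_any (\<lambda>i::nat. s (fps_nth ?e i) (coeff Y (mode u (int i - d - 1) v) c w)))"
  define R where "R = (\<lambda>c d. Sum_any (\<lambda>a::int. s (if d < 0 then 0 else (of_int a / of_nat T) ^ nat d / fact (nat d))
       (product_coeff s Y k u v a (c + int T * int k - a) w)))"
  \<comment> \<open>Here \<open>c\<close> becomes the total degree before the factor x2^k is
    applied, as in \<open>iterate_series\<close>.\<close>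
  have id: "phi_identity k u v w \<longleftrightarrow> (\<forall>c d. L c d = R c d)"
  proof
    assume *: "phi_identity k u v w"
    show "\<forall>c d. L c d = R c d"
    proof (intro allI)
      fix c d
      show "L c d = R c d"
        using *[unfolded phi_identity_def, rule_format, of d "c + int T * int k"] by (simp add: L_def R_def)
    qed
  next
    assume *: "\<forall>c d. L c d = R c d"
    show "phi_identity k u v w"
      unfolding phi_identity_def
    proof (intro allI)
      fix c d :: int
      show "Sum_any (\<lambda>i::nat. s (fps_nth ?e i) (coeff Y (mode u (int i - d - 1) v) (c - int T * int k) w)) =
        Sum_any (\<lambda>a::int. s (if d < 0 then 0 else (of_int a / of_nat T) ^ nat d / fact (nat d))
          (product_coeff s Y k u v a (c - a) w))"
        using *[rule_format, of "c - int T * int k" d] by (simp add: L_def R_def)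
    qed
  qed
  have fin: "finite {a. product_coeff s Y k u v a (c + int T * int k - a) w \<noteq> 0}" for c
    by (rule product_coeff_finite[OF tr])
  have finR: "finite {a::int. s (if d < 0 then 0 else (of_int a / of_nat T) ^ nat d / fact (nat d))
       (product_coeff s Y k u v a (c + int T * int k - a) w) \<noteq> 0}" for c d
    by (rule finite_subset[OF _ fin[of c]]) auto
  have finL: "finite {i::nat. s (fps_nth ?e i) (coeff Y (mode u (int i - d - 1) v) c w) \<noteq> 0}" for c d
  proof -
    obtain N where N: "\<forall>n\<ge>N. mode u n v = 0" using truncation by blast
    have "{i::nat. s (fps_nth ?e i) (coeff Y (mode u (int i - d - 1) v) c w) \<noteq> 0} \<subseteq> {..nat (N + d + 1)}"
    proof
      fix i assume i: "i \<in> {i::nat. s (fps_nth ?e i) (coeff Y (mode u (int i - d - 1) v) c w) \<noteq> 0}"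
      have "\<not> int i - d - 1 \<ge> N" using i N w by auto
      then show "i \<in> {..nat (N + d + 1)}" by simp
    qed
    then show ?thesis by (rule finite_subset) simp
  qed
  have pair: "phi_pair T k (product_series \<phi> u v c w) (iterate_series \<phi> u v c w) \<longleftrightarrow> (\<forall>d. \<phi> (L c d) = \<phi> (R c d))"
    if \<phi>: "is_functional s \<phi>" for \<phi> c
  proof -
    let ?P = "sdiff T k (product_series \<phi> u v c w)"
    have P: "?P = (\<lambda>a. \<phi> (product_coeff s Y k u v a (c + int T * int k - a) w))"
      by (simp add: product_coeff_sdiff[OF \<phi>])
    have finP: "finite {a. ?P a \<noteq> 0}"
      unfolding P by (rule finite_subset[OF _ fin[of c]]) (auto simp: is_functionalD[OF \<phi>])
    have R: "fps_to_fls (expsum T ?P) $$ d = \<phi> (R c d)" for d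
    proof (cases "d < 0")
      case False
      have "fps_to_fls (expsum T ?P) $$ d = Sum_any (\<lambda>a. (of_int a / of_nat T) ^ nat d / fact (nat d) * ?P a)"
        using False by (simp add: expsum_nth[OF finP])
      also have "\<dots> = \<phi> (R c d)"
        unfolding R_def is_functional_Sum_any[OF \<phi> finR]
        using False by (simp add: P is_functionalD[OF \<phi>])
      finally show ?thesis .
    qed (simp add: R_def is_functionalD[OF \<phi>])
    have L: "(fps_to_fls ?e * iterate_series \<phi> u v c w) $$ d = \<phi> (L c d)" for d
      unfolding L_def is_functional_Sum_any[OF \<phi> finL]
        conjunct1[OF fps_to_fls_times_nth[of ?e "iterate_series \<phi> u v c w" d]]
      by (simp add: is_functionalD[OF \<phi>] iterate_series_nth[OF \<phi> w] algebra_simps)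
    show ?thesis
      using finP by (simp only: phi_pair_def fls_eq_iff R L) auto
  qed
  show ?thesis
    unfolding id
  proof
    assume "\<forall>c d. L c d = R c d"
    then show "\<forall>\<phi> c. is_functional s \<phi> \<longrightarrow> phi_pair T k (product_series \<phi> u v c w) (iterate_series \<phi> u v c w)"
      using pair by simp
  next
    assume *: "\<forall>\<phi> c. is_functional s \<phi> \<longrightarrow> phi_pair T k (product_series \<phi> u v c w) (iterate_series \<phi> u v c w)"
    show "\<forall>c d. L c d = R c d"
    proof (intro allI)
      fix c d
      show "L c d = R c d"
        by (rule functional_eqI[OF W]) (use * pair in blast)
    qed
  qed
qed

text \<open>Term by term, the defining sum of \<open>residue_product\<close> is the sum in
  \<open>twist_nth\<close>.\<close>

lemma iterate_series_residue_product:
  assumes \<phi>: "is_functional s \<phi>" and w: "w \<in> total_space G"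
  shows "\<phi> (coeff Y (residue_product M (N + 1) u v) c w) = twist M (iterate_series \<phi> u v c w) $$ N"
proof -
  let ?r = "\<lambda>n. fls_residue (fps_to_fls (fps_binomial M) * fls_X_intpow (- (N + 1)) *
      fps_to_fls (fps_ln 1) powi (- n - 1))"
  obtain K where K: "\<forall>n\<ge>K. mode u n v = 0" using truncation by blast
  \<comment> \<open>An auxiliary series with all coefficients 1 from - K on. Through it
    \<open>twist_nth\<close> gives the finiteness of the sum in V, where no functional has been
    applied yet.\<close>
  define A :: "complex fls" where "A = Abs_fls (\<lambda>d. if d < - K then 0 else 1)"
  have A: "A $$ d = (if d < - K then 0 else 1)" for d
    unfolding A_def by (rule nth_Abs_fls_lower_bound[of "- K"]) simp
  have sub: "{n. ?r n *v mode u n v \<noteq> 0} \<subseteq> {n. ?r n * A $$ (- n - 1) \<noteq> 0}"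
  proof
    fix n assume n: "n \<in> {n. ?r n *v mode u n v \<noteq> 0}"
    then have "\<not> n \<ge> K" using K by auto
    then show "n \<in> {n. ?r n * A $$ (- n - 1) \<noteq> 0}" using n A by auto
  qed
  have fin: "finite {n. ?r n *v mode u n v \<noteq> 0}"
    by (rule finite_subset[OF sub]) (rule conjunct2[OF twist_nth])
  have fin': "finite {n. coeff Y (?r n *v mode u n v) c w \<noteq> 0}"
    by (rule finite_subset[OF _ fin]) (use w in auto)
  have "\<phi> (coeff Y (residue_product M (N + 1) u v) c w) = Sum_any (\<lambda>n. \<phi> (coeff Y (?r n *v mode u n v) c w))"
    unfolding residue_product_def coeff_Sum_any[OF fin w] is_functional_Sum_any[OF \<phi> fin'] ..
  also have "\<dots> = Sum_any (\<lambda>n. ?r n * iterate_series \<phi> u v c w $$ (- n - 1))"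
    by (simp add: coeff_scale_left w is_functionalD[OF \<phi>] iterate_series_nth[OF \<phi> w] del: fls_residue_def)
  also have "\<dots> = twist M (iterate_series \<phi> u v c w) $$ N"
    by (rule conjunct1[OF twist_nth, symmetric])
  finally show ?thesis .
qed

end

lemma phi_pair_add:
  assumes "phi_pair h k F A" "phi_pair h k F' A'"
  shows "phi_pair h k (\<lambda>a. F a + F' a) (A + A')"
  using phi_pair_sum[of "{0, 1 :: nat}" h k "\<lambda>x. if x = 0 then F else F'" "\<lambda>x. if x = 0 then A else A'"] assms
  by (simp add: fun_eq_iff)

lemma phi_pair_0: "phi_pair h k (\<lambda>_. 0) 0"
  by (simp add: phi_pair_def sdiff_def expsum_def)

section \<open>The exponents in the product formula\<close>

context vertex_algebra_with_automorphism
begin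

text \<open>On a vector of degree \<open>m/T\<close>, the powers of \<open>x\<close> in \<open>Y\<^sub>W(u,x)\<close> with \<open>u\<close> in \<open>eigenspace r\<close> are at least
  \<open>- least_power r m / T\<close>.\<close>

definition least_power :: "nat \<Rightarrow> nat \<Rightarrow> int" where
  "least_power r m = int T * (int (m div T) + delta (m mod T) r - 1) + int r"

text \<open>One more than the integer part of (n + \<open>least_power r m\<close>)/T, by
  \<open>degree_bound_eq\<close>. In the definition of \<open>bullet_homogeneous\<close> it is the
  exponent \<open>e\<close> increased by \<open>p div T\<close>.\<close>

definition degree_bound :: "nat \<Rightarrow> nat \<Rightarrow> nat \<Rightarrow> int" where
  "degree_bound r m n = int (m div T) + int (n div T) + delta (m mod T) r + delta (n mod T) (T - r)"

abbreviation twist_power :: "nat \<Rightarrow> nat \<Rightarrow> complex" where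
  "twist_power r m \<equiv> of_int (least_power r m) / of_nat T"

lemma twist_power_eq:
  "- 1 + of_nat (m div T) + of_int (delta (m mod T) r) + of_nat r / of_nat T = twist_power r m"
  using T_pos by (simp add: least_power_def field_simps)

lemma int_div_mod: "int m = int T * int (m div T) + int (m mod T)" "int (m mod T) < int T"
  using T_pos by (simp_all flip: of_nat_mult of_nat_add)

lemma least_power_bounds:
  assumes "r < T"
  shows "least_power r m \<le> int m" "int m < least_power r m + int T"
proof -
  obtain q x where "m div T = q" "m mod T = x" "int m = int T * int q + int x" "int x < int T"
    using int_div_mod[of m] by blast
  then show "least_power r m \<le> int m" "int m < least_power r m + int T"
    using assms by (auto simp: least_power_def delta_def algebra_simps)
qed

text \<open>The second \<open>delta\<close> in \<open>degree_bound\<close> is the carry when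
  \<open>n mod T\<close> and \<open>r\<close> are added.\<close>

lemma degree_bound_eq:
  assumes "r < T"
  shows "0 \<le> int n + least_power r m - int T * (degree_bound r m n - 1)"
    "int n + least_power r m - int T * (degree_bound r m n - 1) < int T"
proof -
  obtain q x where "n div T = q" "n mod T = x" "int n = int T * int q + int x" "int x < int T"
    using int_div_mod[of n] by blast
  then show "0 \<le> int n + least_power r m - int T * (degree_bound r m n - 1)"
    "int n + least_power r m - int T * (degree_bound r m n - 1) < int T"
    using assms by (auto simp: least_power_def degree_bound_def delta_def algebra_simps)
qed

lemma residue_product_0_left [simp]: "residue_product a e 0 v = 0"
  by (simp add: residue_product_def)

lemma residue_product_0_right [simp]: "residue_product a e u 0 = 0"
  by (simp add: residue_product_def)

text \<open>Rewritten with the exponent s = \<open>degree_bound r m n - 1 - p div T + i\<close> of z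
  - 1, so that the sum can be recognized as \<open>inf_coeff\<close>.\<close>

lemma bullet_homogeneous_eq:
  "bullet_homogeneous r m p n u v =
    (\<Sum>i\<le>p div T. ((- 1) ^ i * ((of_int (degree_bound r m n - 1 - int (p div T) + int i) :: complex) gchoose i)) *v
      residue_product (twist_power r m) (degree_bound r m n - 1 - int (p div T) + int i + 1) u v)"
  unfolding bullet_homogeneous_def Let_def twist_power_eq
  by (intro sum.cong refl) (simp add: degree_bound_def algebra_simps)

lemma bullet_homogeneous_0 [simp]: "bullet_homogeneous r m p n 0 v = 0" "bullet_homogeneous r m p n u 0 = 0"
  by (simp_all add: bullet_homogeneous_eq)

lemma eigen_component_eigen: "u \<in> eigenspace r \<Longrightarrow> component eigenspace u = (\<lambda>q. if q = r then u else 0)"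
  by (rule component_single[OF vector_space_scale graded_eigenspace])

lemma bullet_eq:
  "bullet m p n u v = bullet_homogeneous (nat ((int p - int n) mod int T)) m p n
     (component eigenspace u (nat ((int p - int n) mod int T))) v"
proof -
  let ?q = "nat ((int p - int n) mod int T)"
  have q: "?q < T" "\<And>r. (int p - int n) mod int T = int r \<longleftrightarrow> r = ?q"
    using T_pos by (auto simp: nat_less_iff)
  then show ?thesis by (simp add: bullet_def q(2) sum.delta)
qed

lemma bullet_0 [simp]: "bullet m p n 0 v = 0" "bullet m p n u 0 = 0"
  using eigen_component_eigen[of 0 0] subspace_0[OF subspace_eigenspace] by (simp_all add: bullet_eq)

end

section \<open>Commutativity and the relations in a twisted module\<close>

context graded_operators
begin

text \<open>For v = \<open>vac\<close> the product series is a single monomial, so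
  \<open>phi_pair_finite\<close> applies and Y_W(Y(x,x0)vac,x2) is Y_W(x,x2 e^x0). In other words,
  translation acts as the Euler operator x d/dx, which multiplies x^(c/T) by c/T.\<close>

lemma phi_identity_vac:
  assumes phi: "graded_phi_module s G Y" and \<phi>: "is_functional s \<phi>" and w: "w \<in> total_space G"
  shows "\<phi> (coeff Y (mode x (- 1 - int i) vac) c w) = (of_int c / of_nat T) ^ i / fact i * \<phi> (coeff Y x c w)"
proof -
  let ?F = "product_series \<phi> x vac c w" and ?A = "iterate_series \<phi> x vac c w"
  obtain k where "truncated k x vac w" "phi_identity k x vac w"
    using phi w unfolding graded_phi_module_iff by blast
  then have pair: "phi_pair T k ?F ?A" using phi_identity_iff[OF w] \<phi> by blast
  have F: "?F a = (if a = c then \<phi> (coeff Y x c w) else 0)" for a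
    using w \<phi> by (auto simp: product_series_def vac_coeff is_functionalD)
  have fin: "finite {a. ?F a \<noteq> 0}" by (rule finite_subset[of _ "{c}"]) (auto simp: F)
  have "expsum T ?F = (\<Sum>a\<in>{c}. fps_const (?F a) * fps_exp (of_int a / of_nat T))"
    by (rule expsum_superset) (auto simp: F)
  then have "expsum T ?F = fps_const (\<phi> (coeff Y x c w)) * fps_exp (of_int c / of_nat T)" by (simp add: F)
  moreover have "?A = fps_to_fls (expsum T ?F)" using phi_pair_finite[OF pair _ fin] T_pos by simp
  ultimately have "?A $$ int i = \<phi> (coeff Y x c w) * (of_int c / of_nat T) ^ i / fact i" by simp
  moreover have "- int i - 1 = - 1 - int i" by simp
  ultimately show ?thesis
    using iterate_series_nth[OF \<phi> w, of x vac c "int i"] by (simp only: mult.commute times_divide_eq_right)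
qed

text \<open>Skew symmetry inside Y_W, with translation acting as in \<open>phi_identity_vac\<close>:
  Y_W(Y(u,x0)v,x2) = Y_W(Y(v,-x0)u,x2 e^x0). It supplies the hypothesis \<open>skew\<close> of
  \<open>phi_pair_commute\<close>.\<close>

lemma iterate_series_skew:
  assumes phi: "graded_phi_module s G Y" and \<phi>: "is_functional s \<phi>" and w: "w \<in> total_space G"
  shows "iterate_series \<phi> u v c w =
    fps_to_fls (fps_exp (of_int c / of_nat T)) * fls_compose_fps (iterate_series \<phi> v u c w) (- fps_X)"
proof -
  let ?z = "of_int c / of_nat T :: complex"
  have "fls_compose_fps (iterate_series \<phi> v u c w) (- fps_X) = fps_to_fls (fps_exp (- ?z)) * iterate_series \<phi> u v c w"
  proof (rule fls_eqI)
    fix d :: int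
    define q where "q = - d - 1"
    have d: "d = - q - 1" unfolding q_def by linarith
    let ?f = "\<lambda>i::nat. ((- 1) ^ i) *v mode (mode u (q + int i) v) (- 1 - int i) vac"
    have fin: "finite {i. ?f i \<noteq> 0}"
    proof -
      obtain N where N: "\<forall>n\<ge>N. mode u n v = 0" using truncation by blast
      have "{i. ?f i \<noteq> 0} \<subseteq> {..nat (N - q)}"
      proof
        fix i assume "i \<in> {i. ?f i \<noteq> 0}"
        then have "\<not> q + int i \<ge> N" using N by auto
        then show "i \<in> {..nat (N - q)}" by simp
      qed
      then show ?thesis by (rule finite_subset) simp
    qed
    have fin': "finite {i. coeff Y (?f i) c w \<noteq> 0}"
      by (rule finite_subset[OF _ fin]) (use w in auto)
    \<comment> \<open>Replacing x0 by - x0 multiplies the coefficient of x0^d by (- 1)^d; with d = -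
      q - 1 this is the sign in \<open>skew_symmetry\<close>.\<close>
    have "fls_compose_fps (iterate_series \<phi> v u c w) (- fps_X) $$ d = iterate_series \<phi> v u c w $$ d * (- 1) powi d"
      using fls_nth_fls_compose_fps_linear[of "- 1 :: complex" "iterate_series \<phi> v u c w" d]
      by (simp add: fps_const_neg[symmetric] del: fps_const_neg)
    also have "\<dots> = - ((- 1) powi q) * \<phi> (coeff Y (mode v q u) c w)"
      by (simp add: iterate_series_nth[OF \<phi> w] d power_int_diff power_int_minus_one_minus)
    also have "\<dots> = \<phi> (coeff Y ((- ((- 1) powi q)) *v mode v q u) c w)"
      using is_functionalD(2)[OF \<phi>] by (simp only: coeff_scale_left[OF w])
    also have "\<dots> = \<phi> (coeff Y (Sum_any ?f) c w)"
      by (simp only: skew_symmetry)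
    also have "\<dots> = Sum_any (\<lambda>i. \<phi> (coeff Y (?f i) c w))"
      unfolding coeff_Sum_any[OF fin w] is_functional_Sum_any[OF \<phi> fin'] ..
    also have "\<dots> = Sum_any (\<lambda>i. fps_exp (- ?z) $ i * iterate_series \<phi> u v c w $$ (d - int i))"
    proof (rule Sum_any.cong)
      fix i :: nat
      have "\<phi> (coeff Y (?f i) c w) = (- 1) ^ i * (?z ^ i / fact i * \<phi> (coeff Y (mode u (q + int i) v) c w))"
        by (simp add: coeff_scale_left[OF w] is_functionalD[OF \<phi>] phi_identity_vac[OF phi \<phi> w])
      also have "(- 1) ^ i * (?z ^ i / fact i * \<phi> (coeff Y (mode u (q + int i) v) c w)) =
         (- ?z) ^ i / fact i * \<phi> (coeff Y (mode u (q + int i) v) c w)"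
        by (simp add: power_minus[of ?z])
      finally show "\<phi> (coeff Y (?f i) c w) = fps_exp (- ?z) $ i * iterate_series \<phi> u v c w $$ (d - int i)"
        by (simp add: iterate_series_nth[OF \<phi> w] d algebra_simps)
    qed
    also have "\<dots> = (fps_to_fls (fps_exp (- ?z)) * iterate_series \<phi> u v c w) $$ d"
      by (rule conjunct1[OF fps_to_fls_times_nth, symmetric])
    finally show "fls_compose_fps (iterate_series \<phi> v u c w) (- fps_X) $$ d =
      (fps_to_fls (fps_exp (- ?z)) * iterate_series \<phi> u v c w) $$ d" .
  qed
  moreover have "fps_to_fls (fps_exp ?z) * (fps_to_fls (fps_exp (- ?z)) * A) = A" for A
    using fps_exp_add_mult[of ?z "- ?z"] by (simp add: mult.assoc[symmetric] fls_times_fps_to_fls[symmetric])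
  ultimately show ?thesis by simp
qed

text \<open>By commutativity the powers of \<open>x\<^sub>1\<close> are bounded by those in \<open>Y\<^sub>W(v,x\<^sub>2)Y\<^sub>W(u,x\<^sub>1)w\<close>.\<close>

lemma phi_pair_product_series:
  assumes phi: "graded_phi_module s G Y" and \<phi>: "is_functional s \<phi>" and w: "w \<in> G m"
  obtains k where "phi_pair T k (product_series \<phi> u v c w) (iterate_series \<phi> u v c w)"
    and "\<And>a. a < - int m \<Longrightarrow> sdiff T k (product_series \<phi> u v c w) a = 0"
proof -
  have w': "w \<in> total_space G" using total_mem[OF w] .
  have ex: "\<exists>k. phi_pair T k (product_series \<phi> u v c w) (iterate_series \<phi> u v c w)" for u v
    using phi w' phi_identity_iff[OF w'] \<phi> unfolding graded_phi_module_iff by meson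
  obtain k1 k2 where k: "phi_pair T k1 (product_series \<phi> u v c w) (iterate_series \<phi> u v c w)"
    "phi_pair T k2 (product_series \<phi> v u c w) (iterate_series \<phi> v u c w)" using ex by meson
  \<comment> \<open>A common exponent for the two orders of the product.\<close>
  define k where "k = max k1 k2"
  have T: "T > 0" using T_pos by simp
  have pair: "phi_pair T k (product_series \<phi> u v c w) (iterate_series \<phi> u v c w)"
    "phi_pair T k (product_series \<phi> v u c w) (iterate_series \<phi> v u c w)"
    using k phi_pair_mono[OF _ T] by (auto simp: k_def)
  show ?thesis
  proof (rule that[OF pair(1)])
    fix a assume a: "a < - int m"
    have "sdiff T k (product_series \<phi> u v c w) a = sdiff T k (\<lambda>a. product_series \<phi> v u c w (c - a)) a"
      by (rule phi_pair_commute[OF pair T iterate_series_skew[OF phi \<phi> w']])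
    also have "\<dots> = 0"
    \<comment> \<open>In the other order \<open>u\<close> acts first on \<open>w\<close>, and a
      power of x1 below - m/T would lead to negative degree.\<close>
    proof (rule sdiff_eq_0_below[OF _ a])
      fix t assume "t < - int m"
      then show "product_series \<phi> v u c w (c - t) = 0"
        using coeff_degree_neg[OF w, of t u] \<phi> by (simp add: product_series_def is_functionalD)
    qed
    finally show "sdiff T k (product_series \<phi> u v c w) a = 0" .
  qed
qed

lemma product_series_residue_class:
  assumes "u \<in> eigenspace r" "is_functional s \<phi>" "w \<in> total_space G" "product_series \<phi> u v c w a \<noteq> 0"
  shows "int T dvd a - (- least_power r m)"
proof -
  have "coeff Y u a (coeff Y v (c - a) w) \<noteq> 0"
    using assms by (auto simp: product_series_def is_functionalD)
  then have "int T dvd a + int r" using coeff_eigen[OF assms(1) coeff_closed] assms(3) by blast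
  then have "int T dvd (a + int r) + int T * (int (m div T) + delta (m mod T) r - 1)"
    by (rule dvd_add) simp
  then show ?thesis by (simp add: least_power_def algebra_simps)
qed

text \<open>The exponent that remains for \<open>v\<close> is so low that \<open>v\<close> would map
  \<open>w\<close> to negative degree.\<close>

lemma product_series_above:
  assumes "r < T" "w \<in> G m" "is_functional s \<phi>" "t \<ge> degree_bound r m n"
  shows "product_series \<phi> u v (int n - int m) w (- least_power r m + int T * t) = 0"
proof -
  let ?c = "int n - int m - (- least_power r m + int T * t)"
  have "int T * t \<ge> int T * degree_bound r m n" using assms(4) by (intro mult_left_mono) auto
  then have "int m + ?c < 0" using degree_bound_eq(2)[OF assms(1), of n m] by (simp add: algebra_simps)
  then show ?thesis
    using coeff_degree_neg[OF assms(2), of ?c v] assms(3) by (simp add: product_series_def is_functionalD)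
qed

text \<open>The exponent of z is chosen so that the range of \<open>i\<close> in
  \<open>inf_coeff\<close> ends at \<open>p div T\<close>, as it does in
  \<open>bullet_homogeneous\<close>.\<close>

lemma bullet_homogeneous_inf_coeff:
  assumes \<phi>: "is_functional s \<phi>" and w: "w \<in> total_space G"
  shows "\<phi> (coeff Y (bullet_homogeneous r m p n u v) c w) =
    inf_coeff (fls_nth (twist (twist_power r m) (iterate_series \<phi> u v c w))) (degree_bound r m n)
      (degree_bound r m n - 1 - int (p div T))"
  unfolding bullet_homogeneous_eq coeff_sum_left[OF w] is_functional_sum[OF \<phi>] coeff_scale_left[OF w]
    is_functionalD(2)[OF \<phi>] iterate_series_residue_product[OF \<phi> w] inf_coeff_def
  by simp

text \<open>A dictionary between the intermediate degree p/T and the integral power t of z after the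
  shift by \<open>least_power\<close>.\<close>

lemma product_index:
  assumes r: "r < T"
  shows "int n - int p = - least_power r m + int T * t \<longleftrightarrow>
    (int p - int n) mod int T = int r \<and> t = degree_bound r m n - 1 - int (p div T)"
proof -
  \<comment> \<open>The remainder that \<open>p\<close> must have modulo \<open>T\<close> if
    \<open>p - n\<close> is congruent to \<open>r\<close>.\<close>
  define x where "x = int n + least_power r m - int T * (degree_bound r m n - 1)"
  have x: "0 \<le> x" "x < int T" using degree_bound_eq[OF r] by (simp_all add: x_def)
  have T: "int T > 0" using T_pos by simp
  show ?thesis
  proof
    assume *: "int n - int p = - least_power r m + int T * t"
    have "int p - int n = int r + int T * (int (m div T) + delta (m mod T) r - 1 - t)"
      using * by (simp add: least_power_def algebra_simps)
    then have 1: "(int p - int n) mod int T = int r" using r by simp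
    have "int p = x + int T * (degree_bound r m n - 1 - t)"
      using * by (simp add: x_def algebra_simps)
    then have "int p div int T = degree_bound r m n - 1 - t" using x T by simp
    then show "(int p - int n) mod int T = int r \<and> t = degree_bound r m n - 1 - int (p div T)"
      using 1 by (simp add: zdiv_int)
  next
    assume *: "(int p - int n) mod int T = int r \<and> t = degree_bound r m n - 1 - int (p div T)"
    have "int p - int n = int T * ((int p - int n) div int T) + (int p - int n) mod int T" by simp
    then have "int p - int n = int T * ((int p - int n) div int T) + int r" using * by simp
    then have "int p - x = int T * ((int p - int n) div int T + (degree_bound r m n - 1) -
        (int (m div T) + delta (m mod T) r - 1))"
      by (simp add: x_def least_power_def algebra_simps)
    then have "int p mod int T = x mod int T" by (simp add: mod_eq_dvd_iff)
    then have "int p mod int T = x" using x by simp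
    then have "int p = int T * (int p div int T) + x" using mult_div_mod_eq[of "int T" "int p"] by simp
    moreover have "int T * t = int T * (degree_bound r m n - 1) - int T * (int p div int T)"
      using * by (simp add: zdiv_int right_diff_distrib)
    ultimately show "int n - int p = - least_power r m + int T * t"
      unfolding x_def by linarith
  qed
qed

text \<open>Composing the actions of \<open>elementary n p u\<close> and
  \<open>elementary p m v\<close> follows the rule of \<open>elementary_mult\<close>.\<close>

definition product_formula :: bool where
  "product_formula \<longleftrightarrow> (\<forall>u v m p n. \<forall>w\<in>G m.
     coeff Y u (int n - int p) (coeff Y v (int p - int m) w) = coeff Y (bullet m p n u v) (int n - int m) w)"

text \<open>The coefficients of (z - 1)^t at and above \<open>degree_bound\<close> act by zero. All
  exponents in \<open>bullet\<close> lie below this bound, so these relations have to be recorded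
  separately.\<close>

definition residues_vanish :: bool where
  "residues_vanish \<longleftrightarrow> (\<forall>r<T. \<forall>u\<in>eigenspace r. \<forall>v m n. \<forall>t\<ge>degree_bound r m n. \<forall>w\<in>G m.
     coeff Y (residue_product (twist_power r m) (t + 1) u v) (int n - int m) w = 0)"

text \<open>The lower bound from commutativity and the upper bound from the grading meet here, in
  integral powers of z. The exponent \<open>k\<close> occurs only within the proof.\<close>

lemma phi_module_inf_coeff:
  assumes phi: "graded_phi_module s G Y" and \<phi>: "is_functional s \<phi>" and w: "w \<in> G m"
    and r: "r < T" and u: "u \<in> eigenspace r"
  shows "t \<ge> degree_bound r m n \<Longrightarrow>
      twist (twist_power r m) (iterate_series \<phi> u v (int n - int m) w) $$ t = 0"
    and "product_series \<phi> u v (int n - int m) w (- least_power r m + int T * t) =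
      inf_coeff (fls_nth (twist (twist_power r m) (iterate_series \<phi> u v (int n - int m) w))) (degree_bound r m n) t"
proof -
  let ?c = "int n - int m"
  let ?F = "product_series \<phi> u v ?c w" and ?A = "iterate_series \<phi> u v ?c w"
  let ?f = "\<lambda>t. ?F (- least_power r m + int T * t)"
  have w': "w \<in> total_space G" using total_mem[OF w] .
  have T: "T > 0" using T_pos by simp
  obtain k where pair: "phi_pair T k ?F ?A" and low: "\<And>a. a < - int m \<Longrightarrow> sdiff T k ?F a = 0"
    using phi_pair_product_series[OF phi \<phi> w, of u v ?c] by metis
  have off: "int T dvd a - (- least_power r m)" if "?F a \<noteq> 0" for a
    by (rule product_series_residue_class[OF u \<phi> w' that])
  have pair': "phi_pair 1 k ?f (fps_to_fls (fps_exp (twist_power r m)) * ?A)"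
    using pair phi_pair_residue_class[where k = k and A = ?A, OF T off] by simp
  \<comment> \<open>By maximality of \<open>least_power\<close>, an exponent with t < 0 lies below -
    m.\<close>
  have low': "sdiff 1 k ?f t = 0" if "t < 0" for t
  proof -
    have "int T * t \<le> int T * (- 1)" using that by (intro mult_left_mono) auto
    then have "- least_power r m + int T * t < - int m" using least_power_bounds[OF r, of m] by linarith
    then show ?thesis using low unfolding sdiff_residue_class[symmetric] by blast
  qed
  note * = phi_pair_inf_coeff[OF pair' low' product_series_above[OF r w \<phi>]]
  show "t \<ge> degree_bound r m n \<Longrightarrow> twist (twist_power r m) ?A $$ t = 0" using *(1) by blast
  show "?F (- least_power r m + int T * t) = inf_coeff (fls_nth (twist (twist_power r m) ?A)) (degree_bound r m n) t"
    using *(2) by blast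
qed

theorem phi_module_product_formula:
  assumes phi: "graded_phi_module s G Y"
  shows product_formula
  unfolding product_formula_def
proof (intro allI ballI)
  fix u v m p n w assume w: "w \<in> G m"
  have w': "w \<in> total_space G" using total_mem[OF w] .
  define q where "q = nat ((int p - int n) mod int T)"
  define u' where "u' = component eigenspace u q"
  have q: "q < T" "(int p - int n) mod int T = int q"
    using T_pos by (auto simp: q_def nat_less_iff)
  have u': "u' \<in> eigenspace q" by (simp add: u'_def eigen_component)
  let ?t = "degree_bound q m n - 1 - int (p div T)"
  have idx: "int n - int p = - least_power q m + int T * ?t"
    using product_index[OF q(1), of n p m ?t] q(2) by blast
  let ?x = "coeff Y v (int p - int m) w"
  have x: "?x \<in> total_space G" using coeff_closed[OF w'] .
  have "coeff Y u (int n - int p) ?x = (\<Sum>r<T. coeff Y (component eigenspace u r) (int n - int p) ?x)"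
    using coeff_sum_left[OF x, of "\<lambda>r. component eigenspace u r" "{..<T}"] by (simp add: eigen_component)
  \<comment> \<open>The remaining eigencomponents of \<open>u\<close> have no coefficient at this
    power of x1.\<close>
  also have "\<dots> = (\<Sum>r<T. if r = q then coeff Y u' (int n - int p) ?x else 0)"
  proof (intro sum.cong refl)
    fix r assume r: "r \<in> {..<T}"
    show "coeff Y (component eigenspace u r) (int n - int p) ?x = (if r = q then coeff Y u' (int n - int p) ?x else 0)"
    proof (cases "r = q")
      case False
      have "\<not> int T dvd int n - int p + int r"
      proof
        assume "int T dvd int n - int p + int r"
        then have "int T dvd int r - (int p - int n)" by (simp add: algebra_simps)
        then have "int r mod int T = (int p - int n) mod int T" by (simp add: mod_eq_dvd_iff)
        then show False using r False q by simp
      qed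
      then show ?thesis using coeff_eigen[OF eigen_component(1) x] False by auto
    qed (simp add: u'_def)
  qed
  also have "\<dots> = coeff Y u' (int n - int p) ?x" using q by simp
  also have "\<dots> = coeff Y (bullet_homogeneous q m p n u' v) (int n - int m) w"
  proof (rule functional_eqI[OF W])
    fix \<phi> assume \<phi>: "is_functional s \<phi>"
    have "\<phi> (coeff Y u' (int n - int p) ?x) = product_series \<phi> u' v (int n - int m) w (int n - int p)"
      by (simp add: product_series_def)
    also have "\<dots> = \<phi> (coeff Y (bullet_homogeneous q m p n u' v) (int n - int m) w)"
      unfolding idx bullet_homogeneous_inf_coeff[OF \<phi> w'] by (rule phi_module_inf_coeff(2)[OF phi \<phi> w q(1) u'])
    finally show "\<phi> (coeff Y u' (int n - int p) ?x) = \<phi> (coeff Y (bullet_homogeneous q m p n u' v) (int n - int m) w)" .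
  qed
  finally show "coeff Y u (int n - int p) ?x = coeff Y (bullet m p n u v) (int n - int m) w"
    by (simp add: bullet_eq u'_def q_def)
qed

theorem phi_module_residues_vanish:
  assumes phi: "graded_phi_module s G Y"
  shows residues_vanish
  unfolding residues_vanish_def
proof (intro allI ballI impI)
  fix r u v m n t w
  assume r: "r < T" and u: "u \<in> eigenspace r" and t: "degree_bound r m n \<le> t" and w: "w \<in> G m"
  have w': "w \<in> total_space G" using total_mem[OF w] .
  show "coeff Y (residue_product (twist_power r m) (t + 1) u v) (int n - int m) w = 0"
  proof (rule functional_eqI[OF W])
    fix \<phi> assume \<phi>: "is_functional s \<phi>"
    show "\<phi> (coeff Y (residue_product (twist_power r m) (t + 1) u v) (int n - int m) w) = \<phi> 0"
      using phi_module_inf_coeff(1)[OF phi \<phi> w r u t] \<phi>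
      by (simp add: iterate_series_residue_product[OF \<phi> w'] is_functionalD)
  qed
qed

section \<open>From the relations back to the module axiom\<close>

lemma product_series_add:
  assumes "is_functional s \<phi>"
  shows "w \<in> total_space G \<Longrightarrow> product_series \<phi> (u + u') v c w a = product_series \<phi> u v c w a + product_series \<phi> u' v c w a"
    and "x \<in> total_space G \<Longrightarrow> y \<in> total_space G \<Longrightarrow>
      product_series \<phi> u v c (x + y) a = product_series \<phi> u v c x a + product_series \<phi> u v c y a"
  by (simp_all add: product_series_def coeff_add_left coeff_closed coeff_add is_functionalD[OF assms])

lemma iterate_series_add:
  assumes "is_functional s \<phi>"
  shows "w \<in> total_space G \<Longrightarrow> iterate_series \<phi> (u + u') v c w = iterate_series \<phi> u v c w + iterate_series \<phi> u' v c w"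
    and "x \<in> total_space G \<Longrightarrow> y \<in> total_space G \<Longrightarrow>
      iterate_series \<phi> u v c (x + y) = iterate_series \<phi> u v c x + iterate_series \<phi> u v c y"
  by (auto intro!: fls_eqI simp: iterate_series_nth[OF assms] W.subspace_add[OF subspace_total] mode_add_left
      coeff_add_left coeff_add is_functionalD[OF assms])

lemma product_coeff_add:
  shows "w \<in> total_space G \<Longrightarrow> product_coeff s Y k (u + u') v a b w = product_coeff s Y k u v a b w + product_coeff s Y k u' v a b w"
    and "x \<in> total_space G \<Longrightarrow> y \<in> total_space G \<Longrightarrow>
      product_coeff s Y k u v a b (x + y) = product_coeff s Y k u v a b x + product_coeff s Y k u v a b y"
  by (simp_all add: product_coeff_def coeff_add_left coeff_closed coeff_add W.scale_right_distrib sum.distrib)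

text \<open>The axiom for a fixed \<open>k\<close>, in scalar form. For fixed \<open>k\<close> it is
  additive in \<open>u\<close> and in \<open>w\<close>, so that it can be checked on eigenvectors
  and homogeneous vectors.\<close>

definition phi_axiom :: "nat \<Rightarrow> 'v \<Rightarrow> 'v \<Rightarrow> 'w \<Rightarrow> bool" where
  "phi_axiom k u v w \<longleftrightarrow> truncated k u v w \<and>
    (\<forall>\<phi> c. is_functional s \<phi> \<longrightarrow> phi_pair T k (product_series \<phi> u v c w) (iterate_series \<phi> u v c w))"

lemma truncated_add:
  assumes "truncated k u v w" "truncated k u' v' w'"
    and "\<And>a b. product_coeff s Y k u'' v'' a b w'' = product_coeff s Y k u v a b w + product_coeff s Y k u' v' a b w'"
  shows "truncated k u'' v'' w''"
proof -
  obtain M N where "\<forall>a b. a < M \<or> b < M \<longrightarrow> product_coeff s Y k u v a b w = 0"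
    "\<forall>a b. a < N \<or> b < N \<longrightarrow> product_coeff s Y k u' v' a b w' = 0"
    using assms(1,2) by (auto simp: truncated_def)
  then have "\<forall>a b. a < min M N \<or> b < min M N \<longrightarrow> product_coeff s Y k u'' v'' a b w'' = 0"
    by (auto simp: assms(3))
  then show ?thesis unfolding truncated_def by blast
qed

lemma phi_axiom_add_left:
  assumes w: "w \<in> total_space G" and "phi_axiom k u v w" "phi_axiom k u' v w"
  shows "phi_axiom k (u + u') v w"
proof -
  have "phi_pair T k (product_series \<phi> (u + u') v c w) (iterate_series \<phi> (u + u') v c w)"
    if \<phi>: "is_functional s \<phi>" for \<phi> c
  proof -
    have "product_series \<phi> (u + u') v c w = (\<lambda>a. product_series \<phi> u v c w a + product_series \<phi> u' v c w a)"
      using product_series_add(1)[OF \<phi> w] by blast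
    then show ?thesis
      using assms \<phi> phi_pair_add by (simp add: iterate_series_add(1)[OF \<phi> w] phi_axiom_def)
  qed
  then show ?thesis
    using assms truncated_add[of k u v w u' v w] product_coeff_add(1)[OF w] unfolding phi_axiom_def by blast
qed

lemma phi_axiom_add:
  assumes xy: "x \<in> total_space G" "y \<in> total_space G" and "phi_axiom k u v x" "phi_axiom k u v y"
  shows "phi_axiom k u v (x + y)"
proof -
  have "phi_pair T k (product_series \<phi> u v c (x + y)) (iterate_series \<phi> u v c (x + y))"
    if \<phi>: "is_functional s \<phi>" for \<phi> c
  proof -
    have "product_series \<phi> u v c (x + y) = (\<lambda>a. product_series \<phi> u v c x a + product_series \<phi> u v c y a)"
      using product_series_add(2)[OF \<phi> xy] by blast
    then show ?thesis
      using assms \<phi> phi_pair_add by (simp add: iterate_series_add(2)[OF \<phi> xy] phi_axiom_def)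
  qed
  then show ?thesis
    using assms truncated_add[of k u v x u v y] product_coeff_add(2)[OF xy] unfolding phi_axiom_def by blast
qed

text \<open>Every \<open>k\<close> that bounds the pole of Y(u,x)v works, whatever \<open>w\<close>
  is; this is the uniformity that the axiom demands. The relations present the product as an
  expansion at infinity, so \<open>inf_coeff_phi_pair\<close> applies.\<close>

lemma phi_axiom_homogeneous:
  assumes pf: product_formula and van: residues_vanish
    and r: "r < T" and u: "u \<in> eigenspace r" and w: "w \<in> G m" and k: "\<And>n. n \<ge> int k \<Longrightarrow> mode u n v = 0"
  shows "phi_axiom k u v w"
proof -
  have w': "w \<in> total_space G" using total_mem[OF w] .
  have T: "T > 0" using T_pos by simp
  have main: "phi_pair T k (product_series \<phi> u v c w) (iterate_series \<phi> u v c w) \<and>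
      (\<forall>a < - int m. sdiff T k (product_series \<phi> u v c w) a = 0)" if \<phi>: "is_functional s \<phi>" for \<phi> c
  proof (cases "int m + c < 0")
    \<comment> \<open>The target degree would be negative. The relations do not cover this case, but
      both series vanish.\<close>
    case True
    have "product_series \<phi> u v c w a = 0" for a
    proof (cases "int m + (c - a) < 0")
      case False
      then have "coeff Y v (c - a) w \<in> G (nat (int m + (c - a)))" using coeff_degree[OF w] by simp
      from coeff_degree_neg[OF this, of a u] False True show ?thesis
        by (simp add: product_series_def is_functionalD[OF \<phi>])
    qed (simp add: product_series_def is_functionalD[OF \<phi>] coeff_degree_neg[OF w])
    then have F: "product_series \<phi> u v c w = (\<lambda>_. 0)" by blast
    have "iterate_series \<phi> u v c w = 0"
      using True by (intro fls_eqI) (simp add: iterate_series_nth[OF \<phi> w'] coeff_degree_neg[OF w] is_functionalD[OF \<phi>])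
    then show ?thesis unfolding F by (simp add: phi_pair_0, simp add: sdiff_def)
  next
    case False
    define n where "n = nat (int m + c)"
    have c: "c = int n - int m" using False by (simp add: n_def)
    let ?F = "product_series \<phi> u v c w" and ?A = "iterate_series \<phi> u v c w"
    let ?f = "\<lambda>t. ?F (- least_power r m + int T * t)"
    let ?e = "degree_bound r m n"
    have R: "twist (twist_power r m) ?A $$ t = 0" if "t \<ge> ?e" for t
      using van r u that w unfolding residues_vanish_def
      by (simp add: iterate_series_residue_product[OF \<phi> w', symmetric] is_functionalD[OF \<phi>] c)
    have A: "?A $$ t = 0" if "t < - int k" for t
      using k[of "- t - 1"] that w' by (simp add: iterate_series_nth[OF \<phi> w'] is_functionalD[OF \<phi>])
    have f: "?f t = inf_coeff (fls_nth (twist (twist_power r m) ?A)) ?e t" for t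
    proof (cases "t \<ge> ?e")
      case True
      then show ?thesis using product_series_above[OF r w \<phi> True] by (simp add: inf_coeff_def c)
    next
      case False
      \<comment> \<open>The intermediate degree that belongs to \<open>t\<close>; it is nonnegative
        because t < \<open>?e\<close>.\<close>
      define p where "p = nat (int n + least_power r m - int T * t)"
      have "int T * t \<le> int T * (?e - 1)" using False by (intro mult_left_mono) auto
      then have p: "int n - int p = - least_power r m + int T * t"
        using degree_bound_eq(1)[OF r, of n m] by (simp add: p_def)
      then have idx: "(int p - int n) mod int T = int r" "t = ?e - 1 - int (p div T)"
        using product_index[OF r, of n p m t] by auto
      have "?f t = \<phi> (coeff Y u (int n - int p) (coeff Y v (int p - int m) w))"
      proof -
        have "c - (int n - int p) = int p - int m" using c by simp
        then show ?thesis by (simp only: product_series_def p[symmetric])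
      qed
      also have "\<dots> = \<phi> (coeff Y (bullet m p n u v) c w)"
        using pf w by (simp add: product_formula_def c)
      also have "bullet m p n u v = bullet_homogeneous r m p n u v"
        using eigen_component_eigen[OF u] by (simp add: bullet_eq idx(1))
      finally show ?thesis
        by (simp add: bullet_homogeneous_inf_coeff[OF \<phi> w'] idx(2)[symmetric])
    qed
    note * = inf_coeff_phi_pair[OF R A f]
    have off: "int T dvd a - (- least_power r m)" if "?F a \<noteq> 0" for a
      by (rule product_series_residue_class[OF u \<phi> w' that])
    have "sdiff T k ?F a = 0" if a: "a < - int m" for a
    proof (cases "int T dvd a - (- least_power r m)")
      case True
      then obtain t where "a - (- least_power r m) = int T * t" by (auto elim: dvdE)
      then have t: "a = - least_power r m + int T * t" by simp
      have "int T * t < 0" using a least_power_bounds(1)[OF r, of m] t by linarith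
      then have "t < 0" by (simp add: mult_less_0_iff)
      then show ?thesis unfolding t sdiff_residue_class using *(2) by blast
    next
      case False
      then show ?thesis using sdiff_off_residue_class[of ?F T "- least_power r m" a k] off by blast
    qed
    moreover have "phi_pair T k ?F ?A"
      using *(1) phi_pair_residue_class[where k = k and A = ?A, OF T off] by simp
    ultimately show ?thesis by blast
  qed
  \<comment> \<open>The bound is - m in both variables: for x1 by \<open>main\<close>, for x2
    because \<open>v\<close> acts on \<open>w\<close> first.\<close>
  have "truncated k u v w"
    unfolding truncated_def
  proof (intro exI allI impI)
    fix a b assume ab: "a < - int m \<or> b < - int m"
    show "product_coeff s Y k u v a b w = 0"
    proof (cases "a < - int m")
      case True
      show ?thesis
      proof (rule functional_eqI[OF W])
        fix \<phi> assume \<phi>: "is_functional s \<phi>"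
        have "\<phi> (product_coeff s Y k u v a b w) =
            sdiff T k (product_series \<phi> u v (a + b - int T * int k) w) a"
          using product_coeff_sdiff[OF \<phi>, of k u v a "a + b - int T * int k" w] by simp
        then show "\<phi> (product_coeff s Y k u v a b w) = \<phi> 0"
          using main[OF \<phi>] True by (simp add: is_functionalD[OF \<phi>])
      qed
    next
      case False
      have "coeff Y v (b - int T * int i) w = 0" for i
        using ab False by (intro coeff_degree_neg[OF w]) (smt (verit, best) of_nat_0_le_iff mult_nonneg_nonneg)
      then show ?thesis by (simp add: product_coeff_def)
    qed
  qed
  then show ?thesis using main by (simp add: phi_axiom_def)
qed

theorem graded_phi_moduleI:
  assumes pf: product_formula and van: residues_vanish
  shows "graded_phi_module s G Y"
  unfolding graded_phi_module_iff
proof (intro allI)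
  fix u v
  have "u \<in> total_space eigenspace" by (simp add: eigen_component)
  with vector_space_scale graded_eigenspace
  \<comment> \<open>Strengthened to all \<open>k\<close> from some \<open>K\<close> on, so that the
    maximum of two bounds serves for a sum of eigenvectors.\<close>
  have "\<exists>K. \<forall>k\<ge>K. \<forall>w\<in>total_space G. phi_axiom k u v w"
  proof (induction u rule: total_space_induct)
    case (hom r u)
    show ?case
    proof (cases "r < T")
      case True
      obtain K where K: "\<forall>n\<ge>int K. mode u n v = 0" using truncation_nat by blast
      have "phi_axiom k u v w" if "k \<ge> K" "w \<in> total_space G" for k w
        using W graded that(2)
      proof (induction w rule: total_space_induct)
        case (hom m w)
        then show ?case
          using K that(1) by (intro phi_axiom_homogeneous[OF pf van True \<open>u \<in> eigenspace r\<close>]) auto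
      next
        case (add x y)
        then show ?case by (intro phi_axiom_add)
      qed
      then show ?thesis by blast
    next
      case False
      \<comment> \<open>Beyond \<open>T\<close> the eigenspaces are zero by definition, so
        \<open>u\<close> can be regarded as the zero vector of \<open>eigenspace 0\<close>.\<close>
      then have 0: "u \<in> eigenspace 0" "u = 0"
        using hom subspace_0[OF subspace_eigenspace] by (simp_all add: eigenspace_def)
      have "phi_axiom k u v w" if "w \<in> total_space G" for k w
        using W graded that
      proof (induction w rule: total_space_induct)
        case (hom m w)
        then show ?case
          using T_pos 0(2) by (intro phi_axiom_homogeneous[OF pf van _ 0(1)]) auto
      next
        case (add x y)
        then show ?case by (intro phi_axiom_add)
      qed
      then show ?thesis by blast
    qed
  next
    case (add u u')
    then obtain K K' where "\<forall>k\<ge>K. \<forall>w\<in>total_space G. phi_axiom k u v w" "\<forall>k\<ge>K'. \<forall>w\<in>total_space G. phi_axiom k u' v w"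
      by blast
    then have "\<forall>k\<ge>max K K'. \<forall>w\<in>total_space G. phi_axiom k (u + u') v w"
      by (auto intro: phi_axiom_add_left)
    then show ?case by blast
  qed
  then obtain K where "\<forall>w\<in>total_space G. phi_axiom K u v w" by blast
  then have "\<forall>w\<in>total_space G. truncated K u v w \<and> phi_identity K u v w"
    using phi_identity_iff by (simp add: phi_axiom_def)
  then show "\<exists>k. \<forall>w\<in>total_space G. truncated k u v w \<and> phi_identity k u v w" by blast
qed

end

section \<open>Transport of a module along an injective linear map\<close>

text \<open>Since \<open>h\<close> kills only 0 in \<open>S\<close>, the supports agree; for an
  infinite support both sums are 0 by convention.\<close>

lemma Sum_any_inj_hom:
  assumes f: "\<And>a. f a \<in> S"
    and S: "0 \<in> S" "\<And>x y. x \<in> S \<Longrightarrow> y \<in> S \<Longrightarrow> x + y \<in> S"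
    and h: "\<And>x y. x \<in> S \<Longrightarrow> y \<in> S \<Longrightarrow> h (x + y) = h x + h y" "\<And>x. x \<in> S \<Longrightarrow> h x = 0 \<longleftrightarrow> x = 0"
  shows "h (Sum_any f) = Sum_any (\<lambda>a. h (f a))" "Sum_any f \<in> S"
proof -
  have h0: "h 0 = 0" using h(2) S by blast
  have "h (Sum_any f) = Sum_any (\<lambda>a. h (f a)) \<and> Sum_any f \<in> S"
  proof (cases "finite {a. f a \<noteq> 0}")
    case True
    then show ?thesis using Sum_any_hom[of f S h] f S h h0 by blast
  next
    case False
    then have "\<not> finite {a. h (f a) \<noteq> 0}" using h(2) f by simp
    then show ?thesis using False h0 S by simp
  qed
  then show "h (Sum_any f) = Sum_any (\<lambda>a. h (f a))" "Sum_any f \<in> S" by auto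
qed

text \<open>Together with \<open>pullback_operator\<close> the structure on \<open>M\<close> for
  which \<tau> is an isomorphism onto a graded submodule.\<close>

definition pullback_grading :: "(nat \<Rightarrow> 'w set) \<Rightarrow> 'x set \<Rightarrow> ('x \<Rightarrow> 'w) \<Rightarrow> nat \<Rightarrow> 'x set" where
  "pullback_grading G M \<tau> n = {x \<in> M. \<tau> x \<in> G n}"

definition pullback_operator :: "('v \<Rightarrow> int \<Rightarrow> 'w \<Rightarrow> 'w) \<Rightarrow> 'x set \<Rightarrow> ('x \<Rightarrow> 'w) \<Rightarrow> 'v \<Rightarrow> int \<Rightarrow> 'x \<Rightarrow> 'x" where
  "pullback_operator Y M \<tau> v j = (\<lambda>x\<in>M. inv_into M \<tau> (Y v j (\<tau> x)))"

context vertex_algebra_with_automorphism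
begin

lemma graded_phi_moduleD:
  assumes "vector_space s" "graded_phi_module s G Y"
  shows "graded_operators scale mode vac g T s G Y"
proof -
  note p = assms(2)[unfolded graded_phi_module_def]
  note p1 = p[THEN conjunct2] note p2 = p1[THEN conjunct2] note p3 = p2[THEN conjunct2]
  note p4 = p3[THEN conjunct2, THEN conjunct2] note p5 = p4[THEN conjunct2] note p6 = p5[THEN conjunct2]
  show ?thesis
    by (intro graded_operators.intro graded_operators_axioms.intro vertex_algebra_with_automorphism_axioms assms(1)
        p[THEN conjunct1] p1[THEN conjunct1, rule_format] p2[THEN conjunct1, rule_format]
        p3[THEN conjunct1, rule_format] p4[THEN conjunct1, THEN spec, THEN spec, THEN spec, THEN bspec]
        p5[THEN conjunct1, rule_format] p6[THEN conjunct1, rule_format])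
qed

section \<open>Submodules\<close>

context
  fixes s :: "complex \<Rightarrow> 'w::ab_group_add \<Rightarrow> 'w" and G Y
    and s' :: "complex \<Rightarrow> 'x::ab_group_add \<Rightarrow> 'x" and M \<tau>
  assumes s: "vector_space s" and phi: "graded_phi_module s G Y" and s': "vector_space s'"
    and M: "module.subspace s' M"
    and \<tau>_add: "\<And>x y. x \<in> M \<Longrightarrow> y \<in> M \<Longrightarrow> \<tau> (x + y) = \<tau> x + \<tau> y"
    and \<tau>_scale: "\<And>c x. x \<in> M \<Longrightarrow> \<tau> (s' c x) = s c (\<tau> x)"
    and \<tau>_inj: "inj_on \<tau> M"
    and \<tau>_total: "\<tau> ` M \<subseteq> total_space G"
    and \<tau>_component: "\<And>x n. x \<in> M \<Longrightarrow> component G (\<tau> x) n \<in> \<tau> ` M"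
    and \<tau>_closed: "\<And>v j x. x \<in> M \<Longrightarrow> Y v j (\<tau> x) \<in> \<tau> ` M"
begin

interpretation P: graded_operators scale mode vac g T s G Y
  by (rule graded_phi_moduleD[OF s phi])

interpretation X: vector_space s' by (rule s')

lemma M_closed: "0 \<in> M" "x \<in> M \<Longrightarrow> y \<in> M \<Longrightarrow> x + y \<in> M" "x \<in> M \<Longrightarrow> s' c x \<in> M"
  using M X.subspace_0 X.subspace_add X.subspace_scale by blast+

lemma \<tau>_0: "\<tau> 0 = 0"
  using \<tau>_scale[OF M_closed(1), of 0] by simp

lemma \<tau>_eq_0: "x \<in> M \<Longrightarrow> \<tau> x = 0 \<longleftrightarrow> x = 0"
  using \<tau>_inj \<tau>_0 M_closed(1) by (metis inj_onD)

lemma \<tau>_eqI: "x \<in> M \<Longrightarrow> y \<in> M \<Longrightarrow> \<tau> x = \<tau> y \<Longrightarrow> x = y"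
  using \<tau>_inj by (rule inj_onD)

lemma \<tau>_Sum_any:
  assumes "\<And>a. f a \<in> M"
  shows "\<tau> (Sum_any f) = Sum_any (\<lambda>a. \<tau> (f a))" "Sum_any f \<in> M"
  by (rule Sum_any_inj_hom[of f M \<tau>]; use assms M_closed \<tau>_add \<tau>_eq_0 in blast)+

lemma \<tau>_sum:
  assumes "\<And>a. f a \<in> M"
  shows "\<tau> (\<Sum>a\<in>A. f a) = (\<Sum>a\<in>A. \<tau> (f a)) \<and> (\<Sum>a\<in>A. f a) \<in> M"
  by (induction A rule: infinite_finite_induct) (auto simp: \<tau>_0 M_closed \<tau>_add assms)

lemma pullback_operator_mem: "x \<in> M \<Longrightarrow> (pullback_operator Y M \<tau>) v j x \<in> M"
  and \<tau>_pullback_operator: "x \<in> M \<Longrightarrow> \<tau> ((pullback_operator Y M \<tau>) v j x) = Y v j (\<tau> x)"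
  using \<tau>_closed by (simp_all add: pullback_operator_def inv_into_into f_inv_into_f)

lemma total_pullback: "total_space (pullback_grading G M \<tau>) = M" and graded_pullback: "graded_space s' (pullback_grading G M \<tau>)"
proof -
  have sub: "X.subspace ((pullback_grading G M \<tau>) n)" for n
    using M_closed P.W.subspace_0 P.W.subspace_add P.W.subspace_scale graded_subspace[OF s P.graded, of n]
    by (intro X.subspaceI) (auto simp: pullback_grading_def \<tau>_0 \<tau>_add \<tau>_scale)
  have mem: "f n \<in> M" if "finite_family (pullback_grading G M \<tau>) f" for f n
    using that by (auto simp: finite_family_def pullback_grading_def)
  show "graded_space s' (pullback_grading G M \<tau>)"
    unfolding graded_space_def
  proof (intro conjI allI impI sub)
    fix f n assume f: "finite_family (pullback_grading G M \<tau>) f \<and> Sum_any f = 0"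
    have "finite_family G (\<lambda>n. \<tau> (f n))"
      using f mem \<tau>_eq_0 by (auto simp: finite_family_def pullback_grading_def)
    moreover have "Sum_any (\<lambda>n. \<tau> (f n)) = 0"
      using \<tau>_Sum_any(1)[of f] mem f \<tau>_0 by simp
    ultimately have "\<tau> (f n) = 0" using P.graded by (auto simp: graded_space_def)
    then show "f n = 0" using \<tau>_eq_0 mem f by blast
  qed
  show "total_space (pullback_grading G M \<tau>) = M"
  proof (intro equalityI subsetI)
    fix x assume "x \<in> total_space (pullback_grading G M \<tau>)"
    then obtain f where "finite_family (pullback_grading G M \<tau>) f" "x = Sum_any f" by (auto simp: total_space_def)
    then show "x \<in> M" using \<tau>_Sum_any(2)[of f] mem by simp
  next
    fix x assume x: "x \<in> M"
    then have tx: "\<tau> x \<in> total_space G" using \<tau>_total by blast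
    define f where "f = (\<lambda>n. inv_into M \<tau> (component G (\<tau> x) n))"
    have f: "f n \<in> M" "\<tau> (f n) = component G (\<tau> x) n" for n
      using \<tau>_component[OF x] by (simp_all add: f_def inv_into_into f_inv_into_f)
    have "finite {n. f n \<noteq> 0}"
      using finite_component[OF s P.graded tx] \<tau>_eq_0[OF f(1)] by (simp add: f(2))
    then have fam: "finite_family (pullback_grading G M \<tau>) f"
      using f component_mem[OF s P.graded tx] by (simp add: finite_family_def pullback_grading_def)
    have "\<tau> (Sum_any f) = \<tau> x"
      using \<tau>_Sum_any(1)[of f] f component(2)[OF s P.graded tx] by simp
    then have "Sum_any f = x" using x \<tau>_eqI \<tau>_Sum_any(2)[of f] f by blast
    then show "x \<in> total_space (pullback_grading G M \<tau>)" using fam unfolding total_space_def by blast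
  qed
qed

text \<open>\<tau> carries every identity to the given module, where it holds, and injectivity
  brings it back; the exponent \<open>k\<close> stays the same.\<close>

lemma graded_phi_module_pullback: "graded_phi_module s' (pullback_grading G M \<tau>) (pullback_operator Y M \<tau>)"
proof -
  have \<tau>Y: "\<tau> x \<in> total_space G" if "x \<in> M" for x using \<tau>_total that by blast
  have \<tau>c: "\<tau> (coeff (pullback_operator Y M \<tau>) v a x) = coeff Y v a (\<tau> x)"
    and cM: "coeff (pullback_operator Y M \<tau>) v a x \<in> M" if "x \<in> M" for v a x
    using that by (simp_all add: coeff_def \<tau>_pullback_operator pullback_operator_mem)
  interpret Q: graded_operators scale mode vac g T s' "pullback_grading G M \<tau>" "pullback_operator Y M \<tau>"
  proof (unfold_locales, goal_cases)
    case 1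
    then show ?case by (rule graded_pullback)
  next
    case (2 v j)
    show ?case
      unfolding linear_maps_def total_pullback mem_Collect_eq
    proof (intro conjI ballI allI)
      show "(pullback_operator Y M \<tau>) v j \<in> M \<rightarrow>\<^sub>E M"
        using pullback_operator_mem by (auto simp: PiE_def extensional_def pullback_operator_def)
      fix x assume x: "x \<in> M"
      show "(pullback_operator Y M \<tau>) v j (x + y) = (pullback_operator Y M \<tau>) v j x + (pullback_operator Y M \<tau>) v j y" if y: "y \<in> M" for y
        using x y P.coeff_add[of "\<tau> x" "\<tau> y" v "- j - int T"] \<tau>Y
        by (intro \<tau>_eqI) (simp_all add: M_closed pullback_operator_mem \<tau>_pullback_operator \<tau>_add coeff_def)
      show "(pullback_operator Y M \<tau>) v j (s' c x) = s' c ((pullback_operator Y M \<tau>) v j x)" for c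
        using x P.coeff_scale[of "\<tau> x" v "- j - int T" c] \<tau>Y
        by (intro \<tau>_eqI) (simp_all add: M_closed pullback_operator_mem \<tau>_pullback_operator \<tau>_scale coeff_def)
    qed
  next
    case (3 x u v j)
    then have x: "x \<in> M" by (simp add: total_pullback)
    then show ?case using \<tau>Y
      by (intro \<tau>_eqI) (simp_all add: M_closed pullback_operator_mem \<tau>_pullback_operator \<tau>_add P.Y_add_left)
  next
    case (4 x c v j)
    then have x: "x \<in> M" by (simp add: total_pullback)
    then show ?case using \<tau>Y
      by (intro \<tau>_eqI) (simp_all add: M_closed pullback_operator_mem \<tau>_pullback_operator \<tau>_scale P.Y_scale_left)
  next
    case (5 x n j v)
    then have x: "x \<in> M" "\<tau> x \<in> G n" by (auto simp: pullback_grading_def)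
    then show ?case
      using P.Y_degree[OF x(2), of j v] \<tau>_eq_0[OF pullback_operator_mem[OF x(1)], of v j]
      by (auto simp: pullback_grading_def pullback_operator_mem \<tau>_pullback_operator)
  next
    case (6 x a)
    then have x: "x \<in> M" by (simp add: total_pullback)
    then show ?case
      using P.vac_coeff[OF \<tau>Y[OF x], of a] \<tau>c[OF x, of vac a]
      by (intro \<tau>_eqI) (auto simp: M_closed cM \<tau>_0)
  next
    case (7 x v a)
    then have x: "x \<in> M" by (simp add: total_pullback)
    then show ?case
      by (intro \<tau>_eqI) (simp_all add: M_closed cM \<tau>c \<tau>_scale P.g_coeff[OF \<tau>Y[OF x]])
  qed
  have \<tau>p: "\<tau> (product_coeff s' (pullback_operator Y M \<tau>) k u v a b x) = product_coeff s Y k u v a b (\<tau> x)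
      \<and> product_coeff s' (pullback_operator Y M \<tau>) k u v a b x \<in> M" if x: "x \<in> M" for k u v a b x
    unfolding product_coeff_def
    using \<tau>_sum[of "\<lambda>i. s' ((- 1) ^ i * of_nat (k choose i)) (coeff (pullback_operator Y M \<tau>) u (a - int T * int (k - i))
       (coeff (pullback_operator Y M \<tau>) v (b - int T * int i) x))" "{..k}"] x
    by (simp add: M_closed cM \<tau>_scale \<tau>c)
  show ?thesis
    unfolding Q.graded_phi_module_iff total_pullback
  proof (intro allI)
    fix u v
    obtain k where k: "\<And>w. w \<in> total_space G \<Longrightarrow> P.truncated k u v w \<and> P.phi_identity k u v w"
      using phi unfolding P.graded_phi_module_iff by blast
    have "Q.truncated k u v x \<and> Q.phi_identity k u v x" if x: "x \<in> M" for x
    proof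
      show "Q.truncated k u v x"
        using k[OF \<tau>Y[OF x]] \<tau>p[OF x] \<tau>_eq_0 unfolding P.truncated_def Q.truncated_def by metis
      show "Q.phi_identity k u v x"
        unfolding Q.phi_identity_def
      proof (intro allI)
        fix c d :: int
        let ?l = "\<lambda>i::nat. s' (fps_nth ((fps_exp 1 - 1) ^ k) i)
           (coeff (pullback_operator Y M \<tau>) (mode u (int i - d - 1) v) (c - int T * int k) x)"
        let ?r = "\<lambda>a::int. s' (if d < 0 then 0 else (of_int a / of_nat T) ^ nat d / fact (nat d))
           (product_coeff s' (pullback_operator Y M \<tau>) k u v a (c - a) x)"
        have l: "?l i \<in> M" and r: "?r a \<in> M" for i a using x \<tau>p by (auto simp: M_closed cM)
        have "\<tau> (Sum_any ?l) = \<tau> (Sum_any ?r)"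
          unfolding \<tau>_Sum_any(1)[of ?l, OF l] \<tau>_Sum_any(1)[of ?r, OF r]
          using k[OF \<tau>Y[OF x]] x \<tau>p unfolding P.phi_identity_def
          by (simp add: \<tau>_scale \<tau>c cM)
        then show "Sum_any ?l = Sum_any ?r"
          using \<tau>_eqI \<tau>_Sum_any(2)[of ?l, OF l] \<tau>_Sum_any(2)[of ?r, OF r] by blast
      qed
    qed
    then show "\<exists>k. \<forall>w\<in>M. Q.truncated k u v w \<and> Q.phi_identity k u v w" by blast
  qed
qed

end

end

section \<open>The kernel ideal acts by zero\<close>

abbreviation free_scale :: "complex \<Rightarrow> ('a \<Rightarrow>\<^sub>0 complex) \<Rightarrow> ('a \<Rightarrow>\<^sub>0 complex)" where
  "free_scale \<equiv> \<lambda>c. Poly_Mapping.map ((*) c)"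

lemma lookup_free_scale [simp]: "Poly_Mapping.lookup (free_scale c x) k = c * Poly_Mapping.lookup x k"
  by (simp add: Poly_Mapping.map.rep_eq when_def)

lemma vector_space_free: "vector_space free_scale"
  by standard (auto intro!: poly_mapping_eqI simp: lookup_add algebra_simps)

lemma theta_hom_aux:
  assumes "vector_space s" "graded_space s G" "w \<in> G m" "\<And>v j. Y v j 0 = 0"
  shows "Sum_any (\<lambda>n. Sum_any (\<lambda>k. Y (a k n) (int n - int k - T) (component G w n))) =
     Sum_any (\<lambda>k. Y (a k m) (int m - int k - T) w)"
proof -
  have "Sum_any (\<lambda>n. Sum_any (\<lambda>k. Y (a k n) (int n - int k - T) (component G w n))) =
    Sum_any (\<lambda>n. if n = m then Sum_any (\<lambda>k. Y (a k m) (int m - int k - T) w) else 0)"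
    using assms by (intro Sum_any.cong) (simp add: component_single[OF assms(1,2,3)])
  then show ?thesis by simp
qed

context graded_operators
begin

lemma Y_0: "Y v j 0 = 0" "w \<in> total_space G \<Longrightarrow> Y 0 j w = 0"
  using coeff_0[of v "- j - int T"] coeff_0_left[of w "- j - int T"] by (simp_all add: coeff_def)

lemma Y_coeff: "Y v (int m - int k - int T) = coeff Y v (int k - int m)"
  by (simp add: coeff_def algebra_simps)

lemma theta_hom: "w \<in> G m \<Longrightarrow> theta G Y a w = Sum_any (\<lambda>k. coeff Y (a k m) (int k - int m) w)"
  unfolding theta_def Y_coeff[symmetric]
  using theta_hom_aux[where Y = Y, OF W graded _ Y_0(1)] total_mem by simp

definition word :: "'w \<Rightarrow> ('v \<times> int) list \<Rightarrow> 'w" where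
  "word w ws = foldr (\<lambda>(v, j). Y v j) ws w"

lemma Y_closed: "w \<in> total_space G \<Longrightarrow> Y v j w \<in> total_space G"
  using coeff_closed[of w v "- j - int T"] by (simp add: coeff_def)

lemma Y_add: "x \<in> total_space G \<Longrightarrow> y \<in> total_space G \<Longrightarrow> Y v j (x + y) = Y v j x + Y v j y"
  using coeff_add[of x y v "- j - int T"] by (simp add: coeff_def)

lemma Y_scale: "x \<in> total_space G \<Longrightarrow> Y v j (s c x) = s c (Y v j x)"
  using coeff_scale[of x v "- j - int T" c] by (simp add: coeff_def)

lemma word_homogeneous:
  assumes "w \<in> G m"
  shows "\<exists>n. word w ws \<in> G n"
proof (induction ws)
  case Nil
  then show ?case using assms by (auto simp: word_def)
next
  case (Cons x ws)
  obtain v j where x: "x = (v, j)" by (cases x)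
  obtain n where "word w ws \<in> G n" using Cons by blast
  from Y_degree[OF this, of j v]
  show ?case using W.subspace_0[OF graded_subspace[OF W graded, of 0]]
    by (auto simp: word_def x split: if_splits)
qed

text \<open>The kernel ranges over modules on one type, so the submodule generated by
  \<open>w\<close> has to be rebuilt there. The free space on words maps onto it, and choosing a
  basis among the words replaces the quotient by the kernel of this map.\<close>

theorem kernel_ideal_acts_by_0:
  assumes phi: "graded_phi_module s G Y" and a: "a \<in> kernel_ideal" and w: "w \<in> G m"
  shows "theta G Y a w = 0"
proof -
  let ?f = "free_scale :: complex \<Rightarrow> (('v \<times> int) list \<Rightarrow>\<^sub>0 complex) \<Rightarrow> _"
  interpret F: vector_space ?f by (rule vector_space_free)
  interpret P: vector_space_pair ?f s ..
  define S where "S = W.span (range (word w))"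
  have word: "word w ws \<in> total_space G" for ws using word_homogeneous[OF w] total_mem by blast
  have S_total: "S \<subseteq> total_space G"
    unfolding S_def using word by (intro W.span_minimal subspace_total) auto
  have S_component: "component G x n \<in> S" if "x \<in> S" for x n
  proof -
    have "S \<subseteq> {x \<in> total_space G. \<forall>n. component G x n \<in> S}"
      unfolding S_def
    proof (rule W.span_minimal)
      show "range (word w) \<subseteq> {x \<in> total_space G. \<forall>n. component G x n \<in> W.span (range (word w))}"
      proof safe
        fix ws n
        show "word w ws \<in> total_space G" by (rule word)
        obtain k where "word w ws \<in> G k" using word_homogeneous[OF w] by blast
        from component_single[OF W graded this]
        show "component G (word w ws) n \<in> W.span (range (word w))"
          by (simp add: W.span_base W.span_zero)
      qed
      show "W.subspace {x \<in> total_space G. \<forall>n. component G x n \<in> W.span (range (word w))}"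
        using W.subspace_add[OF subspace_total] W.subspace_scale[OF subspace_total]
          component_single[OF W graded W.subspace_0[OF graded_subspace[OF W graded]], of 0]
        by (intro W.subspaceI)
           (auto simp: component_add[OF W graded] component_scale[OF W graded] W.span_zero W.span_add W.span_scale)
    qed
    then show ?thesis using that by blast
  qed
  have S_closed: "Y v j x \<in> S" if "x \<in> S" for v j x
  proof -
    have "S \<subseteq> {x \<in> total_space G. Y v j x \<in> S}"
      unfolding S_def
    proof (rule W.span_minimal)
      show "range (word w) \<subseteq> {x \<in> total_space G. Y v j x \<in> W.span (range (word w))}"
      proof safe
        fix ws
        show "word w ws \<in> total_space G" by (rule word)
        have "Y v j (word w ws) = word w ((v, j) # ws)" by (simp add: word_def)
        then show "Y v j (word w ws) \<in> W.span (range (word w))" by (simp add: W.span_base)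
      qed
      show "W.subspace {x \<in> total_space G. Y v j x \<in> W.span (range (word w))}"
        using W.subspace_add[OF subspace_total] W.subspace_scale[OF subspace_total]
        by (intro W.subspaceI) (auto simp: Y_0 Y_add Y_scale W.span_zero W.span_add W.span_scale)
    qed
    then show ?thesis using that by blast
  qed
  define \<tau> where "\<tau> = (\<lambda>x :: ('v \<times> int) list \<Rightarrow>\<^sub>0 complex. Sum_any (\<lambda>ws. s (Poly_Mapping.lookup x ws) (word w ws)))"
  have fin: "finite {ws. s (Poly_Mapping.lookup x ws) (word w ws) \<noteq> 0}" for x
    by (rule finite_subset[of _ "Poly_Mapping.keys x"]) (auto simp: in_keys_iff)
  have lin: "Vector_Spaces.linear ?f s \<tau>"
  proof (unfold_locales)
    fix x y c
    show "\<tau> (x + y) = \<tau> x + \<tau> y"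
      by (simp add: \<tau>_def lookup_add W.scale_left_distrib Sum_any.distrib[OF fin fin])
    show "\<tau> (?f c x) = s c (\<tau> x)"
      using Sum_any_hom(1)[OF fin, of x UNIV "s c"] by (simp add: \<tau>_def W.scale_right_distrib)
  qed
  have \<tau>_single: "\<tau> (Poly_Mapping.single ws 1) = word w ws" for ws
  proof -
    have "\<tau> (Poly_Mapping.single ws 1) = Sum_any (\<lambda>ws'. if ws' = ws then word w ws' else 0)"
      unfolding \<tau>_def by (intro Sum_any.cong) (auto simp: lookup_single when_def)
    then show ?thesis by simp
  qed
  \<comment> \<open>A basis of the submodule that consists of words. On the span of one chosen word
    for each element of \<open>B\<close>, the map \<tau> is a bijection onto
    \<open>S\<close>.\<close>
  obtain B where B: "B \<subseteq> range (word w)" "W.independent B" "range (word w) \<subseteq> W.span B"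
    using W.maximal_independent_subset[of "range (word w)"] by blast
  have span_B: "W.span B = S"
    unfolding S_def using W.span_mono[OF B(1)] W.span_minimal[OF B(3) W.subspace_span] by blast
  define C where "C = (\<lambda>b. Poly_Mapping.single (inv_into UNIV (word w) b) (1 :: complex)) ` B"
  have \<tau>_inv: "\<tau> (Poly_Mapping.single (inv_into UNIV (word w) b) 1) = b" if "b \<in> B" for b
    using B(1) that by (simp add: \<tau>_single f_inv_into_f subset_iff)
  have \<tau>C: "\<tau> ` C = B" unfolding C_def image_image using \<tau>_inv by simp
  have "inj_on \<tau> C"
  proof (rule inj_onI)
    fix x y assume "x \<in> C" "y \<in> C" and eq: "\<tau> x = \<tau> y"
    then obtain b b' where "b \<in> B" "x = Poly_Mapping.single (inv_into UNIV (word w) b) 1"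
      "b' \<in> B" "y = Poly_Mapping.single (inv_into UNIV (word w) b') 1" by (auto simp: C_def)
    then show "x = y" using \<tau>_inv eq by metis
  qed
  then have inj: "inj_on \<tau> (F.span C)"
    using B(2) by (intro P.linear_inj_on_span_independent_image[OF lin]) (simp_all add: \<tau>C)
  have image: "\<tau> ` F.span C = S"
    using P.linear_span_image[OF lin, of C] span_B \<tau>C by simp
  have add: "\<tau> (x + y) = \<tau> x + \<tau> y" if "x \<in> F.span C" "y \<in> F.span C" for x y
    by (rule P.linear_add[OF lin])
  have scale: "\<tau> (?f c x) = s c (\<tau> x)" if "x \<in> F.span C" for x c
    by (rule P.linear_scale[OF lin])
  have "w = word w []" by (simp add: word_def)
  then have "w \<in> S" unfolding S_def using W.span_base by (metis rangeI)
  then obtain x where x: "x \<in> F.span C" "\<tau> x = w" using image by blast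
  have comp: "component G (\<tau> y) n \<in> \<tau> ` F.span C" "Y v j (\<tau> y) \<in> \<tau> ` F.span C" if "y \<in> F.span C" for y n v j
    using that S_component S_closed image by auto
  have sub: "\<tau> ` F.span C \<subseteq> total_space G" using S_total image by simp
  define G' where "G' = pullback_grading G (F.span C) \<tau>"
  define Y' where "Y' = pullback_operator Y (F.span C) \<tau>"
  note ctxt = W phi vector_space_free F.subspace_span add scale inj sub comp
  have phi': "graded_phi_module ?f G' Y'"
    unfolding G'_def Y'_def by (rule graded_phi_module_pullback[OF ctxt])
  have tot: "total_space G' = F.span C"
    unfolding G'_def by (rule total_pullback[OF ctxt])
  have \<tau>Y': "\<tau> (Y' v j y) = Y v j (\<tau> y)" if "y \<in> F.span C" for v j y
    unfolding Y'_def by (rule \<tau>_pullback_operator[OF ctxt that])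
  have Y'M: "Y' v j y \<in> F.span C" if "y \<in> F.span C" for v j y
    unfolding Y'_def by (rule pullback_operator_mem[OF ctxt that])
  have xm: "x \<in> G' m" using x w by (simp add: G'_def pullback_grading_def)
  interpret Q: graded_operators scale mode vac g T ?f G' Y'
    by (rule graded_phi_moduleD[OF vector_space_free phi'])
  have "theta G' Y' a x = 0"
    using a phi' x(1) tot unfolding kernel_ideal_def by blast
  then have "\<tau> (Sum_any (\<lambda>k. coeff Y' (a k m) (int k - int m) x)) = 0"
    unfolding Q.theta_hom[OF xm] using P.linear_0[OF lin] by simp
  moreover have "\<tau> (Sum_any (\<lambda>k. coeff Y' (a k m) (int k - int m) x)) = Sum_any (\<lambda>k. \<tau> (coeff Y' (a k m) (int k - int m) x))"
  proof (rule Sum_any_inj_hom(1))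
    show "coeff Y' (a k m) (int k - int m) x \<in> F.span C" for k
      unfolding coeff_def by (rule Y'M[OF x(1)])
    show "(0 :: ('v \<times> int) list \<Rightarrow>\<^sub>0 complex) \<in> F.span C" by (rule F.span_zero)
    show "y + z \<in> F.span C" if "y \<in> F.span C" "z \<in> F.span C" for y z
      using that by (rule F.span_add)
    show "\<tau> (y + z) = \<tau> y + \<tau> z" if "y \<in> F.span C" "z \<in> F.span C" for y z
      using that by (rule add)
    show "\<tau> y = 0 \<longleftrightarrow> y = 0" if "y \<in> F.span C" for y
      using inj_onD[OF inj _ that F.span_zero] P.linear_0[OF lin] by metis
  qed
  ultimately show ?thesis
    using x \<tau>Y' by (simp add: theta_hom[OF w] coeff_def)
qed

end

section \<open>The action of matrices\<close>

context vertex_algebra_with_automorphism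
begin

lemma carrier_matrix: "a \<in> carrier matrix_algebra \<longleftrightarrow> (\<forall>l. finite {k. a k l \<noteq> 0})"
  by (simp add: matrix_algebra_def)

lemma matrix_ops:
  "a \<oplus>\<^bsub>matrix_algebra\<^esub> b = (\<lambda>k l. a k l + b k l)"
  "a \<otimes>\<^bsub>matrix_algebra\<^esub> b = (\<lambda>k l. Sum_any (\<lambda>n. bullet l n k (a k n) (b n l)))"
  "\<one>\<^bsub>matrix_algebra\<^esub> = (\<lambda>k l. if k = l then vac else 0)"
  "csmult matrix_algebra c a = (\<lambda>k l. c *v a k l)"
  by (simp_all add: matrix_algebra_def)

lemma matrix_add_closed:
  assumes "a \<in> carrier matrix_algebra" "b \<in> carrier matrix_algebra"
  shows "(\<lambda>k l. a k l + b k l) \<in> carrier matrix_algebra"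
  unfolding carrier_matrix
proof
  fix l
  have "finite ({k. a k l \<noteq> 0} \<union> {k. b k l \<noteq> 0})" using assms by (simp add: carrier_matrix)
  then show "finite {k. a k l + b k l \<noteq> 0}" by (rule rev_finite_subset) auto
qed

lemma matrix_scale_closed:
  assumes "a \<in> carrier matrix_algebra"
  shows "(\<lambda>k l. c *v a k l) \<in> carrier matrix_algebra"
  unfolding carrier_matrix
proof
  fix l
  have "finite {k. a k l \<noteq> 0}" using assms by (simp add: carrier_matrix)
  then show "finite {k. c *v a k l \<noteq> 0}" by (rule rev_finite_subset) auto
qed

lemma elementary_closed: "elementary k l v \<in> carrier matrix_algebra"
  unfolding carrier_matrix elementary_def by (auto intro: finite_subset[of _ "{k}"])

lemma zero_closed: "(\<lambda>_ _. 0) \<in> carrier matrix_algebra"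
  by (simp add: carrier_matrix)

lemma one_closed: "\<one>\<^bsub>matrix_algebra\<^esub> \<in> carrier matrix_algebra"
  unfolding carrier_matrix matrix_ops
proof
  fix l
  show "finite {k. (if k = l then vac else 0) \<noteq> 0}" by (rule finite_subset[of _ "{l}"]) auto
qed

text \<open>A column of \<open>b\<close> has finitely many nonzero entries, and these select
  finitely many columns of \<open>a\<close>, each of them finite.\<close>

lemma matrix_mult_column:
  assumes "a \<in> carrier matrix_algebra" "b \<in> carrier matrix_algebra"
  shows "(a \<otimes>\<^bsub>matrix_algebra\<^esub> b) k l = (\<Sum>n | b n l \<noteq> 0. bullet l n k (a k n) (b n l))"
    and "finite (\<Union>n\<in>{n. b n l \<noteq> 0}. {k. a k n \<noteq> 0})"
    and "(a \<otimes>\<^bsub>matrix_algebra\<^esub> b) k l \<noteq> 0 \<Longrightarrow> k \<in> (\<Union>n\<in>{n. b n l \<noteq> 0}. {k. a k n \<noteq> 0})"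
proof -
  have fin: "finite {n. b n l \<noteq> 0}" using assms by (simp add: carrier_matrix)
  show *: "(a \<otimes>\<^bsub>matrix_algebra\<^esub> b) k l = (\<Sum>n | b n l \<noteq> 0. bullet l n k (a k n) (b n l))"
    unfolding matrix_ops by (rule Sum_any.expand_superset[OF fin]) auto
  show "finite (\<Union>n\<in>{n. b n l \<noteq> 0}. {k. a k n \<noteq> 0})"
    using fin assms by (simp add: carrier_matrix)
  show "k \<in> (\<Union>n\<in>{n. b n l \<noteq> 0}. {k. a k n \<noteq> 0})" if "(a \<otimes>\<^bsub>matrix_algebra\<^esub> b) k l \<noteq> 0"
  proof (rule ccontr)
    assume "k \<notin> (\<Union>n\<in>{n. b n l \<noteq> 0}. {k. a k n \<noteq> 0})"
    then have "(\<Sum>n | b n l \<noteq> 0. bullet l n k (a k n) (b n l)) = 0" by (intro sum.neutral) auto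
    then show False using that * by simp
  qed
qed

lemma matrix_mult_closed:
  assumes "a \<in> carrier matrix_algebra" "b \<in> carrier matrix_algebra"
  shows "a \<otimes>\<^bsub>matrix_algebra\<^esub> b \<in> carrier matrix_algebra"
  unfolding carrier_matrix
proof
  fix l
  show "finite {k. (a \<otimes>\<^bsub>matrix_algebra\<^esub> b) k l \<noteq> 0}"
    by (rule finite_subset[OF _ matrix_mult_column(2)[OF assms, of l]]) (use matrix_mult_column(3)[OF assms] in blast)
qed

lemma elementary_mult:
  "elementary k n u \<otimes>\<^bsub>matrix_algebra\<^esub> elementary n l v = elementary k l (bullet l n k u v)"
proof (intro ext)
  fix i j
  have "(elementary k n u \<otimes>\<^bsub>matrix_algebra\<^esub> elementary n l v) i j =
    Sum_any (\<lambda>p. if p = n then bullet j n i (elementary k n u i n) (elementary n l v n j) else 0)"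
    unfolding matrix_ops by (intro Sum_any.cong) (auto simp: elementary_def)
  also have "\<dots> = elementary k l (bullet l n k u v) i j"
    by (simp add: elementary_def)
  finally show "(elementary k n u \<otimes>\<^bsub>matrix_algebra\<^esub> elementary n l v) i j = elementary k l (bullet l n k u v) i j" .
qed

lemma elementary_add: "elementary k l (u + v) = (\<lambda>i j. elementary k l u i j + elementary k l v i j)"
  and elementary_scale: "elementary k l (c *v v) = (\<lambda>i j. c *v elementary k l v i j)"
  and elementary_0: "elementary k l 0 = (\<lambda>_ _. 0)"
  by (simp_all add: elementary_def fun_eq_iff)

end

section \<open>Linearity and multiplicativity of the action\<close>

context graded_operators
begin

lemma component_in: "w \<in> total_space G \<Longrightarrow> component G w n \<in> G n"
  by (rule component_mem[OF W graded])

lemma theta_decompose: "w \<in> total_space G \<Longrightarrow> theta G Y a w = Sum_any (\<lambda>n. theta G Y a (component G w n))"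
  using theta_hom[OF component_in, of w a]
  by (simp add: theta_def Y_coeff)

lemma finite_theta:
  assumes "a \<in> carrier matrix_algebra" "w \<in> total_space G"
  shows "finite {k. coeff Y (a k m) (int k - int m) w \<noteq> 0}"
proof -
  have "finite {k. a k m \<noteq> 0}" using assms by (simp add: carrier_matrix)
  then show ?thesis by (rule rev_finite_subset) (use assms in auto)
qed

lemma theta_elementary:
  "w \<in> total_space G \<Longrightarrow> theta G Y (elementary k l v) w = coeff Y v (int k - int l) (component G w l)"
proof -
  assume w: "w \<in> total_space G"
  have c: "component G w n \<in> total_space G" for n using component_in[OF w] total_mem by blast
  have "theta G Y (elementary k l v) w =
    Sum_any (\<lambda>n. Sum_any (\<lambda>i. coeff Y (elementary k l v i n) (int i - int n) (component G w n)))"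
    using w by (simp add: theta_def Y_coeff)
  also have "\<dots> = Sum_any (\<lambda>n. if n = l then Sum_any (\<lambda>i. if i = k then coeff Y v (int k - int l) (component G w l) else 0) else 0)"
  proof (rule Sum_any.cong)
    fix n
    show "Sum_any (\<lambda>i. coeff Y (elementary k l v i n) (int i - int n) (component G w n)) =
      (if n = l then Sum_any (\<lambda>i. if i = k then coeff Y v (int k - int l) (component G w l) else 0) else 0)"
    proof (cases "n = l")
      case True
      show ?thesis
        unfolding True using c by (simp only: simp_thms if_True, intro Sum_any.cong) (auto simp: elementary_def)
    qed (use c in \<open>simp add: elementary_def\<close>)
  qed
  finally show ?thesis by simp
qed

lemma theta_0_right: "theta G Y a 0 = 0"
  using theta_hom[OF W.subspace_0[OF graded_subspace[OF W graded]], of a 0] by simp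

lemma theta_add_hom:
  assumes "a \<in> carrier matrix_algebra" "x \<in> G m" "y \<in> G m"
  shows "theta G Y a (x + y) = theta G Y a x + theta G Y a y"
proof -
  have "x + y \<in> G m" using assms W.subspace_add[OF graded_subspace[OF W graded]] by blast
  then show ?thesis
    using assms total_mem[of x m] total_mem[of y m]
    by (simp add: theta_hom coeff_add Sum_any.distrib[OF finite_theta finite_theta])
qed

lemma finite_theta_component:
  assumes "w \<in> total_space G"
  shows "finite {n. theta G Y a (component G w n) \<noteq> 0}"
  by (rule finite_subset[OF _ finite_component[OF W graded assms]]) (auto simp: theta_0_right)

lemma theta_add_right:
  assumes a: "a \<in> carrier matrix_algebra" and x: "x \<in> total_space G" and y: "y \<in> total_space G"
  shows "theta G Y a (x + y) = theta G Y a x + theta G Y a y"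
proof -
  have "theta G Y a (x + y) = Sum_any (\<lambda>n. theta G Y a (component G x n) + theta G Y a (component G y n))"
    using theta_decompose[OF W.subspace_add[OF subspace_total x y], of a]
      theta_add_hom[OF a component_in[OF x] component_in[OF y]]
    by (simp add: component_add[OF W graded x y])
  also have "\<dots> = theta G Y a x + theta G Y a y"
    using Sum_any.distrib[OF finite_theta_component[OF x] finite_theta_component[OF y], of a a]
    by (simp add: theta_decompose[symmetric] x y)
  finally show ?thesis .
qed

lemma theta_closed:
  assumes "w \<in> total_space G"
  shows "theta G Y a w \<in> total_space G"
proof -
  have fin: "Sum_any f \<in> total_space G" if "\<And>n. f n \<in> total_space G" for f :: "nat \<Rightarrow> 'w"
    unfolding Sum_any.expand_set using that by (intro W.subspace_sum[OF subspace_total])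
  have "theta G Y a (component G w n) \<in> total_space G" for n
    unfolding theta_hom[OF component_in[OF assms]]
    by (intro fin coeff_closed total_mem[OF component_in[OF assms]])
  then show ?thesis unfolding theta_decompose[OF assms] by (rule fin)
qed

lemma theta_scale_right:
  assumes a: "a \<in> carrier matrix_algebra" and w: "w \<in> total_space G"
  shows "theta G Y a (s c w) = s c (theta G Y a w)"
  using W graded w
proof (induction w rule: total_space_induct)
  case (hom n w)
  then have sw: "s c w \<in> G n" and w: "w \<in> total_space G"
    using W.subspace_scale[OF graded_subspace[OF W graded]] total_mem by blast+
  show ?case
    unfolding theta_hom[OF sw] theta_hom[OF hom] using Sum_any_hom(1)[where S = UNIV and h = "s c", OF finite_theta[OF a w]]
    by (simp add: coeff_scale[OF w] W.scale_right_distrib)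
next
  case (add x y)
  then show ?case
    using W.subspace_scale[OF subspace_total]
    by (simp add: W.scale_right_distrib theta_add_right[OF a])
qed

lemma theta_linear:
  assumes a: "a \<in> carrier matrix_algebra"
  shows "theta G Y a \<in> linear_maps s (total_space G) (total_space G)"
  unfolding linear_maps_def
  by (auto simp: theta_closed theta_add_right[OF a] theta_scale_right[OF a]) (simp add: theta_def)

lemma theta_add_left:
  assumes a: "a \<in> carrier matrix_algebra" and b: "b \<in> carrier matrix_algebra" and w: "w \<in> total_space G"
  shows "theta G Y (\<lambda>k l. a k l + b k l) w = theta G Y a w + theta G Y b w"
  using W graded w
proof (induction w rule: total_space_induct)
  case (hom n w)
  have w: "w \<in> total_space G" using total_mem[OF hom] .
  show ?case
    unfolding theta_hom[OF hom]
    by (simp add: coeff_add_left[OF w] Sum_any.distrib[OF finite_theta[OF a w] finite_theta[OF b w]])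
next
  case (add x y)
  then show ?case by (simp add: theta_add_right a b matrix_add_closed)
qed

lemma theta_scale_left:
  assumes a: "a \<in> carrier matrix_algebra" and w: "w \<in> total_space G"
  shows "theta G Y (\<lambda>k l. c *v a k l) w = s c (theta G Y a w)"
  using W graded w
proof (induction w rule: total_space_induct)
  case (hom n w)
  have w: "w \<in> total_space G" using total_mem[OF hom] .
  show ?case
    unfolding theta_hom[OF hom] using Sum_any_hom(1)[where S = UNIV and h = "s c", OF finite_theta[OF a w]]
    by (simp add: coeff_scale_left[OF w] W.scale_right_distrib)
next
  case (add x y)
  then show ?case by (simp add: theta_add_right a matrix_scale_closed W.scale_right_distrib)
qed

lemma theta_sum:
  assumes a: "a \<in> carrier matrix_algebra" and "\<And>n. n \<in> N \<Longrightarrow> f n \<in> total_space G" "finite N"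
  shows "theta G Y a (\<Sum>n\<in>N. f n) = (\<Sum>n\<in>N. theta G Y a (f n))"
  using assms(3,2)
  by (induction N rule: finite_induct)
     (simp_all add: theta_0_right theta_add_right[OF a] W.subspace_sum[OF subspace_total])

text \<open>On a vector of degree l/T only column l of \<open>b\<close> acts, so all sums are finite
  and the product formula applies to each summand.\<close>

lemma theta_mult:
  assumes pf: product_formula and a: "a \<in> carrier matrix_algebra" and b: "b \<in> carrier matrix_algebra"
    and w: "w \<in> total_space G"
  shows "theta G Y (a \<otimes>\<^bsub>matrix_algebra\<^esub> b) w = theta G Y a (theta G Y b w)"
  using W graded w
proof (induction w rule: total_space_induct)
  case (hom l w)
  have w: "w \<in> total_space G" using total_mem[OF hom] .
  define N where "N = {n. b n l \<noteq> 0}"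
  define K where "K = (\<Union>n\<in>N. {k. a k n \<noteq> 0})"
  have N: "finite N" using b by (simp add: N_def carrier_matrix)
  have K: "finite K" using matrix_mult_column(2)[OF a b, of l] by (simp add: K_def N_def)
  let ?x = "\<lambda>n. coeff Y (b n l) (int n - int l) w"
  have x: "?x n \<in> G n" for n using coeff_degree[OF hom, of "int n - int l" "b n l"] by simp
  have "theta G Y b w = (\<Sum>n\<in>N. ?x n)"
    unfolding theta_hom[OF hom] by (rule Sum_any.expand_superset[OF N]) (use w in \<open>auto simp: N_def\<close>)
  then have "theta G Y a (theta G Y b w) = (\<Sum>n\<in>N. theta G Y a (?x n))"
    using theta_sum[OF a total_mem[OF x] N] by simp
  also have "\<dots> = (\<Sum>n\<in>N. \<Sum>k\<in>K. coeff Y (a k n) (int k - int n) (?x n))"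
  proof (intro sum.cong refl)
    fix n assume "n \<in> N"
    then show "theta G Y a (?x n) = (\<Sum>k\<in>K. coeff Y (a k n) (int k - int n) (?x n))"
      unfolding theta_hom[OF x]
      by (intro Sum_any.expand_superset[OF K]) (use total_mem[OF x] in \<open>auto simp: K_def\<close>)
  qed
  also have "\<dots> = (\<Sum>k\<in>K. \<Sum>n\<in>N. coeff Y (bullet l n k (a k n) (b n l)) (int k - int l) w)"
    using pf hom by (subst sum.swap) (simp add: product_formula_def)
  also have "\<dots> = (\<Sum>k\<in>K. coeff Y ((a \<otimes>\<^bsub>matrix_algebra\<^esub> b) k l) (int k - int l) w)"
    by (simp only: matrix_mult_column(1)[OF a b] N_def[symmetric] coeff_sum_left[OF w])
  also have "\<dots> = theta G Y (a \<otimes>\<^bsub>matrix_algebra\<^esub> b) w"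
    unfolding theta_hom[OF hom]
    by (rule Sum_any.expand_superset[OF K, symmetric])
       (use matrix_mult_column(3)[OF a b] w in \<open>force simp: K_def N_def\<close>)
  finally show ?case ..
next
  case (add x y)
  then show ?case by (simp add: theta_add_right a b matrix_mult_closed theta_closed)
qed

lemma theta_one:
  assumes w: "w \<in> total_space G"
  shows "theta G Y \<one>\<^bsub>matrix_algebra\<^esub> w = w"
  using W graded w
proof (induction w rule: total_space_induct)
  case (hom n w)
  have w: "w \<in> total_space G" using total_mem[OF hom] .
  have "theta G Y \<one>\<^bsub>matrix_algebra\<^esub> w = Sum_any (\<lambda>k. if k = n then w else 0)"
    unfolding theta_hom[OF hom] by (intro Sum_any.cong) (auto simp: matrix_ops vac_coeff[OF w] w)
  then show ?case by simp
next
  case (add x y)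
  then show ?case by (simp add: theta_add_right one_closed)
qed

lemma theta_kernel:
  assumes phi: "graded_phi_module s G Y" and a: "a \<in> kernel_ideal" and w: "w \<in> total_space G"
  shows "theta G Y a w = 0"
proof -
  have "a \<in> carrier matrix_algebra" using a by (simp add: kernel_ideal_def)
  from W graded w show ?thesis
    by (induction w rule: total_space_induct)
       (simp_all add: kernel_ideal_acts_by_0[OF phi a] theta_add_right[OF \<open>a \<in> carrier matrix_algebra\<close>])
qed

end

lemma UN_constant_value:
  assumes "x \<in> S" "\<And>y. y \<in> S \<Longrightarrow> f y = c"
  shows "(\<Union>y\<in>S. f y) = c"
  using assms by auto

section \<open>The quotient algebra\<close>

context vertex_algebra_with_automorphism
begin

lemma kernel_ideal_carrier: "a \<in> kernel_ideal \<Longrightarrow> a \<in> carrier matrix_algebra"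
  by (simp add: kernel_ideal_def)

lemma kernel_idealI:
  assumes "a \<in> carrier matrix_algebra"
    and "\<And>(G :: nat \<Rightarrow> (('v \<times> int) list \<Rightarrow>\<^sub>0 complex) set) Y w.
      graded_phi_module free_scale G Y \<Longrightarrow> w \<in> total_space G \<Longrightarrow> theta G Y a w = 0"
  shows "a \<in> kernel_ideal"
  using assms by (simp add: kernel_ideal_def)

lemma quotient_class_eq: "quotient_class a = {(\<lambda>i j. k i j + a i j) | k. k \<in> kernel_ideal}"
  by (auto simp: quotient_class_def a_r_coset_def' matrix_ops)

lemma quotient_classI: "k \<in> kernel_ideal \<Longrightarrow> x = (\<lambda>i j. k i j + a i j) \<Longrightarrow> x \<in> quotient_class a"
  unfolding quotient_class_eq by (intro CollectI exI conjI)

lemma quotient_classE: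
  assumes "x \<in> quotient_class a"
  obtains k where "k \<in> kernel_ideal" "x = (\<lambda>i j. k i j + a i j)"
  using assms unfolding quotient_class_eq by (elim CollectE exE conjE)

lemma kernel_ideal_0: "(\<lambda>_ _. 0) \<in> kernel_ideal"
proof (rule kernel_idealI[OF zero_closed])
  fix G :: "nat \<Rightarrow> (('v \<times> int) list \<Rightarrow>\<^sub>0 complex) set" and Y w
  assume phi: "graded_phi_module free_scale G Y" and w: "w \<in> total_space G"
  interpret P: graded_operators scale mode vac g T free_scale G Y
    by (rule graded_phi_moduleD[OF vector_space_free phi])
  show "theta G Y (\<lambda>_ _. 0) w = 0"
    using P.theta_scale_left[OF zero_closed w, of 0] by simp
qed

lemma quotient_class_self: "a \<in> quotient_class a"
  by (rule quotient_classI[OF kernel_ideal_0]) simp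

lemma quotient_class_carrier:
  assumes "b \<in> quotient_class a" "a \<in> carrier matrix_algebra"
  shows "b \<in> carrier matrix_algebra"
  using assms by (elim quotient_classE) (simp add: kernel_ideal_carrier matrix_add_closed)

lemma theta_quotient_class:
  assumes s: "vector_space s" and phi: "graded_phi_module s G Y" and a: "a \<in> carrier matrix_algebra"
    and b: "b \<in> quotient_class a" and w: "w \<in> total_space G"
  shows "theta G Y b w = theta G Y a w"
proof -
  interpret P: graded_operators scale mode vac g T s G Y by (rule graded_phi_moduleD[OF s phi])
  obtain k where k: "k \<in> kernel_ideal" "b = (\<lambda>i j. k i j + a i j)" using b by (rule quotient_classE)
  show ?thesis
    using P.theta_add_left[OF kernel_ideal_carrier[OF k(1)] a w] P.theta_kernel[OF phi k(1) w] by (simp add: k(2))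
qed

text \<open>By the choice of the kernel ideal, equality of classes can be tested on modules over the
  free space. The relations between elementary classes below are obtained in this way.\<close>

lemma quotient_class_eqI:
  assumes a: "a \<in> carrier matrix_algebra" and b: "b \<in> carrier matrix_algebra"
    and eq: "\<And>(G :: nat \<Rightarrow> (('v \<times> int) list \<Rightarrow>\<^sub>0 complex) set) Y w.
      graded_phi_module free_scale G Y \<Longrightarrow> w \<in> total_space G \<Longrightarrow> theta G Y a w = theta G Y b w"
  shows "quotient_class a = quotient_class b"
proof -
  have sub: "quotient_class a \<subseteq> quotient_class b"
    if a: "a \<in> carrier matrix_algebra" and b: "b \<in> carrier matrix_algebra"
      and eq: "\<And>(G :: nat \<Rightarrow> (('v \<times> int) list \<Rightarrow>\<^sub>0 complex) set) Y w.
      graded_phi_module free_scale G Y \<Longrightarrow> w \<in> total_space G \<Longrightarrow> theta G Y a w = theta G Y b w" for a b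
  proof
    fix x assume "x \<in> quotient_class a"
    then obtain k where k: "k \<in> kernel_ideal" "x = (\<lambda>i j. k i j + a i j)" by (rule quotient_classE)
    define k' where "k' = (\<lambda>i j. (k i j + a i j) + (- 1) *v b i j)"
    note c = matrix_add_closed[OF kernel_ideal_carrier[OF k(1)] a] matrix_scale_closed[OF b, of "- 1"]
    have "k' \<in> kernel_ideal"
      unfolding k'_def
    proof (rule kernel_idealI[OF matrix_add_closed[OF c]])
      fix G :: "nat \<Rightarrow> (('v \<times> int) list \<Rightarrow>\<^sub>0 complex) set" and Y w
      assume phi: "graded_phi_module free_scale G Y" and w: "w \<in> total_space G"
      interpret P: graded_operators scale mode vac g T free_scale G Y
        by (rule graded_phi_moduleD[OF vector_space_free phi])
      show "theta G Y (\<lambda>i j. k i j + a i j + (- 1) *v b i j) w = 0"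
        using P.theta_add_left[OF c w] P.theta_add_left[OF kernel_ideal_carrier[OF k(1)] a w]
          P.theta_scale_left[OF b w, of "- 1"] P.theta_kernel[OF phi k(1) w] eq[OF phi w] P.W.scale_minus_left[of 1]
        by simp
    qed
    moreover have "x = (\<lambda>i j. k' i j + b i j)" by (simp add: k k'_def)
    ultimately show "x \<in> quotient_class b" by (rule quotient_classI)
  qed
  show ?thesis using sub[OF a b eq] sub[OF b a eq[symmetric]] by blast
qed

lemma carrier_A: "carrier A_algebra = quotient_class ` carrier matrix_algebra"
  by (auto simp: A_algebra_def quotient_algebra_def ring.extend_def FactRing_def A_RCOSETS_def' quotient_class_def)

lemma carrier_AE:
  assumes "X \<in> carrier A_algebra"
  obtains a where "a \<in> carrier matrix_algebra" "X = quotient_class a"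
  using assms by (auto simp: carrier_A)

lemma quotient_class_in: "a \<in> carrier matrix_algebra \<Longrightarrow> quotient_class a \<in> carrier A_algebra"
  by (simp add: carrier_A)

lemma A_one: "\<one>\<^bsub>A_algebra\<^esub> = quotient_class \<one>\<^bsub>matrix_algebra\<^esub>"
  by (simp add: A_algebra_def quotient_algebra_def ring.extend_def FactRing_def quotient_class_def)

lemma A_add:
  assumes "a \<in> carrier matrix_algebra" "b \<in> carrier matrix_algebra"
  shows "quotient_class a \<oplus>\<^bsub>A_algebra\<^esub> quotient_class b = quotient_class (\<lambda>i j. a i j + b i j)"
proof -
  have "quotient_class a \<oplus>\<^bsub>A_algebra\<^esub> quotient_class b =
    (\<Union>x\<in>quotient_class a. \<Union>y\<in>quotient_class b. {\<lambda>i j. x i j + y i j})"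
    by (simp add: A_algebra_def quotient_algebra_def ring.extend_def FactRing_def set_add_def' matrix_ops)
  also have "\<dots> = quotient_class (\<lambda>i j. a i j + b i j)"
  proof (intro equalityI subsetI)
    fix z assume "z \<in> (\<Union>x\<in>quotient_class a. \<Union>y\<in>quotient_class b. {\<lambda>i j. x i j + y i j})"
    then obtain x y where "x \<in> quotient_class a" "y \<in> quotient_class b" and z: "z = (\<lambda>i j. x i j + y i j)"
      by (elim UN_E singletonE)
    then obtain k k' where k: "k \<in> kernel_ideal" "k' \<in> kernel_ideal"
      "x = (\<lambda>i j. k i j + a i j)" "y = (\<lambda>i j. k' i j + b i j)" by (elim quotient_classE)
    have "(\<lambda>i j. k i j + k' i j) \<in> kernel_ideal"
    proof (rule kernel_idealI[OF matrix_add_closed[OF k(1,2)[THEN kernel_ideal_carrier]]])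
      fix G :: "nat \<Rightarrow> (('v \<times> int) list \<Rightarrow>\<^sub>0 complex) set" and Y w
      assume phi: "graded_phi_module free_scale G Y" and w: "w \<in> total_space G"
      interpret P: graded_operators scale mode vac g T free_scale G Y
        by (rule graded_phi_moduleD[OF vector_space_free phi])
      show "theta G Y (\<lambda>i j. k i j + k' i j) w = 0"
        using P.theta_add_left[OF k(1,2)[THEN kernel_ideal_carrier] w] P.theta_kernel[OF phi _ w] k by simp
    qed
    moreover have "z = (\<lambda>i j. (k i j + k' i j) + (a i j + b i j))" by (simp add: z k ac_simps)
    ultimately show "z \<in> quotient_class (\<lambda>i j. a i j + b i j)" by (rule quotient_classI)
  next
    fix z assume "z \<in> quotient_class (\<lambda>i j. a i j + b i j)"
    then obtain k where k: "k \<in> kernel_ideal" "z = (\<lambda>i j. k i j + (a i j + b i j))" by (rule quotient_classE)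
    then have "(\<lambda>i j. k i j + a i j) \<in> quotient_class a" by (intro quotient_classI[OF _ refl])
    moreover have "z = (\<lambda>i j. (k i j + a i j) + b i j)" by (simp add: k add.assoc)
    ultimately show "z \<in> (\<Union>x\<in>quotient_class a. \<Union>y\<in>quotient_class b. {\<lambda>i j. x i j + y i j})"
      using quotient_class_self[of b] by (intro UN_I) auto
  qed
  finally show ?thesis .
qed

text \<open>The union over representatives in \<open>quotient_algebra\<close> is a union of equal
  classes, since representatives act alike in every module.\<close>

lemma A_scale:
  assumes a: "a \<in> carrier matrix_algebra"
  shows "csmult A_algebra c (quotient_class a) = quotient_class (\<lambda>i j. c *v a i j)"
proof -
  have "csmult A_algebra c (quotient_class a) = (\<Union>x\<in>quotient_class a. quotient_class (\<lambda>i j. c *v x i j))"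
    by (simp add: A_algebra_def quotient_algebra_def ring.extend_def complex_algebra.fields_def
        quotient_class_def matrix_ops)
  also have "quotient_class (\<lambda>i j. c *v x i j) = quotient_class (\<lambda>i j. c *v a i j)" if x: "x \<in> quotient_class a" for x
  proof (rule quotient_class_eqI[OF matrix_scale_closed[OF quotient_class_carrier[OF x a]] matrix_scale_closed[OF a]])
    fix G :: "nat \<Rightarrow> (('v \<times> int) list \<Rightarrow>\<^sub>0 complex) set" and Y w
    assume phi: "graded_phi_module free_scale G Y" and w: "w \<in> total_space G"
    interpret P: graded_operators scale mode vac g T free_scale G Y
      by (rule graded_phi_moduleD[OF vector_space_free phi])
    show "theta G Y (\<lambda>i j. c *v x i j) w = theta G Y (\<lambda>i j. c *v a i j) w"
      by (simp add: P.theta_scale_left[OF quotient_class_carrier[OF x a] w] P.theta_scale_left[OF a w]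
          theta_quotient_class[OF vector_space_free phi a x w])
  qed
  then have "(\<Union>x\<in>quotient_class a. quotient_class (\<lambda>i j. c *v x i j)) = quotient_class (\<lambda>i j. c *v a i j)"
    by (rule UN_constant_value[OF quotient_class_self])
  finally show ?thesis .
qed

text \<open>The coset product is a union over representatives. By \<open>theta_mult\<close> a
  product acts as a composition, and representatives act alike, so all members of the union are the
  same class.\<close>

lemma A_mult:
  assumes a: "a \<in> carrier matrix_algebra" and b: "b \<in> carrier matrix_algebra"
  shows "quotient_class a \<otimes>\<^bsub>A_algebra\<^esub> quotient_class b = quotient_class (a \<otimes>\<^bsub>matrix_algebra\<^esub> b)"
proof -
  have "quotient_class a \<otimes>\<^bsub>A_algebra\<^esub> quotient_class b =
    (\<Union>x\<in>quotient_class a. \<Union>y\<in>quotient_class b. quotient_class (x \<otimes>\<^bsub>matrix_algebra\<^esub> y))"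
    by (simp add: A_algebra_def quotient_algebra_def ring.extend_def FactRing_def rcoset_mult_def
        quotient_class_def)
  also have "\<dots> = quotient_class (a \<otimes>\<^bsub>matrix_algebra\<^esub> b)"
  proof -
    have "quotient_class (x \<otimes>\<^bsub>matrix_algebra\<^esub> y) = quotient_class (a \<otimes>\<^bsub>matrix_algebra\<^esub> b)"
      if x: "x \<in> quotient_class a" and y: "y \<in> quotient_class b" for x y
    proof -
      note x' = quotient_class_carrier[OF x a] and y' = quotient_class_carrier[OF y b]
      show ?thesis
      proof (rule quotient_class_eqI[OF matrix_mult_closed[OF x' y'] matrix_mult_closed[OF a b]])
        fix G :: "nat \<Rightarrow> (('v \<times> int) list \<Rightarrow>\<^sub>0 complex) set" and Y w
        assume phi: "graded_phi_module free_scale G Y" and w: "w \<in> total_space G"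
        interpret P: graded_operators scale mode vac g T free_scale G Y
          by (rule graded_phi_moduleD[OF vector_space_free phi])
        note pf = P.phi_module_product_formula[OF phi]
        show "theta G Y (x \<otimes>\<^bsub>matrix_algebra\<^esub> y) w = theta G Y (a \<otimes>\<^bsub>matrix_algebra\<^esub> b) w"
          unfolding P.theta_mult[OF pf x' y' w] P.theta_mult[OF pf a b w]
            theta_quotient_class[OF vector_space_free phi b y w]
          by (rule theta_quotient_class[OF vector_space_free phi a x P.theta_closed[OF w]])
      qed
    qed
    then show ?thesis
      by (intro UN_constant_value[OF quotient_class_self]) auto
  qed
  finally show ?thesis .
qed

text \<open>\<open>theta G Y\<close> is constant on a class because the kernel ideal acts by zero,
  so its image has a single element, which \<open>the_elem\<close> returns.\<close>

lemma A_module_of_class: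
  assumes "vector_space s" "graded_phi_module s G Y" "a \<in> carrier matrix_algebra"
  shows "snd (A_module_of (G, Y)) (quotient_class a) = theta G Y a"
proof -
  have "theta G Y b = theta G Y a" if "b \<in> quotient_class a" for b
  proof
    fix w
    show "theta G Y b w = theta G Y a w"
    proof (cases "w \<in> total_space G")
      case True
      then show ?thesis by (rule theta_quotient_class[OF assms that])
    qed (simp add: theta_def)
  qed
  then have "theta G Y ` quotient_class a = (\<lambda>_. theta G Y a) ` quotient_class a" by (rule image_cong[OF refl])
  also have "\<dots> = {theta G Y a}" by (rule image_constant[OF quotient_class_self])
  finally have "the_elem (theta G Y ` quotient_class a) = theta G Y a" by (simp only: the_elem_eq)
  then show ?thesis
    unfolding A_module_of_def prod.case snd_conv restrict_apply'[OF quotient_class_in[OF assms(3)]] .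
qed

lemma fst_A_module_of [simp]: "fst (A_module_of X) = fst X"
  by (simp add: A_module_of_def split_beta)

theorem graded_A_module_A_module_of:
  assumes s: "vector_space s" and phi: "graded_phi_module s G Y"
  shows "graded_A_module s G (snd (A_module_of (G, Y)))"
proof -
  interpret P: graded_operators scale mode vac g T s G Y by (rule graded_phi_moduleD[OF s phi])
  note pf = P.phi_module_product_formula[OF phi]
  note \<rho> = A_module_of_class[OF s phi]
  let ?\<rho> = "snd (A_module_of (G, Y))"
  have "unital_module A_algebra s (total_space G) ?\<rho>"
    unfolding unital_module_def
  proof (intro conjI ballI allI)
    show "module.subspace s (total_space G)" by (rule P.subspace_total)
    show "?\<rho> \<in> carrier A_algebra \<rightarrow>\<^sub>E linear_maps s (total_space G) (total_space G)"
    proof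
      fix X assume "X \<in> carrier A_algebra"
      then show "?\<rho> X \<in> linear_maps s (total_space G) (total_space G)"
        by (metis carrier_AE \<rho> P.theta_linear)
    next
      fix X assume "X \<notin> carrier A_algebra"
      then show "?\<rho> X = undefined" by (simp add: A_module_of_def)
    qed
    show "?\<rho> \<one>\<^bsub>A_algebra\<^esub> w = w" if "w \<in> total_space G" for w
      using that by (simp add: A_one \<rho> one_closed P.theta_one)
    fix X w assume "X \<in> carrier A_algebra" and w: "w \<in> total_space G"
    then obtain a where a: "a \<in> carrier matrix_algebra" and X: "X = quotient_class a" by (elim carrier_AE)
    show "?\<rho> (csmult A_algebra c X) w = s c (?\<rho> X w)" for c
      using a w by (simp add: X A_scale \<rho> matrix_scale_closed P.theta_scale_left)
    fix Z assume "Z \<in> carrier A_algebra"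
    then obtain b where b: "b \<in> carrier matrix_algebra" and Z: "Z = quotient_class b" by (rule carrier_AE)
    show "?\<rho> (X \<oplus>\<^bsub>A_algebra\<^esub> Z) w = ?\<rho> X w + ?\<rho> Z w"
      using a b w by (simp add: X Z A_add \<rho> matrix_add_closed P.theta_add_left)
    show "?\<rho> (X \<otimes>\<^bsub>A_algebra\<^esub> Z) w = ?\<rho> X (?\<rho> Z w)"
      using a b w by (simp add: X Z A_mult \<rho> matrix_mult_closed P.theta_mult[OF pf])
  qed
  moreover have "?\<rho> (quotient_class (elementary k l v)) w = (if n = l then coeff Y v (int k - int l) w else 0)"
    if "w \<in> G n" for v k l n w
    using P.theta_elementary[OF P.total_mem[OF that], of k l v]
    by (simp add: \<rho> elementary_closed component_single[OF s P.graded that])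
  moreover have "coeff Y v (int k - int l) w \<in> G k" if "w \<in> G l" for v k l w
    using P.coeff_degree[OF that, of "int k - int l" v] by simp
  ultimately show ?thesis
    unfolding graded_A_module_def using P.graded P.vac_coeff P.total_mem by simp
qed

end

section \<open>From modules for the quotient algebra to twisted modules\<close>

context vertex_algebra_with_automorphism
begin

text \<open>The only candidate for an inverse: on degree n/T the operator has to be the action of
  the elementary matrix that leads to degree (n - j - T)/T, and 0 if this is negative.\<close>

definition operator_of :: "(nat \<Rightarrow> 'w::ab_group_add set) \<Rightarrow> ((nat \<Rightarrow> nat \<Rightarrow> 'v) set \<Rightarrow> 'w \<Rightarrow> 'w) \<Rightarrow> 'v \<Rightarrow> int \<Rightarrow> 'w \<Rightarrow> 'w" where
  "operator_of G \<rho> v j = (\<lambda>w\<in>total_space G. Sum_any (\<lambda>n. if int n - j - int T \<ge> 0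
     then \<rho> (quotient_class (elementary (nat (int n - j - int T)) n v)) (component G w n) else 0))"

lemma quotient_class_elementary_add:
  "quotient_class (elementary k l (u + v)) = quotient_class (elementary k l u) \<oplus>\<^bsub>A_algebra\<^esub> quotient_class (elementary k l v)"
  by (simp only: A_add[OF elementary_closed elementary_closed] elementary_add)

lemma quotient_class_elementary_scale:
  "quotient_class (elementary k l (c *v v)) = csmult A_algebra c (quotient_class (elementary k l v))"
  by (simp only: A_scale[OF elementary_closed] elementary_scale)

text \<open>A relation valid in all twisted modules becomes an equation between classes and so holds
  in every module of the quotient algebra. The vacuum axiom, the action of \<open>g\<close> and the
  residue relations are carried over like this.\<close>

lemma quotient_class_elementary_eqI:
  assumes "\<And>(G :: nat \<Rightarrow> (('v \<times> int) list \<Rightarrow>\<^sub>0 complex) set) Y w.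
      graded_phi_module free_scale G Y \<Longrightarrow> w \<in> G l \<Longrightarrow>
      coeff Y u (int k - int l) w = coeff Y v (int k - int l) w"
  shows "quotient_class (elementary k l u) = quotient_class (elementary k l v)"
proof (rule quotient_class_eqI[OF elementary_closed elementary_closed])
  fix G :: "nat \<Rightarrow> (('v \<times> int) list \<Rightarrow>\<^sub>0 complex) set" and Y w
  assume phi: "graded_phi_module free_scale G Y" and w: "w \<in> total_space G"
  interpret P: graded_operators scale mode vac g T free_scale G Y
    by (rule graded_phi_moduleD[OF vector_space_free phi])
  show "theta G Y (elementary k l u) w = theta G Y (elementary k l v) w"
    unfolding P.theta_elementary[OF w] by (rule assms[OF phi P.component_in[OF w]])
qed

lemma quotient_class_elementary_vac:
  assumes "k \<noteq> l"
  shows "quotient_class (elementary k l vac) = quotient_class (elementary k l 0)"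
proof (rule quotient_class_elementary_eqI)
  fix G :: "nat \<Rightarrow> (('v \<times> int) list \<Rightarrow>\<^sub>0 complex) set" and Y w
  assume phi: "graded_phi_module free_scale G Y" and w: "w \<in> G l"
  interpret P: graded_operators scale mode vac g T free_scale G Y
    by (rule graded_phi_moduleD[OF vector_space_free phi])
  show "coeff Y vac (int k - int l) w = coeff Y 0 (int k - int l) w"
    using assms P.total_mem[OF w] P.vac_coeff by simp
qed

lemma quotient_class_elementary_g:
  "quotient_class (elementary k l (g v)) =
    quotient_class (elementary k l ((exp (- 2 * of_real pi * \<i> / of_nat T) powi (int k - int l)) *v v))"
proof (rule quotient_class_elementary_eqI)
  fix G :: "nat \<Rightarrow> (('v \<times> int) list \<Rightarrow>\<^sub>0 complex) set" and Y w
  assume phi: "graded_phi_module free_scale G Y" and w: "w \<in> G l"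
  interpret P: graded_operators scale mode vac g T free_scale G Y
    by (rule graded_phi_moduleD[OF vector_space_free phi])
  show "coeff Y (g v) (int k - int l) w =
    coeff Y ((exp (- 2 * of_real pi * \<i> / of_nat T) powi (int k - int l)) *v v) (int k - int l) w"
    unfolding P.coeff_scale_left[OF P.total_mem[OF w]] by (rule P.g_coeff[OF P.total_mem[OF w]])
qed

lemma quotient_class_elementary_residue_product:
  assumes "r < T" "u \<in> eigenspace r" "t \<ge> degree_bound r m n"
  shows "quotient_class (elementary n m (residue_product (twist_power r m) (t + 1) u v)) =
    quotient_class (elementary n m 0)"
proof (rule quotient_class_elementary_eqI)
  fix G :: "nat \<Rightarrow> (('v \<times> int) list \<Rightarrow>\<^sub>0 complex) set" and Y w
  assume phi: "graded_phi_module free_scale G Y" and w: "w \<in> G m"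
  interpret P: graded_operators scale mode vac g T free_scale G Y
    by (rule graded_phi_moduleD[OF vector_space_free phi])
  show "coeff Y (residue_product (twist_power r m) (t + 1) u v) (int n - int m) w = coeff Y 0 (int n - int m) w"
    using P.phi_module_residues_vanish[OF phi] assms w P.total_mem[OF w] by (simp add: P.residues_vanish_def)
qed

text \<open>Right multiplication by \<open>elementary m m vac\<close> first projects to degree m/T,
  where only column m acts. An arbitrary matrix is thereby reduced to one with finitely many nonzero
  entries.\<close>

lemma quotient_class_column:
  assumes a: "a \<in> carrier matrix_algebra"
  shows "quotient_class (a \<otimes>\<^bsub>matrix_algebra\<^esub> elementary m m vac) =
    quotient_class (\<lambda>i j. if j = m then a i m else 0)"
proof -
  let ?b = "\<lambda>i j. if j = m then a i m else 0"
  have b: "?b \<in> carrier matrix_algebra" using a by (simp add: carrier_matrix)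
  show ?thesis
  proof (rule quotient_class_eqI[OF matrix_mult_closed[OF a elementary_closed] b])
    fix G :: "nat \<Rightarrow> (('v \<times> int) list \<Rightarrow>\<^sub>0 complex) set" and Y w
    assume phi: "graded_phi_module free_scale G Y" and w: "w \<in> total_space G"
    interpret P: graded_operators scale mode vac g T free_scale G Y
      by (rule graded_phi_moduleD[OF vector_space_free phi])
    have w': "component G w m \<in> G m" "component G w m \<in> total_space G"
      using P.component_in[OF w] P.total_mem by blast+
    have "theta G Y (a \<otimes>\<^bsub>matrix_algebra\<^esub> elementary m m vac) w = theta G Y a (component G w m)"
      unfolding P.theta_mult[OF P.phi_module_product_formula[OF phi] a elementary_closed w] P.theta_elementary[OF w]
      using P.vac_coeff[OF w'(2)] by simp
    also have "\<dots> = theta G Y ?b (component G w m)"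
      unfolding P.theta_hom[OF w'(1)] by simp
    also have "\<dots> = Sum_any (\<lambda>n. if n = m then theta G Y ?b (component G w m) else 0)"
      by simp
    also have "\<dots> = Sum_any (\<lambda>n. theta G Y ?b (component G w n))"
    proof (rule Sum_any.cong)
      fix n
      show "(if n = m then theta G Y ?b (component G w m) else 0) = theta G Y ?b (component G w n)"
      proof (cases "n = m")
        case False
        have "component G w n \<in> total_space G" using P.component_in[OF w] P.total_mem by blast
        then show ?thesis unfolding P.theta_hom[OF P.component_in[OF w]] using False by simp
      qed simp
    qed
    also have "\<dots> = theta G Y ?b w" by (rule P.theta_decompose[OF w, symmetric])
    finally show "theta G Y (a \<otimes>\<^bsub>matrix_algebra\<^esub> elementary m m vac) w = theta G Y ?b w" .
  qed
qed

context
  fixes s :: "complex \<Rightarrow> 'w::ab_group_add \<Rightarrow> 'w" and G \<rho>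
  assumes s: "vector_space s" and mod: "graded_A_module s G \<rho>"
begin

interpretation W: vector_space s by (rule s)

lemma A_graded: "graded_space s G"
  using mod by (simp add: graded_A_module_def)

lemma A_unital: "unital_module A_algebra s (total_space G) \<rho>"
  using mod by (simp add: graded_A_module_def)

lemma A_total_mem: "w \<in> G n \<Longrightarrow> w \<in> total_space G"
  by (rule total_space_mem[OF s A_graded])

lemma A_linear: "a \<in> carrier matrix_algebra \<Longrightarrow> \<rho> (quotient_class a) \<in> linear_maps s (total_space G) (total_space G)"
  using A_unital quotient_class_in unfolding unital_module_def by blast

lemma A_closed: "a \<in> carrier matrix_algebra \<Longrightarrow> w \<in> total_space G \<Longrightarrow> \<rho> (quotient_class a) w \<in> total_space G"
  using A_linear by (auto simp: linear_maps_def PiE_def Pi_def)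

lemma A_add_right: "a \<in> carrier matrix_algebra \<Longrightarrow> x \<in> total_space G \<Longrightarrow> y \<in> total_space G \<Longrightarrow>
    \<rho> (quotient_class a) (x + y) = \<rho> (quotient_class a) x + \<rho> (quotient_class a) y"
  using A_linear by (auto simp: linear_maps_def)

lemma A_scale_right: "a \<in> carrier matrix_algebra \<Longrightarrow> x \<in> total_space G \<Longrightarrow>
    \<rho> (quotient_class a) (s c x) = s c (\<rho> (quotient_class a) x)"
  using A_linear by (auto simp: linear_maps_def)

lemma A_0_right: "a \<in> carrier matrix_algebra \<Longrightarrow> \<rho> (quotient_class a) 0 = 0"
  using A_scale_right[of a 0 0] W.subspace_0[OF subspace_total_space[OF s A_graded]] by simp

lemma A_add_left: "a \<in> carrier matrix_algebra \<Longrightarrow> b \<in> carrier matrix_algebra \<Longrightarrow> w \<in> total_space G \<Longrightarrow>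
    \<rho> (quotient_class a \<oplus>\<^bsub>A_algebra\<^esub> quotient_class b) w = \<rho> (quotient_class a) w + \<rho> (quotient_class b) w"
  using A_unital quotient_class_in unfolding unital_module_def by blast

lemma A_scale_left: "a \<in> carrier matrix_algebra \<Longrightarrow> w \<in> total_space G \<Longrightarrow>
    \<rho> (csmult A_algebra c (quotient_class a)) w = s c (\<rho> (quotient_class a) w)"
  using A_unital quotient_class_in unfolding unital_module_def by blast

lemma A_mult_left: "a \<in> carrier matrix_algebra \<Longrightarrow> b \<in> carrier matrix_algebra \<Longrightarrow> w \<in> total_space G \<Longrightarrow>
    \<rho> (quotient_class (a \<otimes>\<^bsub>matrix_algebra\<^esub> b)) w = \<rho> (quotient_class a) (\<rho> (quotient_class b) w)"
  using A_unital quotient_class_in A_mult unfolding unital_module_def by metis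

lemma A_elementary_degree: "w \<in> G l \<Longrightarrow> \<rho> (quotient_class (elementary k l v)) w \<in> G k"
  and A_elementary_vac: "w \<in> G l \<Longrightarrow> \<rho> (quotient_class (elementary l l vac)) w = w"
  using mod unfolding graded_A_module_def by blast+

lemma A_elementary_add: "w \<in> total_space G \<Longrightarrow> \<rho> (quotient_class (elementary k l (u + v))) w =
    \<rho> (quotient_class (elementary k l u)) w + \<rho> (quotient_class (elementary k l v)) w"
  unfolding quotient_class_elementary_add by (rule A_add_left[OF elementary_closed elementary_closed])

lemma A_elementary_scale: "w \<in> total_space G \<Longrightarrow> \<rho> (quotient_class (elementary k l (c *v v))) w =
    s c (\<rho> (quotient_class (elementary k l v)) w)"
  unfolding quotient_class_elementary_scale by (rule A_scale_left[OF elementary_closed])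

lemma A_elementary_0: "w \<in> total_space G \<Longrightarrow> \<rho> (quotient_class (elementary k l 0)) w = 0"
  using A_elementary_scale[of w k l 0 0] by simp

lemma operator_of_hom:
  assumes w: "w \<in> G m"
  shows "operator_of G \<rho> v j w = (if int m - j - int T \<ge> 0
     then \<rho> (quotient_class (elementary (nat (int m - j - int T)) m v)) w else 0)"
proof -
  have "operator_of G \<rho> v j w = Sum_any (\<lambda>n. if n = m then if int m - j - int T \<ge> 0
     then \<rho> (quotient_class (elementary (nat (int m - j - int T)) m v)) w else 0 else 0)"
    unfolding operator_of_def restrict_apply'[OF A_total_mem[OF w]] component_single[OF s A_graded w]
    by (intro Sum_any.cong) (simp add: A_0_right[OF elementary_closed])
  then show ?thesis by simp
qed

lemma operator_of_add:
  assumes x: "x \<in> total_space G" and y: "y \<in> total_space G"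
  shows "operator_of G \<rho> v j (x + y) = operator_of G \<rho> v j x + operator_of G \<rho> v j y"
proof -
  let ?f = "\<lambda>w n. if int n - j - int T \<ge> 0
     then \<rho> (quotient_class (elementary (nat (int n - j - int T)) n v)) (component G w n) else 0"
  have fin: "finite {n. ?f w n \<noteq> 0}" if "w \<in> total_space G" for w
    by (rule finite_subset[OF _ finite_component[OF s A_graded that]]) (auto simp: A_0_right[OF elementary_closed])
  have c: "component G w n \<in> total_space G" if "w \<in> total_space G" for w n
    using component_mem[OF s A_graded that] A_total_mem by blast
  have "Sum_any (?f (x + y)) = Sum_any (\<lambda>n. ?f x n + ?f y n)"
    by (intro Sum_any.cong)
       (simp add: component_add[OF s A_graded x y] A_add_right[OF elementary_closed c[OF x] c[OF y]])
  also have "\<dots> = Sum_any (?f x) + Sum_any (?f y)" by (rule Sum_any.distrib[OF fin[OF x] fin[OF y]])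
  finally show ?thesis
    using W.subspace_add[OF subspace_total_space[OF s A_graded] x y] x y
    unfolding operator_of_def by (simp only: restrict_apply')
qed

lemma operator_of_mem:
  assumes "w \<in> G m"
  shows "if int m - j - int T \<ge> 0 then operator_of G \<rho> v j w \<in> G (nat (int m - j - int T)) else operator_of G \<rho> v j w = 0"
  using A_elementary_degree[OF assms] by (simp add: operator_of_hom[OF assms])

lemma operator_of_closed:
  assumes "w \<in> total_space G"
  shows "operator_of G \<rho> v j w \<in> total_space G"
  using s A_graded assms
proof (induction w rule: total_space_induct)
  case (hom n w)
  show ?case
    using operator_of_mem[OF hom, of j v] A_total_mem W.subspace_0[OF subspace_total_space[OF s A_graded]]
    by (auto split: if_splits)
next
  case (add x y)
  then show ?case by (simp add: operator_of_add W.subspace_add[OF subspace_total_space[OF s A_graded]])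
qed

lemma operator_of_coeff:
  assumes "w \<in> G m"
  shows "coeff (operator_of G \<rho>) v (int k - int m) w = \<rho> (quotient_class (elementary k m v)) w"
  using operator_of_hom[OF assms, of v "- (int k - int m) - int T"] by (simp add: coeff_def)

lemma operator_of_coeff_neg:
  assumes "w \<in> G m" "int m + a < 0"
  shows "coeff (operator_of G \<rho>) v a w = 0"
  using operator_of_hom[OF assms(1), of v "- a - int T"] assms(2) by (simp add: coeff_def)

lemma coeff_operator_of_cases:
  assumes "w \<in> G m"
  obtains k where "a = int k - int m"
    | "int m + a < 0" "\<And>v. coeff (operator_of G \<rho>) v a w = 0"
proof (cases "int m + a < 0")
  case True
  then show ?thesis using that(2) operator_of_coeff_neg[OF assms True] by blast
next
  case False
  then have "a = int (nat (int m + a)) - int m" by simp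
  then show ?thesis by (rule that(1))
qed

lemma coeff_operator_of_add:
  assumes "x \<in> total_space G" "y \<in> total_space G"
  shows "coeff (operator_of G \<rho>) v a (x + y) = coeff (operator_of G \<rho>) v a x + coeff (operator_of G \<rho>) v a y"
  unfolding coeff_def by (rule operator_of_add[OF assms])

text \<open>On homogeneous vectors each condition is a relation between elementary classes, or
  concerns a negative target degree, where the operators vanish.\<close>

lemma graded_operators_operator_of: "graded_operators scale mode vac g T s G (operator_of G \<rho>)"
proof (intro graded_operators.intro graded_operators_axioms.intro vertex_algebra_with_automorphism_axioms s A_graded)
  note tot = subspace_total_space[OF s A_graded]
  have scale: "coeff (operator_of G \<rho>) v a (s c w) = s c (coeff (operator_of G \<rho>) v a w)"
    if "w \<in> total_space G" for v a c w
    using s A_graded that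
  proof (induction w rule: total_space_induct)
    case (hom m w)
    have sw: "s c w \<in> G m" by (rule W.subspace_scale[OF graded_subspace[OF s A_graded] hom])
    show ?case
    proof (rule coeff_operator_of_cases[OF hom, of a])
      fix k assume a: "a = int k - int m"
      show ?thesis
        unfolding a operator_of_coeff[OF hom] operator_of_coeff[OF sw]
        by (rule A_scale_right[OF elementary_closed A_total_mem[OF hom]])
    qed (simp add: operator_of_coeff_neg[OF sw])
  next
    case (add x y)
    then show ?case by (simp add: coeff_operator_of_add W.scale_right_distrib W.subspace_scale[OF tot])
  qed
  show "operator_of G \<rho> v j \<in> linear_maps s (total_space G) (total_space G)" for v j
    unfolding linear_maps_def
  proof (intro CollectI conjI ballI allI)
    show "operator_of G \<rho> v j \<in> total_space G \<rightarrow>\<^sub>E total_space G"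
    proof (rule PiE_I)
      show "operator_of G \<rho> v j x \<in> total_space G" if "x \<in> total_space G" for x
        by (rule operator_of_closed[OF that])
      show "operator_of G \<rho> v j x = undefined" if "x \<notin> total_space G" for x
        using that by (simp add: operator_of_def)
    qed
    show "operator_of G \<rho> v j (x + y) = operator_of G \<rho> v j x + operator_of G \<rho> v j y"
      if "x \<in> total_space G" "y \<in> total_space G" for x y
      by (rule operator_of_add[OF that])
    show "operator_of G \<rho> v j (s c x) = s c (operator_of G \<rho> v j x)" if "x \<in> total_space G" for c x
      using scale[OF that, of v "- j - int T" c] by (simp add: coeff_def)
  qed
  have add_left: "coeff (operator_of G \<rho>) (u + v) a w = coeff (operator_of G \<rho>) u a w + coeff (operator_of G \<rho>) v a w"
    if "w \<in> total_space G" for w u v a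
    using s A_graded that
  proof (induction w rule: total_space_induct)
    case (hom m w)
    show ?case
    proof (rule coeff_operator_of_cases[OF hom, of a])
      fix k assume a: "a = int k - int m"
      show ?thesis
        unfolding a operator_of_coeff[OF hom] by (rule A_elementary_add[OF A_total_mem[OF hom]])
    qed simp
  next
    case (add x y)
    then show ?case by (simp add: coeff_operator_of_add)
  qed
  have scale_left: "coeff (operator_of G \<rho>) (c *v v) a w = s c (coeff (operator_of G \<rho>) v a w)"
    if "w \<in> total_space G" for w c v a
    using s A_graded that
  proof (induction w rule: total_space_induct)
    case (hom m w)
    show ?case
    proof (rule coeff_operator_of_cases[OF hom, of a])
      fix k assume a: "a = int k - int m"
      show ?thesis
        unfolding a operator_of_coeff[OF hom] by (rule A_elementary_scale[OF A_total_mem[OF hom]])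
    qed simp
  next
    case (add x y)
    then show ?case by (simp add: coeff_operator_of_add W.scale_right_distrib)
  qed
  show "operator_of G \<rho> (u + v) j w = operator_of G \<rho> u j w + operator_of G \<rho> v j w"
    if "w \<in> total_space G" for w u v j
    using add_left[OF that, of u v "- j - int T"] by (simp add: coeff_def)
  show "operator_of G \<rho> (c *v v) j w = s c (operator_of G \<rho> v j w)"
    if "w \<in> total_space G" for w c v j
    using scale_left[OF that, of c v "- j - int T"] by (simp add: coeff_def)
  show "if int n - j - int T \<ge> 0 then operator_of G \<rho> v j w \<in> G (nat (int n - j - int T)) else operator_of G \<rho> v j w = 0"
    if "w \<in> G n" for w n j v
    by (rule operator_of_mem[OF that])
  show "coeff (operator_of G \<rho>) vac a w = (if a = 0 then w else 0)" if "w \<in> total_space G" for w a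
    using s A_graded that
  proof (induction w rule: total_space_induct)
    case (hom m w)
    show ?case
    proof (rule coeff_operator_of_cases[OF hom, of a])
      fix k assume a: "a = int k - int m"
      show ?thesis
      proof (cases "k = m")
        \<comment> \<open>Here the degreewise unitality in \<open>graded_A_module\<close>
          enters.\<close>
        case True
        then show ?thesis unfolding a operator_of_coeff[OF hom] using A_elementary_vac[OF hom] by simp
      next
        case False
        then show ?thesis
          unfolding a operator_of_coeff[OF hom] quotient_class_elementary_vac[OF False]
          using A_elementary_0[OF A_total_mem[OF hom]] by simp
      qed
    qed simp
  next
    case (add x y)
    then show ?case by (simp add: coeff_operator_of_add)
  qed
  show "coeff (operator_of G \<rho>) (g v) a w =
    s (exp (- 2 * of_real pi * \<i> / of_nat T) powi a) (coeff (operator_of G \<rho>) v a w)"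
    if "w \<in> total_space G" for w v a
    using s A_graded that
  proof (induction w rule: total_space_induct)
    case (hom m w)
    show ?case
    proof (rule coeff_operator_of_cases[OF hom, of a])
      fix k assume a: "a = int k - int m"
      show ?thesis
        unfolding a operator_of_coeff[OF hom] quotient_class_elementary_g
        by (rule A_elementary_scale[OF A_total_mem[OF hom]])
    qed simp
  next
    case (add x y)
    then show ?case by (simp add: coeff_operator_of_add W.scale_right_distrib)
  qed
qed

interpretation Q: graded_operators scale mode vac g T s G "operator_of G \<rho>"
  by (rule graded_operators_operator_of)

theorem graded_phi_module_operator_of: "graded_phi_module s G (operator_of G \<rho>)"
proof (rule Q.graded_phi_moduleI)
  show Q.product_formula
    unfolding Q.product_formula_def
  proof (intro allI ballI)
    fix u v m p n w assume w: "w \<in> G m"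
    let ?x = "\<rho> (quotient_class (elementary p m v)) w"
    have x: "?x \<in> G p" by (rule A_elementary_degree[OF w])
    show "coeff (operator_of G \<rho>) u (int n - int p) (coeff (operator_of G \<rho>) v (int p - int m) w) =
      coeff (operator_of G \<rho>) (bullet m p n u v) (int n - int m) w"
      \<comment> \<open>The product formula is the module law for the product of two elementary
        matrices.\<close>
      unfolding operator_of_coeff[OF w] operator_of_coeff[OF x] elementary_mult[symmetric]
      by (rule A_mult_left[OF elementary_closed elementary_closed A_total_mem[OF w], symmetric])
  qed
  show Q.residues_vanish
    unfolding Q.residues_vanish_def
  proof (intro allI ballI impI)
    fix r u v m n t w
    assume r: "r < T" and u: "u \<in> eigenspace r" and t: "degree_bound r m n \<le> t" and w: "w \<in> G m"
    show "coeff (operator_of G \<rho>) (residue_product (twist_power r m) (t + 1) u v) (int n - int m) w = 0"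
      unfolding operator_of_coeff[OF w] quotient_class_elementary_residue_product[OF r u t]
      by (rule A_elementary_0[OF A_total_mem[OF w]])
  qed
qed

text \<open>The action of an infinite matrix is not determined by its entries through linearity. On
  degree m/T unitality permits inserting \<open>elementary m m vac\<close>, after which only a
  finite column is left.\<close>

lemma theta_operator_of:
  assumes a: "a \<in> carrier matrix_algebra" and w: "w \<in> total_space G"
  shows "theta G (operator_of G \<rho>) a w = \<rho> (quotient_class a) w"
  using s A_graded w
proof (induction w rule: total_space_induct)
  case (hom m w)
  have w: "w \<in> total_space G" by (rule A_total_mem[OF hom])
  define b where "b = (\<lambda>K i j. if j = m \<and> i \<in> K then a i m else 0)"
  define N where "N = {k. a k m \<noteq> 0}"
  have N: "finite N" using a by (simp add: N_def carrier_matrix)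
  have b: "b K \<in> carrier matrix_algebra \<and>
    \<rho> (quotient_class (b K)) w = (\<Sum>k\<in>K. \<rho> (quotient_class (elementary k m (a k m))) w)" if "finite K" for K
    using that
  proof (induction K rule: finite_induct)
    case empty
    have "b {} = elementary m m 0" by (simp add: b_def elementary_0)
    then show ?case using elementary_closed A_elementary_0[OF w] by simp
  next
    case (insert k K)
    have "b (insert k K) = (\<lambda>i j. elementary k m (a k m) i j + b K i j)"
      using insert(2) by (auto simp: b_def elementary_def fun_eq_iff)
    then show ?case
      using insert matrix_add_closed[OF elementary_closed, of "b K"] A_add[OF elementary_closed, of "b K"]
        A_add_left[OF elementary_closed _ w, of "b K"] by simp
  qed
  have "\<rho> (quotient_class a) w = \<rho> (quotient_class a) (\<rho> (quotient_class (elementary m m vac)) w)"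
    by (simp only: A_elementary_vac[OF hom])
  also have "\<dots> = \<rho> (quotient_class (\<lambda>i j. if j = m then a i m else 0)) w"
    by (simp only: A_mult_left[OF a elementary_closed w, symmetric] quotient_class_column[OF a])
  also have "(\<lambda>i j. if j = m then a i m else 0) = b N"
    by (auto simp: b_def N_def fun_eq_iff)
  also have "\<rho> (quotient_class (b N)) w = (\<Sum>k\<in>N. coeff (operator_of G \<rho>) (a k m) (int k - int m) w)"
    using b[OF N] by (simp add: operator_of_coeff[OF hom])
  also have "\<dots> = theta G (operator_of G \<rho>) a w"
    unfolding Q.theta_hom[OF hom]
    by (rule Sum_any.expand_superset[symmetric, OF N]) (use w in \<open>auto simp: N_def\<close>)
  finally show ?case ..
next
  case (add x y)
  then show ?case by (simp add: Q.theta_add_right[OF a] A_add_right[OF a])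
qed

lemma A_module_of_operator_of: "A_module_of (G, operator_of G \<rho>) = (G, \<rho>)"
proof (rule prod_eqI)
  show "snd (A_module_of (G, operator_of G \<rho>)) = snd (G, \<rho>)"
  proof (rule ext)
    fix X
    show "snd (A_module_of (G, operator_of G \<rho>)) X = snd (G, \<rho>) X"
    proof (cases "X \<in> carrier A_algebra")
      case True
      then obtain a where a: "a \<in> carrier matrix_algebra" "X = quotient_class a" by (elim carrier_AE)
      have "theta G (operator_of G \<rho>) a = \<rho> (quotient_class a)"
      proof (rule ext)
        fix w
        show "theta G (operator_of G \<rho>) a w = \<rho> (quotient_class a) w"
        proof (cases "w \<in> total_space G")
          case True
          then show ?thesis by (rule theta_operator_of[OF a(1)])
        next
          case False
          \<comment> \<open>Off the total space both maps are \<open>undefined\<close>, so they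
            agree as functions.\<close>
          then show ?thesis using A_linear[OF a(1)]
            by (auto simp: linear_maps_def PiE_def extensional_def theta_def)
        qed
      qed
      then show ?thesis
        unfolding a(2) A_module_of_class[OF s graded_phi_module_operator_of a(1)] by simp
    next
      case False
      then show ?thesis
        using A_unital unfolding unital_module_def
        by (auto simp: A_module_of_def PiE_def extensional_def)
    qed
  qed
qed simp

end

lemma operator_of_A_module_of:
  assumes s: "vector_space s" and phi: "graded_phi_module s G Y"
  shows "operator_of G (snd (A_module_of (G, Y))) = Y"
proof (intro ext)
  fix v j w
  interpret P: graded_operators scale mode vac g T s G Y by (rule graded_phi_moduleD[OF s phi])
  note mod = graded_A_module_A_module_of[OF s phi]
  show "operator_of G (snd (A_module_of (G, Y))) v j w = Y v j w"
  proof (cases "w \<in> total_space G")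
    case True
    from s P.graded True show ?thesis
    proof (induction w rule: total_space_induct)
      case (hom m w)
      show ?case
      proof (cases "int m - j - int T \<ge> 0")
        case True
        have "operator_of G (snd (A_module_of (G, Y))) v j w = theta G Y (elementary (nat (int m - j - int T)) m v) w"
          using True by (simp add: operator_of_hom[OF s mod hom] A_module_of_class[OF s phi elementary_closed])
        also have "\<dots> = Y v j w"
          unfolding P.theta_elementary[OF P.total_mem[OF hom]] using True
          by (simp add: component_single[OF s P.graded hom] coeff_def)
        finally show ?thesis .
      next
        case False
        then show ?thesis using P.Y_degree[OF hom, of j v] by (simp add: operator_of_hom[OF s mod hom])
      qed
    next
      case (add x y)
      then show ?case by (simp add: operator_of_add[OF s mod] P.Y_add)
    qed
  next
    case False
    then show ?thesis using P.Y_linear[of v j]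
      by (auto simp: operator_of_def linear_maps_def PiE_def extensional_def)
  qed
qed

end

section \<open>The isomorphism of categories\<close>

lemma graded_linear_mapsD:
  assumes s: "vector_space s" and G: "graded_space s G" and f: "f \<in> graded_linear_maps s G H"
  shows "w \<in> G n \<Longrightarrow> f w \<in> H n" "w \<in> total_space G \<Longrightarrow> f w \<in> total_space H"
    "x \<in> total_space G \<Longrightarrow> y \<in> total_space G \<Longrightarrow> f (x + y) = f x + f y" "f 0 = 0"
    "f \<in> extensional (total_space G)"
proof -
  interpret vector_space s by (rule s)
  show "w \<in> G n \<Longrightarrow> f w \<in> H n" "w \<in> total_space G \<Longrightarrow> f w \<in> total_space H"
    "x \<in> total_space G \<Longrightarrow> y \<in> total_space G \<Longrightarrow> f (x + y) = f x + f y" "f \<in> extensional (total_space G)"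
    using f by (auto simp: graded_linear_maps_def linear_maps_def image_subset_iff PiE_def)
  have 0: "0 \<in> total_space G" by (rule subspace_0[OF subspace_total_space[OF s G]])
  have "f (s 0 0) = s 0 (f 0)" using f 0 unfolding graded_linear_maps_def linear_maps_def by blast
  then show "f 0 = 0" by simp
qed

lemma graded_linear_maps_id:
  assumes s: "vector_space s" and G: "graded_space s G"
  shows "(\<lambda>w\<in>total_space G. w) \<in> graded_linear_maps s G G"
proof -
  interpret vector_space s by (rule s)
  note tot = subspace_total_space[OF s G]
  show ?thesis
    using total_space_mem[OF s G]
    by (auto simp: graded_linear_maps_def linear_maps_def subspace_add[OF tot] subspace_scale[OF tot])
qed

lemma graded_linear_maps_compose:
  assumes s: "vector_space s" and G: "graded_space s G"
    and f: "f \<in> graded_linear_maps s G H" and h: "h \<in> graded_linear_maps s H K"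
  shows "compose (total_space G) h f \<in> graded_linear_maps s G K"
proof -
  interpret vector_space s by (rule s)
  note tot = subspace_total_space[OF s G]
  have f': "f w \<in> total_space H" if "w \<in> total_space G" for w
    using f that by (auto simp: graded_linear_maps_def linear_maps_def)
  show ?thesis
    unfolding graded_linear_maps_def linear_maps_def
  proof (intro CollectI conjI ballI allI)
    show "compose (total_space G) h f \<in> total_space G \<rightarrow>\<^sub>E total_space K"
      using f' h by (auto simp: graded_linear_maps_def linear_maps_def compose_def)
    show "compose (total_space G) h f (x + y) = compose (total_space G) h f x + compose (total_space G) h f y"
      if "x \<in> total_space G" "y \<in> total_space G" for x y
      using that f h f' by (simp add: compose_def subspace_add[OF tot] graded_linear_maps_def linear_maps_def)
    show "compose (total_space G) h f (s c x) = s c (compose (total_space G) h f x)"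
      if "x \<in> total_space G" for c x
      using that f h f' by (simp add: compose_def subspace_scale[OF tot] graded_linear_maps_def linear_maps_def)
    show "compose (total_space G) h f ` G n \<subseteq> K n" for n
      using f h total_space_mem[OF s G] by (auto simp: compose_def graded_linear_maps_def image_subset_iff)
  qed
qed

text \<open>Both categories have this form: \<open>I\<close> is the set of all pairs (v, j) in one
  case and the carrier of the quotient algebra in the other.\<close>

lemma is_category_graded:
  fixes C :: "((nat \<Rightarrow> 'w::ab_group_add set) \<times> 'b, 'w \<Rightarrow> 'w) category"
    and act :: "(nat \<Rightarrow> 'w set) \<times> 'b \<Rightarrow> 'i \<Rightarrow> 'w \<Rightarrow> 'w"
  assumes s: "vector_space s"
    and Obj: "\<And>X. X \<in> Obj C \<Longrightarrow> graded_space s (fst X)"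
    and act: "\<And>X i w. X \<in> Obj C \<Longrightarrow> i \<in> I \<Longrightarrow> w \<in> total_space (fst X) \<Longrightarrow> act X i w \<in> total_space (fst X)"
    and Hom: "\<And>X Y. Hom C X Y = {f \<in> graded_linear_maps s (fst X) (fst Y).
      \<forall>i\<in>I. \<forall>w\<in>total_space (fst X). f (act X i w) = act Y i (f w)}"
    and Idn: "\<And>X. Idn C X = (\<lambda>w\<in>total_space (fst X). w)"
    and Comp: "\<And>X Y Z h f. Comp C X Y Z h f = compose (total_space (fst X)) h f"
  shows "is_category C"
  unfolding is_category_def
proof (intro conjI ballI)
  note D = graded_linear_mapsD[OF s Obj]
  have hom: "f \<in> graded_linear_maps s (fst X) (fst Y)" if "f \<in> Hom C X Y" for f X Y
    using that by (simp add: Hom)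
  have maps: "f \<in> total_space (fst X) \<rightarrow> total_space (fst Y)" "f \<in> extensional (total_space (fst X))"
    if "f \<in> Hom C X Y" "X \<in> Obj C" for f X Y
    using D(2)[OF that(2) hom[OF that(1)]] D(5)[OF that(2) hom[OF that(1)]] by auto
  fix X assume X: "X \<in> Obj C"
  show "Idn C X \<in> Hom C X X"
    using graded_linear_maps_id[OF s Obj[OF X]] act[OF X] by (simp add: Hom Idn)
  fix Y f assume Y: "Y \<in> Obj C" and f: "f \<in> Hom C X Y"
  show "Comp C X X Y f (Idn C X) = f"
    unfolding Comp Idn by (rule compose_Id[OF maps[OF f X]])
  show "Comp C X Y Y (Idn C Y) f = f"
    unfolding Comp Idn by (rule Id_compose[OF maps[OF f X]])
  fix Z h assume Z: "Z \<in> Obj C" and h: "h \<in> Hom C Y Z"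
  show "Comp C X Y Z h f \<in> Hom C X Z"
    unfolding Comp Hom
  proof (intro CollectI conjI ballI)
    show "compose (total_space (fst X)) h f \<in> graded_linear_maps s (fst X) (fst Z)"
      by (rule graded_linear_maps_compose[OF s Obj[OF X] hom[OF f] hom[OF h]])
    fix i w assume i: "i \<in> I" and w: "w \<in> total_space (fst X)"
    have "h (f (act X i w)) = act Z i (h (f w))"
      using f h i w D(2)[OF X hom[OF f] w] by (simp add: Hom)
    then show "compose (total_space (fst X)) h f (act X i w) = act Z i (compose (total_space (fst X)) h f w)"
      using w act[OF X i w] by (simp add: compose_def)
  qed
  fix W k assume "W \<in> Obj C" and "k \<in> Hom C Z W"
  show "Comp C X Y W (Comp C Y Z W k h) f = Comp C X Z W k (Comp C X Y Z h f)"
    unfolding Comp by (rule compose_assoc[OF maps(1)[OF f X], symmetric])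
qed

text \<open>Both functors are the identity on maps, so it is enough to have mutually inverse maps on
  objects that preserve hom-sets, identities and composition.\<close>

lemma is_category_isomorphismI:
  assumes C: "is_category C" and D: "is_category D"
    and F: "\<And>X. X \<in> Obj C \<Longrightarrow> F X \<in> Obj D" and G: "\<And>X. X \<in> Obj D \<Longrightarrow> G X \<in> Obj C"
    and GF: "\<And>X. X \<in> Obj C \<Longrightarrow> G (F X) = X" and FG: "\<And>X. X \<in> Obj D \<Longrightarrow> F (G X) = X"
    and Hom: "\<And>X Y. X \<in> Obj C \<Longrightarrow> Y \<in> Obj C \<Longrightarrow> Hom D (F X) (F Y) = Hom C X Y"
    and Idn: "\<And>X. X \<in> Obj C \<Longrightarrow> Idn D (F X) = Idn C X"
    and Comp: "\<And>X Y Z h f. X \<in> Obj C \<Longrightarrow> Comp D (F X) (F Y) (F Z) h f = Comp C X Y Z h f"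
  shows "is_category_isomorphism C D F (\<lambda>X Y f. f)"
proof -
  have Hom': "Hom C (G X) (G Y) = Hom D X Y" if "X \<in> Obj D" "Y \<in> Obj D" for X Y
    using Hom[OF G[OF that(1)] G[OF that(2)]] that by (simp add: FG)
  have Idn': "Idn C (G X) = Idn D X" if "X \<in> Obj D" for X
    using Idn[OF G[OF that]] that by (simp add: FG)
  have Comp': "Comp C (G X) (G Y) (G Z) h f = Comp D X Y Z h f"
    if "X \<in> Obj D" "Y \<in> Obj D" "Z \<in> Obj D" for X Y Z h f
    using Comp[OF G[OF that(1)], of "G Y" "G Z" h f] that by (simp add: FG)
  have "is_functor C D F (\<lambda>X Y f. f)"
    unfolding is_functor_def using C D F Hom Idn Comp by simp
  moreover have "is_functor D C G (\<lambda>X Y f. f)"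
    unfolding is_functor_def using C D G Hom' Idn' Comp' by simp
  ultimately show ?thesis
    unfolding is_category_isomorphism_def using GF FG
    by (intro conjI exI[of _ G] exI[of _ "\<lambda>X Y f. f"]) auto
qed

context vertex_algebra_with_automorphism
begin

text \<open>On homogeneous vectors \<open>theta\<close> is a finite sum of the operators, and
  conversely each operator is there 0 or the action of an elementary matrix. So a graded linear map
  commutes with one family if and only if it commutes with the other.\<close>

lemma morphism_iff:
  assumes s: "vector_space s" and phi: "graded_phi_module s G Y" and phi': "graded_phi_module s H Z"
    and f: "f \<in> graded_linear_maps s G H"
  shows "(\<forall>v j. \<forall>w\<in>total_space G. f (Y v j w) = Z v j (f w)) \<longleftrightarrow>
    (\<forall>X\<in>carrier A_algebra. \<forall>w\<in>total_space G.
      f (snd (A_module_of (G, Y)) X w) = snd (A_module_of (H, Z)) X (f w))"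
proof -
  interpret P: graded_operators scale mode vac g T s G Y by (rule graded_phi_moduleD[OF s phi])
  interpret P': graded_operators scale mode vac g T s H Z by (rule graded_phi_moduleD[OF s phi'])
  note f' = graded_linear_mapsD[OF s P.graded f]
  have "(\<forall>X\<in>carrier A_algebra. \<forall>w\<in>total_space G.
      f (snd (A_module_of (G, Y)) X w) = snd (A_module_of (H, Z)) X (f w)) \<longleftrightarrow>
    (\<forall>a\<in>carrier matrix_algebra. \<forall>w\<in>total_space G. f (theta G Y a w) = theta H Z a (f w))"
    unfolding carrier_A ball_simps
    by (simp add: A_module_of_class[OF s phi] A_module_of_class[OF s phi'])
  also have "\<dots> \<longleftrightarrow> (\<forall>v j. \<forall>w\<in>total_space G. f (Y v j w) = Z v j (f w))"
  proof (intro iffI ballI allI)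
    fix a w
    assume eq: "\<forall>v j. \<forall>w\<in>total_space G. f (Y v j w) = Z v j (f w)"
      and a: "a \<in> carrier matrix_algebra" and w: "w \<in> total_space G"
    have eq': "f (coeff Y v c w) = coeff Z v c (f w)" if "w \<in> total_space G" for v c w
      using eq that by (simp add: coeff_def)
    from s P.graded w show "f (theta G Y a w) = theta H Z a (f w)"
    proof (induction w rule: total_space_induct)
      case (hom m w)
      have w: "w \<in> total_space G" by (rule P.total_mem[OF hom])
      have "f (theta G Y a w) = Sum_any (\<lambda>k. f (coeff Y (a k m) (int k - int m) w))"
        unfolding P.theta_hom[OF hom]
        by (rule Sum_any_hom(1)[where S = "total_space G", OF P.finite_theta[OF a w] P.coeff_closed[OF w] P.total_0
            P.W.subspace_add[OF P.subspace_total] f'(4) f'(3)])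
      then show ?case
        unfolding P'.theta_hom[OF f'(1)[OF hom]] by (simp add: eq'[OF w])
    next
      case (add x y)
      then show ?case
        by (simp add: P.theta_add_right[OF a] P'.theta_add_right[OF a] f' P.theta_closed)
    qed
  next
    fix v j w
    assume eq: "\<forall>a\<in>carrier matrix_algebra. \<forall>w\<in>total_space G. f (theta G Y a w) = theta H Z a (f w)"
      and w: "w \<in> total_space G"
    from s P.graded w show "f (Y v j w) = Z v j (f w)"
    proof (induction w rule: total_space_induct)
      case (hom m w)
      have w: "w \<in> total_space G" by (rule P.total_mem[OF hom])
      show ?case
      proof (cases "int m - j - int T \<ge> 0")
        case True
        let ?e = "elementary (nat (int m - j - int T)) m v"
        have "f (theta G Y ?e w) = theta H Z ?e (f w)"
          using eq elementary_closed w by blast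
        then show ?thesis
          unfolding P.theta_elementary[OF w] P'.theta_elementary[OF f'(2)[OF w]]
            component_single[OF s P.graded hom] component_single[OF s P'.graded f'(1)[OF hom]]
          using True by (simp add: coeff_def)
      next
        case False
        then show ?thesis
          using P.Y_degree[OF hom, of j v] P'.Y_degree[OF f'(1)[OF hom], of j v] f'(4) by simp
      qed
    next
      case (add x y)
      then show ?case by (simp add: P.Y_add P'.Y_add f' P.Y_closed)
    qed
  qed
  finally show ?thesis ..
qed

lemma is_category_phi_module_category:
  fixes s :: "complex \<Rightarrow> 'w::ab_group_add \<Rightarrow> 'w"
  assumes s: "vector_space s"
  shows "is_category (phi_module_category s)"
proof (rule is_category_graded[where act = "\<lambda>X (v, j). snd X v j" and I = UNIV, OF s])
  fix X :: "(nat \<Rightarrow> 'w set) \<times> ('v \<Rightarrow> int \<Rightarrow> 'w \<Rightarrow> 'w)"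
  assume "X \<in> Obj (phi_module_category s)"
  then have phi: "graded_phi_module s (fst X) (snd X)" by (auto simp: phi_module_category_def)
  interpret P: graded_operators scale mode vac g T s "fst X" "snd X" by (rule graded_phi_moduleD[OF s phi])
  show "graded_space s (fst X)" by (rule P.graded)
  show "(case i of (v, j) \<Rightarrow> snd X v j) w \<in> total_space (fst X)" if "w \<in> total_space (fst X)" for i w
    using P.Y_closed[OF that] by (cases i) simp
qed (auto simp: phi_module_category_def split_beta)

lemma is_category_A_module_category:
  fixes s :: "complex \<Rightarrow> 'w::ab_group_add \<Rightarrow> 'w"
  assumes s: "vector_space s"
  shows "is_category (A_module_category s)"
proof (rule is_category_graded[where act = snd and I = "carrier A_algebra", OF s])
  fix X :: "(nat \<Rightarrow> 'w set) \<times> ((nat \<Rightarrow> nat \<Rightarrow> 'v) set \<Rightarrow> 'w \<Rightarrow> 'w)"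
  assume "X \<in> Obj (A_module_category s)"
  then have mod: "graded_A_module s (fst X) (snd X)" by (auto simp: A_module_category_def)
  show "graded_space s (fst X)" by (rule A_graded[OF s mod])
  show "snd X i w \<in> total_space (fst X)" if "i \<in> carrier A_algebra" "w \<in> total_space (fst X)" for i w
    using that A_closed[OF s mod] by (elim carrier_AE) simp
qed (auto simp: A_module_category_def split_beta)

theorem A_module_of_isomorphism:
  fixes s :: "complex \<Rightarrow> 'w::ab_group_add \<Rightarrow> 'w"
  assumes s: "vector_space s"
  shows "is_category_isomorphism (phi_module_category s) (A_module_category s) A_module_of (\<lambda>X Y f. f)"
proof (rule is_category_isomorphismI[where G = "\<lambda>(G, \<rho>). (G, operator_of G \<rho>)"])
  let ?C = "phi_module_category s" and ?D = "A_module_category s"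
  have C: "X \<in> Obj ?C \<longleftrightarrow> graded_phi_module s (fst X) (snd X)"
    for X :: "(nat \<Rightarrow> 'w set) \<times> ('v \<Rightarrow> int \<Rightarrow> 'w \<Rightarrow> 'w)" by (auto simp: phi_module_category_def)
  have D: "X \<in> Obj ?D \<longleftrightarrow> graded_A_module s (fst X) (snd X)"
    for X :: "(nat \<Rightarrow> 'w set) \<times> ((nat \<Rightarrow> nat \<Rightarrow> 'v) set \<Rightarrow> 'w \<Rightarrow> 'w)" by (auto simp: A_module_category_def)
  show "is_category ?C" by (rule is_category_phi_module_category[OF s])
  show "is_category ?D" by (rule is_category_A_module_category[OF s])
  show "A_module_of X \<in> Obj ?D" if "X \<in> Obj ?C" for X
    using graded_A_module_A_module_of[OF s, of "fst X" "snd X"] that by (simp add: C D)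
  show "(case X of (G, \<rho>) \<Rightarrow> (G, operator_of G \<rho>)) \<in> Obj ?C" if "X \<in> Obj ?D" for X
    using graded_phi_module_operator_of[OF s, of "fst X" "snd X"] that by (simp add: C D split_beta)
  show "(case A_module_of X of (G, \<rho>) \<Rightarrow> (G, operator_of G \<rho>)) = X" if "X \<in> Obj ?C" for X
    using operator_of_A_module_of[OF s, of "fst X" "snd X"] that by (simp add: C split_beta)
  show "A_module_of (case X of (G, \<rho>) \<Rightarrow> (G, operator_of G \<rho>)) = X" if "X \<in> Obj ?D" for X
    using A_module_of_operator_of[OF s, of "fst X" "snd X"] that by (simp add: D split_beta)
  show "Hom ?D (A_module_of X) (A_module_of X') = Hom ?C X X'" if X: "X \<in> Obj ?C" and X': "X' \<in> Obj ?C" for X X'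
  proof -
    have "Hom ?D (A_module_of X) (A_module_of X') = {f \<in> graded_linear_maps s (fst X) (fst X').
      \<forall>x\<in>carrier A_algebra. \<forall>w\<in>total_space (fst X).
        f (snd (A_module_of X) x w) = snd (A_module_of X') x (f w)}"
      by (simp add: A_module_category_def split_beta)
    also have "\<dots> = {f \<in> graded_linear_maps s (fst X) (fst X').
      \<forall>v j. \<forall>w\<in>total_space (fst X). f (snd X v j w) = snd X' v j (f w)}"
      using morphism_iff[OF s X[unfolded C] X'[unfolded C]] by (intro Collect_cong conj_cong refl) simp
    also have "\<dots> = Hom ?C X X'"
      by (simp add: phi_module_category_def split_beta)
    finally show ?thesis .
  qed
  show "Idn ?D (A_module_of X) = Idn ?C X" for X
    by (simp add: A_module_category_def phi_module_category_def split_beta)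
  show "Comp ?D (A_module_of X) (A_module_of X') (A_module_of X'') h f = Comp ?C X X' X'' h f" for X X' X'' h f
    by (simp add: A_module_category_def phi_module_category_def split_beta)
qed

end

theorem theorem4p12:
  fixes scale :: "complex \<Rightarrow> 'v::ab_group_add \<Rightarrow> 'v"
    and mode :: "'v \<Rightarrow> int \<Rightarrow> 'v \<Rightarrow> 'v"
    and vac :: 'v
    and g :: "'v \<Rightarrow> 'v"
    and T :: nat
    and s :: "complex \<Rightarrow> 'w::ab_group_add \<Rightarrow> 'w"
  assumes "vertex_algebra_with_automorphism scale mode vac g T"
    and "vector_space s"
  shows "is_category_isomorphism
    (vertex_algebra_with_automorphism.phi_module_category scale mode vac g T s)
    (vertex_algebra_with_automorphism.A_module_category scale mode vac g T s)
    (vertex_algebra_with_automorphism.A_module_of scale mode vac g T)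
    (\<lambda>X Y f. f)"
  using assms by (rule vertex_algebra_with_automorphism.A_module_of_isomorphism)

end
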